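(* Let $K$ be an algebraically closed field, let $d \geq 2$ be an integer, let $V_1,\ldots,V_d$ be vector spaces over $K$ of (finite) dimensions $n_1,\ldots,n_d$, respectively, and let $r$ be a nonnegative integer. Set $s:=\lfloor r/d \rfloor$. Then the locus $X_{\geq r} \subseteq V_1 \otimes \cdots \otimes V_d$ of tensors of border subrank $\geq r$ has dimension at most \[ n_1 \cdots n_d - s^d + \sum_{i=1}^d 2 s(n_i-s) + r \left(1 + d(r-1) + \sum_{i=1}^d (n_i-r) \right). \]
   Context: For a nonnegative integer $r$, let $e_1,\ldots,e_r$ be the standard basis of $K^r$; the $r$-th unit tensor is $I_r := \sum_{i=1}^r e_i^{\otimes d} \in (K^r)^{\otimes d}$. The border subrank of a tensor $T \in V_1 \otimes \cdots \otimes V_d$ is the maximal $r$ for which $I_r$ lies in the Zariski closure (in $(K^r)^{\otimes d}$) of the set $\{(\phi_1 \otimes \cdots \otimes \phi_d)T \mid \phi_i \in \mathrm{Hom}(V_i,K^r),\ i=1,\ldots,d\}$. The set $X_{\geq r}$ is constructible; its dimension is the dimension of its Zariski closure, with the convention that the empty set has dimension $-\infty$. *)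

theory Defs
  imports
    "HOL-Analysis.Analysis"
    "HOL-Computational_Algebra.Polynomial"
    "HOL-Library.Function_Algebras"
begin

text \<open>
  A family of vector spaces over a field is a family of subspaces \<open>V i\<close>
  of one ambient vector space with scalar multiplication \<open>scl\<close>; any
  family of vector spaces has this form inside its direct sum.  Tensor factors
  are indexed by \<open>{1..d}\<close>.
\<close>

definition fun_scale :: "'k::field \<Rightarrow> ('x \<Rightarrow> 'k) \<Rightarrow> ('x \<Rightarrow> 'k)" where
  "fun_scale c f = (\<lambda>x. c * f x)"

lemma vector_space_fun_scale: "vector_space fun_scale"
  by unfold_locales (auto simp: fun_scale_def fun_eq_iff algebra_simps)

definition Hom_space ::
  "('k::field \<Rightarrow> 'v::ab_group_add \<Rightarrow> 'v) \<Rightarrow> 'v set \<Rightarrow>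
   ('k \<Rightarrow> 'w::ab_group_add \<Rightarrow> 'w) \<Rightarrow> 'w set \<Rightarrow> ('v \<Rightarrow> 'w) set" where
  "Hom_space s1 V s2 W =
     {f \<in> V \<rightarrow> W. (\<forall>x\<in>V. \<forall>y\<in>V. f (x + y) = f x + f y) \<and>
                  (\<forall>c. \<forall>x\<in>V. f (s1 c x) = s2 c (f x))}"


subsection \<open>Tensor products\<close>

definition multilinear_forms ::
  "nat \<Rightarrow> ('k::field \<Rightarrow> 'v::ab_group_add \<Rightarrow> 'v) \<Rightarrow> (nat \<Rightarrow> 'v set) \<Rightarrow>
   ((nat \<Rightarrow> 'v) \<Rightarrow> 'k) set" where
  "multilinear_forms d scl V =
     {f \<in> extensional (Pi\<^sub>E {1..d} V).
        \<forall>v \<in> Pi\<^sub>E {1..d} V. \<forall>i\<in>{1..d}.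
          (\<lambda>x. f (v(i := x))) \<in> Hom_space scl (V i) (*) UNIV}"

text \<open>
  Over a field, the canonical map from \<open>V 1 \<otimes> \<dots> \<otimes> V d\<close> to the dual of the space of
  multilinear forms, sending \<open>v 1 \<otimes> \<dots> \<otimes> v d\<close> to evaluation at \<open>v\<close>, is
  injective.  The tensor product is realised as its image, i.e. as the span of these
  evaluations.
\<close>

definition pure_tensor ::
  "nat \<Rightarrow> ('k::field \<Rightarrow> 'v::ab_group_add \<Rightarrow> 'v) \<Rightarrow> (nat \<Rightarrow> 'v set) \<Rightarrow>
   (nat \<Rightarrow> 'v) \<Rightarrow> (((nat \<Rightarrow> 'v) \<Rightarrow> 'k) \<Rightarrow> 'k)" where
  "pure_tensor d scl V v =
     (\<lambda>f. if f \<in> multilinear_forms d scl V then f v else 0)"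

definition tensor_space ::
  "nat \<Rightarrow> ('k::field \<Rightarrow> 'v::ab_group_add \<Rightarrow> 'v) \<Rightarrow> (nat \<Rightarrow> 'v set) \<Rightarrow>
   (((nat \<Rightarrow> 'v) \<Rightarrow> 'k) \<Rightarrow> 'k) set" where
  "tensor_space d scl V =
     module.span fun_scale (pure_tensor d scl V ` Pi\<^sub>E {1..d} V)"

text \<open>
  The map \<open>\<phi> 1 \<otimes> \<dots> \<otimes> \<phi> d\<close> is dual to the pullback of multilinear forms along
  \<open>\<phi> 1 \<times> \<dots> \<times> \<phi> d\<close>; see \<open>tensor_map_pure_tensor\<close> below.
\<close>

definition tensor_map ::
  "nat \<Rightarrow> (nat \<Rightarrow> 'v set) \<Rightarrow> ('k::field \<Rightarrow> 'w::ab_group_add \<Rightarrow> 'w) \<Rightarrow> (nat \<Rightarrow> 'w set) \<Rightarrow>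
   (nat \<Rightarrow> 'v \<Rightarrow> 'w) \<Rightarrow> (((nat \<Rightarrow> 'v) \<Rightarrow> 'k) \<Rightarrow> 'k) \<Rightarrow> (((nat \<Rightarrow> 'w) \<Rightarrow> 'k) \<Rightarrow> 'k)" where
  "tensor_map d V scl' W \<phi> T =
     (\<lambda>g. if g \<in> multilinear_forms d scl' W
          then T (\<lambda>v\<in>Pi\<^sub>E {1..d} V. g (\<lambda>i\<in>{1..d}. \<phi> i (v i)))
          else 0)"

lemma pullback_multilinear_form:
  assumes V: "vector_space scl" "\<And>i. i \<in> {1..d} \<Longrightarrow> module.subspace scl (V i)"
    and \<phi>: "\<And>i. i \<in> {1..d} \<Longrightarrow> \<phi> i \<in> Hom_space scl (V i) scl' (W i)"
    and g: "g \<in> multilinear_forms d scl' W"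
  shows "(\<lambda>v\<in>Pi\<^sub>E {1..d} V. g (\<lambda>i\<in>{1..d}. \<phi> i (v i))) \<in> multilinear_forms d scl V"
proof -
  interpret vector_space scl by fact
  define h where "h = (\<lambda>v\<in>Pi\<^sub>E {1..d} V. g (\<lambda>i\<in>{1..d}. \<phi> i (v i)))"
  have "(\<lambda>x. h (v(i := x))) \<in> Hom_space scl (V i) (*) UNIV"
    if v: "v \<in> Pi\<^sub>E {1..d} V" and i: "i \<in> {1..d}" for v i
  proof -
    define w where "w = (\<lambda>j\<in>{1..d}. \<phi> j (v j))"
    have w: "w \<in> Pi\<^sub>E {1..d} W"
      using v \<phi> by (auto simp: w_def Hom_space_def PiE_iff Pi_iff)
    have lin: "(\<lambda>y. g (w(i := y))) \<in> Hom_space scl' (W i) (*) UNIV"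
      using g w i by (auto simp: multilinear_forms_def)
    have eq: "h (v(i := x)) = g (w(i := \<phi> i x))" if x: "x \<in> V i" for x
    proof -
      have "v(i := x) \<in> Pi\<^sub>E {1..d} V"
        using v i x by (auto simp: PiE_iff extensional_def)
      moreover have "(\<lambda>j\<in>{1..d}. \<phi> j ((v(i := x)) j)) = w(i := \<phi> i x)"
        using i by (auto simp: w_def fun_eq_iff)
      ultimately show ?thesis by (simp add: h_def)
    qed
    have sub: "module.subspace scl (V i)" using V(2) i by blast
    show ?thesis
      using lin \<phi>[OF i] subspace_add[OF sub] subspace_scale[OF sub]
      by (auto simp: Hom_space_def eq Pi_iff simp del: fun_upd_apply)
  qed
  moreover have "h \<in> extensional (Pi\<^sub>E {1..d} V)"
    by (simp add: h_def)
  ultimately show ?thesis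
    unfolding h_def[symmetric] multilinear_forms_def by blast
qed

lemma tensor_map_pure_tensor:
  assumes "vector_space scl" "\<And>i. i \<in> {1..d} \<Longrightarrow> module.subspace scl (V i)"
    and "\<And>i. i \<in> {1..d} \<Longrightarrow> \<phi> i \<in> Hom_space scl (V i) scl' (W i)"
    and "v \<in> Pi\<^sub>E {1..d} V"
  shows "tensor_map d V scl' W \<phi> (pure_tensor d scl V v) =
         pure_tensor d scl' W (\<lambda>i\<in>{1..d}. \<phi> i (v i))"
proof
  fix g
  show "tensor_map d V scl' W \<phi> (pure_tensor d scl V v) g =
        pure_tensor d scl' W (\<lambda>i\<in>{1..d}. \<phi> i (v i)) g"
    using pullback_multilinear_form[where d=d and \<phi>=\<phi> and g=g, OF assms(1,2,3)] assms(4)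
    by (simp add: tensor_map_def pure_tensor_def)
qed


subsection \<open>The Zariski topology on a vector space and dimension\<close>

text \<open>
  Polynomial functions on a vector space \<open>W\<close>, without a choice of coordinates: the
  algebra of functions generated by the constants and the linear forms on \<open>W\<close>.  Only
  the values on \<open>W\<close> are relevant.
\<close>

inductive_set polynomial_functions ::
  "('k::field \<Rightarrow> 'w::ab_group_add \<Rightarrow> 'w) \<Rightarrow> 'w set \<Rightarrow> ('w \<Rightarrow> 'k) set"
  for scl :: "'k \<Rightarrow> 'w \<Rightarrow> 'w" and W :: "'w set" where
  const: "(\<lambda>_. c) \<in> polynomial_functions scl W"
| linear: "l \<in> Hom_space scl W (*) UNIV \<Longrightarrow> l \<in> polynomial_functions scl W"
| add: "\<lbrakk>f \<in> polynomial_functions scl W; g \<in> polynomial_functions scl W\<rbrakk>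
        \<Longrightarrow> (\<lambda>x. f x + g x) \<in> polynomial_functions scl W"
| mult: "\<lbrakk>f \<in> polynomial_functions scl W; g \<in> polynomial_functions scl W\<rbrakk>
        \<Longrightarrow> (\<lambda>x. f x * g x) \<in> polynomial_functions scl W"

definition zariski_closed ::
  "('k::field \<Rightarrow> 'w::ab_group_add \<Rightarrow> 'w) \<Rightarrow> 'w set \<Rightarrow> 'w set \<Rightarrow> bool" where
  "zariski_closed scl W Z \<longleftrightarrow>
     (\<exists>F \<subseteq> polynomial_functions scl W. Z = {x \<in> W. \<forall>f\<in>F. f x = 0})"

definition zariski_topology ::
  "('k::field \<Rightarrow> 'w::ab_group_add \<Rightarrow> 'w) \<Rightarrow> 'w set \<Rightarrow> 'w topology" where
  "zariski_topology scl W = topology (\<lambda>U. U \<subseteq> W \<and> zariski_closed scl W (W - U))"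

lemma zariski_closed_empty: "zariski_closed scl W {}"
  unfolding zariski_closed_def
  using polynomial_functions.const[of 1 scl W] by (intro exI[of _ "{\<lambda>_. 1}"]) simp

lemma zariski_closed_Un:
  assumes "zariski_closed scl W A" "zariski_closed scl W B"
  shows "zariski_closed scl W (A \<union> B)"
proof -
  obtain F G where F: "F \<subseteq> polynomial_functions scl W" "A = {x \<in> W. \<forall>f\<in>F. f x = 0}"
    and G: "G \<subseteq> polynomial_functions scl W" "B = {x \<in> W. \<forall>g\<in>G. g x = 0}"
    using assms by (auto simp: zariski_closed_def)
  let ?H = "(\<lambda>(f, g). \<lambda>x. f x * g x) ` (F \<times> G)"
  have "?H \<subseteq> polynomial_functions scl W"
  proof
    fix h
    assume "h \<in> ?H"
    then obtain f g where "f \<in> F" "g \<in> G" and h: "h = (\<lambda>x. f x * g x)"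
      by auto
    then have "f \<in> polynomial_functions scl W" "g \<in> polynomial_functions scl W"
      using F(1) G(1) by blast+
    then show "h \<in> polynomial_functions scl W"
      unfolding h by (rule polynomial_functions.mult)
  qed
  moreover have "A \<union> B = {x \<in> W. \<forall>h\<in>?H. h x = 0}"
    by (auto simp: F(2) G(2))
  ultimately show ?thesis unfolding zariski_closed_def by (intro exI[of _ ?H] conjI)
qed

lemma zariski_closed_INT:
  assumes "\<And>U. U \<in> \<U> \<Longrightarrow> zariski_closed scl W (W - U)"
  shows "zariski_closed scl W (W - \<Union>\<U>)"
proof -
  have "\<forall>U\<in>\<U>. \<exists>F. F \<subseteq> polynomial_functions scl W \<and> W - U = {x \<in> W. \<forall>f\<in>F. f x = 0}"
    using assms by (auto simp: zariski_closed_def)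
  from bchoice[OF this] obtain F
    where F: "\<forall>U\<in>\<U>. F U \<subseteq> polynomial_functions scl W \<and> W - U = {x \<in> W. \<forall>f\<in>F U. f x = 0}" ..
  have "(\<Union>U\<in>\<U>. F U) \<subseteq> polynomial_functions scl W"
    using F by blast
  moreover have "x \<in> W - \<Union>\<U> \<longleftrightarrow> x \<in> W \<and> (\<forall>f\<in>(\<Union>U\<in>\<U>. F U). f x = 0)" for x
  proof -
    have "x \<in> W - U \<longleftrightarrow> x \<in> W \<and> (\<forall>f\<in>F U. f x = 0)" if "U \<in> \<U>" for U
      using bspec[OF F that] by simp
    then show ?thesis by blast
  qed
  then have "W - \<Union>\<U> = {x \<in> W. \<forall>f\<in>(\<Union>U\<in>\<U>. F U). f x = 0}"
    by (intro set_eqI) (simp only: mem_Collect_eq)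
  ultimately show ?thesis
    unfolding zariski_closed_def by (intro exI[of _ "\<Union>U\<in>\<U>. F U"] conjI)
qed

lemma zariski_closed_subset: "zariski_closed scl W Z \<Longrightarrow> Z \<subseteq> W"
  by (auto simp: zariski_closed_def)

lemma openin_zariski_topology:
  "openin (zariski_topology scl W) U \<longleftrightarrow> U \<subseteq> W \<and> zariski_closed scl W (W - U)"
proof -
  have "istopology (\<lambda>U. U \<subseteq> W \<and> zariski_closed scl W (W - U))"
    unfolding istopology_def
  proof (intro conjI allI impI)
    fix S T
    assume "S \<subseteq> W \<and> zariski_closed scl W (W - S)" "T \<subseteq> W \<and> zariski_closed scl W (W - T)"
    then show "zariski_closed scl W (W - S \<inter> T)"
      by (simp add: Diff_Int zariski_closed_Un)
  next
    fix \<K>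
    assume "\<forall>K\<in>\<K>. K \<subseteq> W \<and> zariski_closed scl W (W - K)"
    then show "zariski_closed scl W (W - \<Union>\<K>)"
      by (intro zariski_closed_INT) blast
  qed blast+
  then show ?thesis
    by (simp add: zariski_topology_def topology_inverse')
qed

lemma topspace_zariski_topology [simp]: "topspace (zariski_topology scl W) = W"
  by (auto simp: topspace_def openin_zariski_topology intro!: exI[of _ W] zariski_closed_empty)

lemma closedin_zariski_topology:
  "closedin (zariski_topology scl W) Z \<longleftrightarrow> zariski_closed scl W Z"
  using zariski_closed_subset[of scl W Z]
  by (auto simp: closedin_def openin_zariski_topology double_diff)

definition irreducible_closedin :: "'a topology \<Rightarrow> 'a set \<Rightarrow> bool" where
  "irreducible_closedin X Z \<longleftrightarrow> closedin X Z \<and> Z \<noteq> {} \<and>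
     (\<forall>A B. closedin X A \<longrightarrow> closedin X B \<longrightarrow> Z = A \<union> B \<longrightarrow> Z = A \<or> Z = B)"

text \<open>
  The Krull dimension of a topological space; the supremum in \<^typ>\<open>ereal\<close> makes the
  dimension of the empty space \<open>-\<infinity>\<close>.
\<close>

definition krull_dim :: "'a topology \<Rightarrow> ereal" where
  "krull_dim X = Sup {ereal (real m) | m.
     \<exists>Z :: nat \<Rightarrow> 'a set. (\<forall>j\<le>m. irreducible_closedin X (Z j)) \<and> (\<forall>j<m. Z j \<subset> Z (Suc j))}"

lemma krull_dim_empty: "topspace X = {} \<Longrightarrow> krull_dim X = -\<infinity>"
proof -
  assume "topspace X = {}"
  then have "\<not> irreducible_closedin X Z" for Z
    by (auto simp: irreducible_closedin_def dest: closedin_subset)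
  then have "{ereal (real m) | m. \<exists>Z :: nat \<Rightarrow> 'a set.
      (\<forall>j\<le>m. irreducible_closedin X (Z j)) \<and> (\<forall>j<m. Z j \<subset> Z (Suc j))} = {}"
    by blast
  then show ?thesis by (simp only: krull_dim_def Sup_empty bot_ereal_def)
qed

definition constructible_dim :: "'a topology \<Rightarrow> 'a set \<Rightarrow> ereal" where
  "constructible_dim X S = krull_dim (subtopology X (X closure_of S))"


subsection \<open>Border subrank\<close>

definition coord_space :: "nat \<Rightarrow> (nat \<Rightarrow> 'k::field) set" where
  "coord_space r = {x. \<forall>j. j \<notin> {1..r} \<longrightarrow> x j = 0}"

definition std_basis :: "nat \<Rightarrow> (nat \<Rightarrow> 'k::field)" where
  "std_basis j = (\<lambda>l. if l = j then 1 else 0)"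

definition coord_tensor_space :: "nat \<Rightarrow> nat \<Rightarrow> (((nat \<Rightarrow> nat \<Rightarrow> 'k::field) \<Rightarrow> 'k) \<Rightarrow> 'k) set" where
  "coord_tensor_space d r = tensor_space d fun_scale (\<lambda>_. coord_space r)"

definition unit_tensor :: "nat \<Rightarrow> nat \<Rightarrow> (((nat \<Rightarrow> nat \<Rightarrow> 'k::field) \<Rightarrow> 'k) \<Rightarrow> 'k)" where
  "unit_tensor d r =
     (\<Sum>j = 1..r. pure_tensor d fun_scale (\<lambda>_. coord_space r) (\<lambda>i\<in>{1..d}. std_basis j))"

definition border_subrank ::
  "nat \<Rightarrow> ('k::field \<Rightarrow> 'v::ab_group_add \<Rightarrow> 'v) \<Rightarrow> (nat \<Rightarrow> 'v set) \<Rightarrow>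
   (((nat \<Rightarrow> 'v) \<Rightarrow> 'k) \<Rightarrow> 'k) \<Rightarrow> nat" where
  "border_subrank d scl V T =
     (GREATEST r. unit_tensor d r \<in>
        zariski_topology fun_scale (coord_tensor_space d r) closure_of
          {tensor_map d V fun_scale (\<lambda>_. coord_space r) \<phi> T | \<phi>.
             \<forall>i\<in>{1..d}. \<phi> i \<in> Hom_space scl (V i) fun_scale (coord_space r)})"

definition border_subrank_locus ::
  "nat \<Rightarrow> ('k::field \<Rightarrow> 'v::ab_group_add \<Rightarrow> 'v) \<Rightarrow> (nat \<Rightarrow> 'v set) \<Rightarrow> nat \<Rightarrow>
   (((nat \<Rightarrow> 'v) \<Rightarrow> 'k) \<Rightarrow> 'k) set" where
  "border_subrank_locus d scl V r =
     {T \<in> tensor_space d scl V. border_subrank d scl V T \<ge> r}"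

end

theory Submission
  imports
    Defs
    "HOL-Library.Poly_Mapping"
    "HOL-Computational_Algebra.Polynomial_Factorial"
begin

text \<open>
  If the unit tensor \<open>I r\<close> is in the closure of the restrictions of \<open>T\<close>, then it is a
  specialisation, along a place of the field of rational functions in the entries of \<open>\<phi> 1, \<dots>, \<phi> d\<close>,
  of the generic restriction of \<open>T\<close>.  Row reduction over the valuation ring factors the
  generic \<open>\<phi> i\<close>, up to a matrix with invertible reduction, as a diagonal matrix with entries
  \<open>a i 1\<close> dividing \<open>a i 2\<close> dividing \<open>\<dots>\<close>, times an integral matrix \<open>h i\<close> in echelon form.
  Since \<open>I r\<close> has slice rank \<open>r\<close>, the product of the \<open>a i s\<close> is not in the maximal ideal for
  \<open>s = r div d\<close>; dividing by the diagonal entries then shows that the first \<open>s\<close> rows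
  of the reductions of the \<open>h i\<close> map \<open>T\<close> to a tensor of rank at most \<open>r\<close>.  The entries of
  \<open>T\<close> in a block of size \<open>s\<^sup>d\<close> are thus polynomials in the remaining entries, the
  \<open>s \<times> n i\<close> projections and the \<open>r d s\<close> entries of a rank decomposition, and this parameter
  count is at most the asserted bound.
\<close>

text \<open>A curve through the point of the closure would need curve selection; a place comes from
  Zorn's lemma, and algebraic closedness keeps its residue field equal to K. The obstacle is that
  the generic \<open>\<phi> i\<close> need not be integral: only the tensor they produce is, so they
  cannot be reduced one by one. The value s = r div d comes from slice rank: discarding the first s
  - 1 rows of every factor discards d (s - 1) < r rows in all, too few to kill a tensor of slice
  rank r, and every remaining entry is a multiple of the product b of the \<open>a i s\<close>. So b
  is not in the maximal ideal, its inverse is integral, and division by the \<open>a i j\<close>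
  with j <= s, which is multiplication by 1/b and by the quotients \<open>a i s / a i j\<close>,
  keeps the small block integral. Dimension is bounded by counting monomials instead of through
  transcendence degrees: a chain of irreducible closed sets yields functions without algebraic
  relation, whereas more functions than parameters satisfy one. The inequality r <= n i is proved
  along the way because it makes the maximum in the border subrank exist and lets the asserted
  expression dominate the count.\<close>

text \<open>Gaussian elimination, in the form used for left inverses, for pivots and for the final
  monomial count.\<close>

lemma nontrivial_solution:
  fixes a :: "'a \<Rightarrow> 'b \<Rightarrow> 'k::field"
  assumes "finite P" "finite J" "card P < card J"
  shows "\<exists>c. (\<exists>j\<in>J. c j \<noteq> 0) \<and> (\<forall>l\<in>P. (\<Sum>j\<in>J. c j * a j l) = 0)"
  using assms
proof (induction P arbitrary: J a rule: finite_induct)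
  case empty
  then have "J \<noteq> {}" by auto
  then show ?case by (intro exI[of _ "\<lambda>_. 1"]) auto
next
  case (insert l P)
  show ?case
  proof (cases "\<forall>j\<in>J. a j l = 0")
    case True
    have "card P < card J" using insert by simp
    from insert.IH[OF insert.prems(1) this, of a] show ?thesis using True by auto
  next
    case False
    then obtain j0 where j0: "j0 \<in> J" "a j0 l \<noteq> 0" by blast
    define J' where "J' = J - {j0}"
    have fJ': "finite J'" and cJ': "card P < card J'" and j0J': "j0 \<notin> J'"
      and J: "J = insert j0 J'"
      using insert j0 by (auto simp: J'_def)
    obtain c where c: "\<exists>j\<in>J'. c j \<noteq> 0"
      "\<forall>m\<in>P. (\<Sum>j\<in>J'. c j * (a j m - a j l / a j0 l * a j0 m)) = 0"
      using insert.IH[OF fJ' cJ', of "\<lambda>j m. a j m - a j l / a j0 l * a j0 m"] by blast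
    define e where "e = - (\<Sum>j\<in>J'. c j * a j l) / a j0 l"
    define c' where "c' = c(j0 := e)"
    have sum: "(\<Sum>j\<in>J. c' j * a j m) = e * a j0 m + (\<Sum>j\<in>J'. c j * a j m)" for m
    proof -
      have "(\<Sum>j\<in>J'. c' j * a j m) = (\<Sum>j\<in>J'. c j * a j m)"
        using j0J' by (intro sum.cong) (auto simp: c'_def)
      then show ?thesis using fJ' j0J' by (simp add: J c'_def)
    qed
    have "(\<Sum>j\<in>J. c' j * a j m) = 0" if "m \<in> insert l P" for m
    proof (cases "m = l")
      case True
      then show ?thesis using j0 by (simp add: sum e_def)
    next
      case False
      then have "(\<Sum>j\<in>J'. c j * (a j m - a j l / a j0 l * a j0 m)) = 0"
        using c that by blast
      then have "(\<Sum>j\<in>J'. c j * a j m) = (\<Sum>j\<in>J'. c j * a j l) / a j0 l * a j0 m"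
        by (simp add: algebra_simps sum_subtractf sum_distrib_left sum_distrib_right sum_divide_distrib)
      then show ?thesis by (simp add: sum e_def)
    qed
    moreover have "\<exists>j\<in>J. c' j \<noteq> 0"
      using c(1) j0J' by (auto simp: c'_def J)
    ultimately show ?thesis by blast
  qed
qed

subsection \<open>Extension of places\<close>

text \<open>The axioms describe a valuation ring \<open>R\<close> with residue map
  \<open>\<psi>\<close>: \<open>unit_closed\<close> makes the kernel of \<open>\<psi>\<close> the
  maximal ideal, and \<open>\<iota>\<close> chooses a representative in \<open>R\<close> of every
  residue. Values of \<open>\<psi>\<close> outside \<open>R\<close> carry no meaning.\<close>

locale place =
  fixes R :: "'f::field set" and \<psi> :: "'f \<Rightarrow> 'k::field" and \<iota> :: "'k \<Rightarrow> 'f"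
  assumes one_closed: "1 \<in> R" and hom_one: "\<psi> 1 = 1"
    and diff_closed: "x \<in> R \<Longrightarrow> y \<in> R \<Longrightarrow> x - y \<in> R"
    and hom_diff: "x \<in> R \<Longrightarrow> y \<in> R \<Longrightarrow> \<psi> (x - y) = \<psi> x - \<psi> y"
    and mult_closed: "x \<in> R \<Longrightarrow> y \<in> R \<Longrightarrow> x * y \<in> R"
    and hom_mult: "x \<in> R \<Longrightarrow> y \<in> R \<Longrightarrow> \<psi> (x * y) = \<psi> x * \<psi> y"
    and valuation: "x \<in> R \<or> inverse x \<in> R"
    and unit_closed: "x \<in> R \<Longrightarrow> \<psi> x \<noteq> 0 \<Longrightarrow> inverse x \<in> R"
    and const_closed: "\<iota> c \<in> R" and hom_const: "\<psi> (\<iota> c) = c"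

text \<open>Graph of a ring homomorphism from a subring of \<open>'f\<close> to \<open>'k\<close>.
  As sets of pairs such graphs are ordered by inclusion exactly as homomorphisms are by extension,
  ready for Zorn. Closure under differences reduces single-valuedness to the condition at 0.\<close>

definition partial_hom :: "('f::field \<times> 'k::field) set \<Rightarrow> bool" where
  "partial_hom G \<longleftrightarrow> (1, 1) \<in> G \<and>
     (\<forall>x a y b. (x, a) \<in> G \<longrightarrow> (y, b) \<in> G \<longrightarrow> (x - y, a - b) \<in> G \<and> (x * y, a * b) \<in> G) \<and>
     (\<forall>a. (0, a) \<in> G \<longrightarrow> a = 0)"

lemma partial_homI:
  assumes "(1, 1) \<in> G"
    and "\<And>x a y b. (x, a) \<in> G \<Longrightarrow> (y, b) \<in> G \<Longrightarrow> (x - y, a - b) \<in> G"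
    and "\<And>x a y b. (x, a) \<in> G \<Longrightarrow> (y, b) \<in> G \<Longrightarrow> (x * y, a * b) \<in> G"
    and "\<And>a. (0, a) \<in> G \<Longrightarrow> a = 0"
  shows "partial_hom G"
  using assms unfolding partial_hom_def by blast

context
  fixes G :: "('f::field \<times> 'k::field) set"
  assumes G: "partial_hom G"
begin

lemma partial_hom_one: "(1, 1) \<in> G"
  and partial_hom_diff: "(x, a) \<in> G \<Longrightarrow> (y, b) \<in> G \<Longrightarrow> (x - y, a - b) \<in> G"
  and partial_hom_mult: "(x, a) \<in> G \<Longrightarrow> (y, b) \<in> G \<Longrightarrow> (x * y, a * b) \<in> G"
  and partial_hom_zero_unique: "(0, a) \<in> G \<Longrightarrow> a = 0"
  using G unfolding partial_hom_def by blast+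

lemma partial_hom_zero: "(0, 0) \<in> G"
  using partial_hom_diff[OF partial_hom_one partial_hom_one] by simp

lemma partial_hom_uminus: "(x, a) \<in> G \<Longrightarrow> (- x, - a) \<in> G"
  using partial_hom_diff[OF partial_hom_zero] by fastforce

lemma partial_hom_add: "(x, a) \<in> G \<Longrightarrow> (y, b) \<in> G \<Longrightarrow> (x + y, a + b) \<in> G"
  using partial_hom_diff[OF _ partial_hom_uminus] by fastforce

lemma partial_hom_unique: "(x, a) \<in> G \<Longrightarrow> (x, b) \<in> G \<Longrightarrow> a = b"
  using partial_hom_diff[of x a x b] partial_hom_zero_unique[of "a - b"] by simp

lemma partial_hom_sum:
  assumes "\<And>i. i \<in> I \<Longrightarrow> (f i, g i) \<in> G"
  shows "(sum f I, sum g I) \<in> G"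
  using assms
  by (induction I rule: infinite_finite_induct) (auto intro: partial_hom_zero partial_hom_add)

lemma partial_hom_power: "(x, a) \<in> G \<Longrightarrow> (x ^ n, a ^ n) \<in> G"
  by (induction n) (auto intro: partial_hom_one partial_hom_mult)

end

text \<open>With A the domain of \<open>G\<close>, \<open>q\<close> is the image of \<open>p\<close>
  under A[X] -> k[X]. The case q = 0 says that all coefficients of \<open>p\<close> lie in the
  kernel m.\<close>

definition coeff_rel :: "('f::field \<times> 'k::field) set \<Rightarrow> 'f poly \<Rightarrow> 'k poly \<Rightarrow> bool" where
  "coeff_rel G p q \<longleftrightarrow> (\<forall>i. (coeff p i, coeff q i) \<in> G)"

context
  fixes G :: "('f::field \<times> 'k::field) set"
  assumes G: "partial_hom G"
begin

lemma coeff_rel_diff: "coeff_rel G p q \<Longrightarrow> coeff_rel G p' q' \<Longrightarrow> coeff_rel G (p - p') (q - q')"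
  by (auto simp: coeff_rel_def intro: partial_hom_diff[OF G])

lemma coeff_rel_mult: "coeff_rel G p q \<Longrightarrow> coeff_rel G p' q' \<Longrightarrow> coeff_rel G (p * p') (q * q')"
  by (auto simp: coeff_rel_def coeff_mult intro!: partial_hom_sum[OF G] partial_hom_mult[OF G])

lemma coeff_rel_pCons: "(x, a) \<in> G \<Longrightarrow> coeff_rel G p q \<Longrightarrow> coeff_rel G (pCons x p) (pCons a q)"
  by (auto simp: coeff_rel_def coeff_pCons split: nat.split)

lemma coeff_rel_0: "coeff_rel G 0 0"
  by (simp add: coeff_rel_def partial_hom_zero[OF G])

lemma coeff_rel_const: "(x, a) \<in> G \<Longrightarrow> coeff_rel G [:x:] [:a:]"
  by (intro coeff_rel_pCons coeff_rel_0)

lemma coeff_rel_surj: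
  assumes "range snd \<subseteq> snd ` G"
  shows "\<exists>p. coeff_rel G p q"
proof (induction q)
  case 0
  show ?case using coeff_rel_0 by blast
next
  case (pCons a q)
  have "a \<in> snd ` G" using assms by force
  then obtain x where "(x, a) \<in> G" by auto
  with pCons.IH show ?case using coeff_rel_pCons by blast
qed

text \<open>The domain of a maximal graph is a local ring: otherwise the homomorphism would extend
  to the localisation at x by y / x^n |-> b / a^n.\<close>

lemma partial_hom_inverse:
  assumes "\<And>G'. partial_hom G' \<Longrightarrow> G \<subseteq> G' \<Longrightarrow> G' = G" and xa: "(x, a) \<in> G" "a \<noteq> 0"
  shows "(inverse x, inverse a) \<in> G"
proof -
  have x: "x \<noteq> 0" using xa partial_hom_zero_unique[OF G] by blast
  define G' where "G' = {(y / x ^ n, b / a ^ n) | y b n. (y, b) \<in> G}"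
  have G'I: "(y, b) \<in> G \<Longrightarrow> u = y / x ^ n \<Longrightarrow> v = b / a ^ n \<Longrightarrow> (u, v) \<in> G'" for y b n u v
    unfolding G'_def by blast
  have "partial_hom G'"
  proof (rule partial_homI)
    show "(1, 1) \<in> G'" by (rule G'I[of 1 1 _ 0]) (auto intro: partial_hom_one[OF G])
  next
    fix u v u' v' assume "(u, v) \<in> G'" "(u', v') \<in> G'"
    then obtain y b n y' b' n' where yb: "(y, b) \<in> G" "(y', b') \<in> G"
      and uv: "u = y / x ^ n" "v = b / a ^ n" "u' = y' / x ^ n'" "v' = b' / a ^ n'"
      unfolding G'_def by blast
    show "(u * u', v * v') \<in> G'"
      by (rule G'I[of "y * y'" "b * b'" _ "n + n'"])
        (auto simp: uv power_add intro: partial_hom_mult[OF G] yb)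
    show "(u - u', v - v') \<in> G'"
      by (rule G'I[of "y * x ^ n' - y' * x ^ n" "b * a ^ n' - b' * a ^ n" _ "n + n'"])
        (auto simp: uv power_add x xa(2) field_simps
          intro!: partial_hom_diff[OF G] partial_hom_mult[OF G] yb partial_hom_power[OF G] xa)
  next
    fix v assume "(0, v) \<in> G'"
    then obtain y b n where "(y, b) \<in> G" "0 = y / x ^ n" "v = b / a ^ n"
      unfolding G'_def by blast
    then show "v = 0" using x partial_hom_zero_unique[OF G] by auto
  qed
  moreover have "G \<subseteq> G'"
    using G'I[of _ _ _ 0] by (intro subrelI) auto
  ultimately have "G' = G" using assms(1) by blast
  moreover have "(inverse x, inverse a) \<in> G'"
    by (rule G'I[of 1 1 _ 1]) (auto intro: partial_hom_one[OF G] simp: field_simps)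
  ultimately show ?thesis by simp
qed

end

text \<open>With A the domain and m the kernel, \<open>proper\<close> says that m A[x] is not all of
  A[x]. The relations of x then reduce to a proper ideal \<open>J\<close> of k[X]; it has a zero z
  since k is algebraically closed, and x |-> z extends the homomorphism to A[x]. Maximality puts x
  into A.\<close>

lemma partial_hom_extend:
  fixes G :: "('f::field \<times> 'k::alg_closed_field) set"
  assumes G: "partial_hom G" and max: "\<And>G'. partial_hom G' \<Longrightarrow> G \<subseteq> G' \<Longrightarrow> G' = G"
    and surj: "range snd \<subseteq> snd ` G"
    and proper: "\<And>p. coeff_rel G p 0 \<Longrightarrow> poly p x \<noteq> 1"
  shows "x \<in> Domain G"
proof -
  define J where "J = {q. \<exists>p. coeff_rel G p q \<and> poly p x = 0}"
  \<comment> \<open>Every \<open>u\<close> lifts to A[X] because the homomorphism is onto k, so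
    \<open>J\<close> absorbs multiplication by all of k[X].\<close>
  have J_mult: "q * u \<in> J" if q: "q \<in> J" for q u
  proof -
    obtain p where "coeff_rel G p q" "poly p x = 0" using q by (auto simp: J_def)
    moreover obtain p' where "coeff_rel G p' u" using coeff_rel_surj[OF G surj] by blast
    ultimately show ?thesis
      using coeff_rel_mult[OF G, of p q p' u] by (auto simp: J_def intro!: exI[of _ "p * p'"])
  qed
  have J_diff: "q - u \<in> J" if qu: "q \<in> J" "u \<in> J" for q u
  proof -
    obtain p p' where "coeff_rel G p q" "poly p x = 0" "coeff_rel G p' u" "poly p' x = 0"
      using qu by (auto simp: J_def)
    then show ?thesis
      using coeff_rel_diff[OF G, of p q p' u] by (auto simp: J_def intro!: exI[of _ "p - p'"])
  qed
  \<comment> \<open>If \<open>p\<close> vanishes at x and reduces to a nonzero constant a, its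
    constant term u is a unit of A, and 1 - p/u has coefficients in m but value 1 at x.\<close>
  have no_const: "a = 0" if J: "[:a:] \<in> J" for a
  proof (rule ccontr)
    assume a: "a \<noteq> 0"
    obtain p where p: "coeff_rel G p [:a:]" "poly p x = 0" using J by (auto simp: J_def)
    define u where "u = coeff p 0"
    have ua: "(u, a) \<in> G" using p(1) by (auto simp: coeff_rel_def u_def dest: spec[of _ 0])
    have u: "u \<noteq> 0" using ua a partial_hom_zero_unique[OF G] by blast
    have inv: "(inverse u, inverse a) \<in> G" by (rule partial_hom_inverse[OF G max ua a])
    have "coeff_rel G ([:1:] - [:inverse u:] * p) ([:1:] - [:inverse a:] * [:a:])"
      by (intro coeff_rel_diff[OF G] coeff_rel_mult[OF G] coeff_rel_const[OF G] p inv partial_hom_one[OF G])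
    then have "coeff_rel G ([:1:] - [:inverse u:] * p) 0"
      using a by (simp add: one_pCons)
    from proper[OF this] show False using p(2) by simp
  qed
  obtain z where z: "\<And>q. q \<in> J \<Longrightarrow> poly q z = 0"
  proof (cases "J \<subseteq> {0}")
    case True
    \<comment> \<open>No nonzero relation survives reduction, so x may be sent anywhere; 0 is
      taken.\<close>
    then show ?thesis using that[of 0] by force
  next
    case False
    \<comment> \<open>An element of least degree generates the ideal \<open>J\<close>, so any root
      of it is a zero of all of \<open>J\<close>.\<close>
    define q where "q = arg_min degree (\<lambda>q. q \<in> J \<and> q \<noteq> 0)"
    have ex: "\<exists>q. q \<in> J \<and> q \<noteq> 0" using False by blast
    have q: "q \<in> J" "q \<noteq> 0" and q_min: "\<And>u. u \<in> J \<Longrightarrow> u \<noteq> 0 \<Longrightarrow> degree q \<le> degree u"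
      using arg_min_natI[of "\<lambda>q. q \<in> J \<and> q \<noteq> 0" _ degree] arg_min_nat_le[of "\<lambda>q. q \<in> J \<and> q \<noteq> 0" _ degree] ex
      unfolding q_def by blast+
    have "degree q > 0"
    proof (rule ccontr)
      assume "\<not> degree q > 0"
      then obtain a where "q = [:a:]" by (auto elim: degree_eq_zeroE)
      with q no_const show False by auto
    qed
    then obtain z where z: "poly q z = 0" using alg_closed_imp_poly_has_root by blast
    have "q dvd u" if u: "u \<in> J" for u
    proof -
      have "u mod q = u - q * (u div q)" by (simp add: minus_mult_div_eq_mod)
      then have "u mod q \<in> J" using J_diff[OF u J_mult[OF q(1)]] by simp
      then have "u mod q = 0"
        using q_min[of "u mod q"] degree_mod_less[OF q(2), of u] by fastforce
      then show ?thesis by (simp add: mod_eq_0_iff_dvd)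
    qed
    then show ?thesis using that[of z] z by (metis dvdE mult_zero_left poly_mult)
  qed
  define G' where "G' = {(poly p x, poly q z) | p q. coeff_rel G p q}"
  have G'I: "coeff_rel G p q \<Longrightarrow> u = poly p x \<Longrightarrow> v = poly q z \<Longrightarrow> (u, v) \<in> G'" for p q u v
    unfolding G'_def by blast
  have "partial_hom G'"
  proof (rule partial_homI)
    show "(1, 1) \<in> G'"
      by (rule G'I[of "[:1:]" "[:1:]"]) (auto intro: coeff_rel_const[OF G] partial_hom_one[OF G])
  next
    fix u v u' v' assume "(u, v) \<in> G'" "(u', v') \<in> G'"
    then obtain p q p' q' where pq: "coeff_rel G p q" "coeff_rel G p' q'"
      and uv: "u = poly p x" "v = poly q z" "u' = poly p' x" "v' = poly q' z"
      unfolding G'_def by blast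
    show "(u - u', v - v') \<in> G'"
      by (rule G'I[of "p - p'" "q - q'"]) (auto simp: uv intro: coeff_rel_diff[OF G] pq)
    show "(u * u', v * v') \<in> G'"
      by (rule G'I[of "p * p'" "q * q'"]) (auto simp: uv intro: coeff_rel_mult[OF G] pq)
  next
    fix v assume "(0, v) \<in> G'"
    then obtain p q where "coeff_rel G p q" "0 = poly p x" "v = poly q z"
      unfolding G'_def by blast
    then show "v = 0" using z[of q] by (auto simp: J_def)
  qed
  moreover have "G \<subseteq> G'"
    by (auto intro!: G'I coeff_rel_const[OF G])
  ultimately have "G' = G" using max by blast
  moreover have "(x, z) \<in> G'"
    by (rule G'I[of "[:0, 1:]" "[:0, 1:]"])
      (auto intro!: coeff_rel_pCons[OF G] coeff_rel_0[OF G] partial_hom_zero[OF G] partial_hom_one[OF G])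
  ultimately show ?thesis by auto
qed


text \<open>Chevalley's descent. The relations say that 1 lies in m A[x] and in m A[1/x]. The one of
  smaller degree, multiplied by a power of x or 1/x, rewrites the leading monomial of the other in
  lower powers with coefficients still in m. The sum of the degrees drops, and a relation of degree
  0 would put 1 into m.\<close>

lemma partial_hom_no_two_sided_relation:
  fixes G :: "('f::field \<times> 'k::field) set"
  assumes G: "partial_hom G" and max: "\<And>G'. partial_hom G' \<Longrightarrow> G \<subseteq> G' \<Longrightarrow> G' = G"
  shows "x \<noteq> 0 \<Longrightarrow> coeff_rel G p 0 \<Longrightarrow> poly p x = 1 \<Longrightarrow> coeff_rel G p' 0 \<Longrightarrow> poly p' (inverse x) = 1 \<Longrightarrow> False"
proof (induction "degree p + degree p'" arbitrary: x p p' rule: less_induct)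
  case less
  have step: "\<exists>p2. degree p2 < degree p \<and> coeff_rel G p2 0 \<and> poly p2 x = 1"
    if x: "x \<noteq> 0" and p: "coeff_rel G p 0" "poly p x = 1" and p': "coeff_rel G p' 0" "poly p' (inverse x) = 1"
      and le: "degree p' \<le> degree p" for p p' x
  proof -
    define n where "n = degree p"
    define a where "a = coeff p n"
    define u where "u = 1 - coeff p' 0"
    have p0: "(coeff p i, 0) \<in> G" and p'0: "(coeff p' i, 0) \<in> G" for i
      using p p' by (auto simp: coeff_rel_def)
    have n: "n > 0"
    proof (rule ccontr)
      assume "\<not> n > 0"
      then obtain b where "p = [:b:]" by (auto simp: n_def elim: degree_eq_zeroE)
      then have "(1, 0) \<in> G" using p p0[of 0] by simp
      then show False using partial_hom_unique[OF G _ partial_hom_one[OF G]] by fastforce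
    qed
    have u1: "(u, 1) \<in> G"
      using partial_hom_diff[OF G partial_hom_one[OF G] p'0] by (simp add: u_def)
    then have u0: "u \<noteq> 0" using partial_hom_zero_unique[OF G] by fastforce
    have inv: "(inverse u, 1) \<in> G" using partial_hom_inverse[OF G max u1] by simp
    define k where "k = degree p'"
    have "1 = coeff p' 0 + (\<Sum>j=1..k. coeff p' j * inverse x ^ j)"
      using p'(2) by (simp add: poly_altdef k_def sum.atLeast_Suc_atMost atMost_atLeast0)
    then have u_eq: "u = (\<Sum>j=1..k. coeff p' j * inverse x ^ j)"
      unfolding u_def by (metis add_diff_cancel_left')
    \<comment> \<open>Dividing the relation for 1/x by the unit u = 1 - coeff p' 0 writes 1 as the
      sum of (coeff p' j / u) x^(-j) over j >= 1. Multiplied by a x^n this is \<open>w\<close>: it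
      has the value of the leading monomial at x but degree below n, and k <= n keeps the exponents
      n - j from being truncated.\<close>
    define w where "w = (\<Sum>j=1..k. monom (a * coeff p' j * inverse u) (n - j))"
    define p2 where "p2 = p - monom a n + w"
    have "poly w x = (\<Sum>j=1..k. a * coeff p' j * inverse u * x ^ (n - j))"
      by (simp add: w_def poly_sum poly_monom)
    also have "\<dots> = (\<Sum>j=1..k. a * inverse u * x ^ n * (coeff p' j * inverse x ^ j))"
      using x le by (intro sum.cong) (auto simp: power_diff k_def n_def field_simps)
    also have "\<dots> = a * x ^ n"
      unfolding sum_distrib_left[symmetric] u_eq[symmetric] using u0 by simp
    finally have "poly p2 x = 1" using p by (simp add: p2_def poly_monom)
    moreover have "coeff_rel G p2 0"
    proof -
      have "(coeff p2 i, 0 - 0 + (\<Sum>j=1..k. 0)) \<in> G" for i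
        unfolding p2_def w_def coeff_add coeff_diff coeff_sum coeff_monom
      proof (intro partial_hom_add[OF G] partial_hom_diff[OF G] partial_hom_sum[OF G] p0)
        show "(if n = i then a else 0, 0) \<in> G" by (simp add: a_def p0 partial_hom_zero[OF G])
        have "(a * coeff p' j * inverse u, 0 * 0 * 1) \<in> G" for j
          unfolding a_def by (intro partial_hom_mult[OF G] p0 p'0 inv)
        then show "(if n - j = i then a * coeff p' j * inverse u else 0, 0) \<in> G" for j
          by (simp add: partial_hom_zero[OF G])
      qed
      then show ?thesis by (simp add: coeff_rel_def)
    qed
    moreover have "degree p2 < degree p"
    proof -
      have "coeff p2 i = 0" if "i \<ge> n" for i
      proof -
        have "coeff w i = 0"
          using that n unfolding w_def coeff_sum coeff_monom by (intro sum.neutral) auto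
        moreover have "coeff p i = (if n = i then a else 0)"
          using that by (auto simp: a_def n_def coeff_eq_0)
        ultimately show ?thesis by (simp add: p2_def)
      qed
      then show ?thesis using n by (metis degree_lessI n_def)
    qed
    ultimately show ?thesis by blast
  qed
  show False
  proof (cases "degree p' \<le> degree p")
    case True
    obtain p2 where "degree p2 < degree p" "coeff_rel G p2 0" "poly p2 x = 1"
      using step[OF less.prems True] by blast
    then show False using less.hyps[of p2 p' x] less.prems by simp
  next
    case False
    have "\<exists>p2. degree p2 < degree p' \<and> coeff_rel G p2 0 \<and> poly p2 (inverse x) = 1"
      by (rule step[of "inverse x" p' p]) (use less.prems False in auto)
    then obtain p2 where "degree p2 < degree p'" "coeff_rel G p2 0" "poly p2 (inverse x) = 1"
      by blast
    then show False using less.hyps[of p p2 x] less.prems by simp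
  qed
qed

text \<open>Zorn gives a maximal graph. If neither x nor 1/x were in its domain A,
  \<open>partial_hom_extend\<close> would yield relations of 1 over the kernel in both A[x] and
  A[1/x], which the descent excludes; so A is a valuation ring. The hypothesis on
  \<open>\<iota>\<close> makes the homomorphism onto, so the residue field is k itself.\<close>

theorem chevalley_place_extension:
  fixes G0 :: "('f::field \<times> 'k::alg_closed_field) set"
  assumes G0: "partial_hom G0" and const: "\<And>c. (\<iota> c, c) \<in> G0"
  obtains R \<psi> where "place R \<psi> \<iota>" "\<And>x a. (x, a) \<in> G0 \<Longrightarrow> x \<in> R \<and> \<psi> x = a"
proof -
  define A where "A = {G. partial_hom G \<and> G0 \<subseteq> G}"
  have "\<exists>M\<in>A. \<forall>X\<in>A. M \<subseteq> X \<longrightarrow> X = M"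
  proof (rule subset_Zorn_nonempty)
    show "A \<noteq> {}" using G0 by (auto simp: A_def)
  next
    fix C assume C: "C \<noteq> {}" "subset.chain A C"
    then have CA: "C \<subseteq> A" and lin: "\<And>X Y. X \<in> C \<Longrightarrow> Y \<in> C \<Longrightarrow> X \<subseteq> Y \<or> Y \<subseteq> X"
      by (auto simp: subset_chain_def)
    obtain X0 where X0: "X0 \<in> C" using C by blast
    have two: "\<exists>X\<in>C. p \<in> X \<and> q \<in> X" if "p \<in> \<Union>C" "q \<in> \<Union>C" for p q
      using that lin by blast
    have ph: "partial_hom X" if "X \<in> C" for X using that CA by (auto simp: A_def)
    have "partial_hom (\<Union>C)"
    proof (rule partial_homI)
      show "(1, 1) \<in> \<Union>C" using partial_hom_one[OF ph[OF X0]] X0 by blast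
    next
      fix x a y b assume "(x, a) \<in> \<Union>C" "(y, b) \<in> \<Union>C"
      from two[OF this] obtain X where X: "X \<in> C" "(x, a) \<in> X" "(y, b) \<in> X" by blast
      show "(x - y, a - b) \<in> \<Union>C" "(x * y, a * b) \<in> \<Union>C"
        using partial_hom_diff[OF ph[OF X(1)] X(2,3)] partial_hom_mult[OF ph[OF X(1)] X(2,3)] X(1)
        by blast+
    next
      fix a assume "(0, a) \<in> \<Union>C"
      then show "a = 0" using partial_hom_zero_unique[OF ph] by blast
    qed
    moreover have "G0 \<subseteq> \<Union>C" using X0 CA by (auto simp: A_def)
    ultimately show "\<Union>C \<in> A" by (simp add: A_def)
  qed
  then obtain G where "G \<in> A" and maxA: "\<And>X. X \<in> A \<Longrightarrow> G \<subseteq> X \<Longrightarrow> X = G" by blast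
  then have G: "partial_hom G" and G0G: "G0 \<subseteq> G" by (auto simp: A_def)
  have max: "G' = G" if "partial_hom G'" "G \<subseteq> G'" for G'
    using maxA[of G'] that G0G by (auto simp: A_def)
  have surj: "range snd \<subseteq> snd ` G" using const G0G by force
  define R where "R = Domain G"
  define \<psi> where "\<psi> x = (THE a. (x, a) \<in> G)" for x
  have \<psi>: "x \<in> R \<and> \<psi> x = a" if "(x, a) \<in> G" for x a
    using that partial_hom_unique[OF G] unfolding R_def \<psi>_def by blast
  have R: "(x, \<psi> x) \<in> G" if "x \<in> R" for x
    using that \<psi> unfolding R_def by blast
  have "place R \<psi> \<iota>"
  proof
    show "1 \<in> R" "\<psi> 1 = 1" using \<psi>[OF partial_hom_one[OF G]] by auto
    show "x - y \<in> R" "\<psi> (x - y) = \<psi> x - \<psi> y" if "x \<in> R" "y \<in> R" for x y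
      using \<psi>[OF partial_hom_diff[OF G R[OF that(1)] R[OF that(2)]]] by auto
    show "x * y \<in> R" "\<psi> (x * y) = \<psi> x * \<psi> y" if "x \<in> R" "y \<in> R" for x y
      using \<psi>[OF partial_hom_mult[OF G R[OF that(1)] R[OF that(2)]]] by auto
    show "inverse x \<in> R" if "x \<in> R" "\<psi> x \<noteq> 0" for x
      using \<psi>[OF partial_hom_inverse[OF G max R[OF that(1)] that(2)]] by auto
    show "\<iota> c \<in> R" "\<psi> (\<iota> c) = c" for c
      using \<psi>[of "\<iota> c" c] const G0G by auto
    show "x \<in> R \<or> inverse x \<in> R" for x
    proof (rule ccontr)
      assume not: "\<not> (x \<in> R \<or> inverse x \<in> R)"
      have x: "x \<noteq> 0" using not \<psi>[OF partial_hom_zero[OF G]] by auto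
      have "\<exists>p. coeff_rel G p 0 \<and> poly p y = 1" if "y \<notin> R" for y
        using partial_hom_extend[OF G max surj, of y] that by (auto simp: R_def)
      then obtain p p' where "coeff_rel G p 0" "poly p x = 1" "coeff_rel G p' 0" "poly p' (inverse x) = 1"
        using not by blast
      then show False using partial_hom_no_two_sided_relation[OF G max x] by blast
    qed
  qed
  moreover have "x \<in> R \<and> \<psi> x = a" if "(x, a) \<in> G0" for x a
    using \<psi> G0G that by blast
  ultimately show ?thesis by (rule that)
qed

subsection \<open>Linear algebra over a valuation ring\<close>

context place
begin

lemma zero_closed: "0 \<in> R" and hom_zero: "\<psi> 0 = 0"
  using diff_closed[OF one_closed one_closed] hom_diff[OF one_closed one_closed] by auto

lemma uminus_closed: "x \<in> R \<Longrightarrow> - x \<in> R" and hom_uminus: "x \<in> R \<Longrightarrow> \<psi> (- x) = - \<psi> x"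
  using diff_closed[OF zero_closed, of x] hom_diff[OF zero_closed, of x] by (auto simp: hom_zero)

lemma add_closed: "x \<in> R \<Longrightarrow> y \<in> R \<Longrightarrow> x + y \<in> R"
  and hom_add: "x \<in> R \<Longrightarrow> y \<in> R \<Longrightarrow> \<psi> (x + y) = \<psi> x + \<psi> y"
  using diff_closed[OF _ uminus_closed, of x y] hom_diff[OF _ uminus_closed, of x y] hom_uminus[of y]
  by auto

lemma sum_closed: "(\<And>i. i \<in> I \<Longrightarrow> f i \<in> R) \<Longrightarrow> sum f I \<in> R"
  by (induction I rule: infinite_finite_induct) (auto intro: zero_closed add_closed)

lemma hom_sum: "(\<And>i. i \<in> I \<Longrightarrow> f i \<in> R) \<Longrightarrow> \<psi> (sum f I) = (\<Sum>i\<in>I. \<psi> (f i))"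
  by (induction I rule: infinite_finite_induct) (auto simp: hom_zero hom_add sum_closed)

lemma prod_closed: "(\<And>i. i \<in> I \<Longrightarrow> f i \<in> R) \<Longrightarrow> prod f I \<in> R"
  by (induction I rule: infinite_finite_induct) (auto intro: one_closed mult_closed)

lemma hom_prod: "(\<And>i. i \<in> I \<Longrightarrow> f i \<in> R) \<Longrightarrow> \<psi> (prod f I) = (\<Prod>i\<in>I. \<psi> (f i))"
  by (induction I rule: infinite_finite_induct) (auto simp: hom_one hom_mult prod_closed)

text \<open>Arguments range over the whole field, not only over \<open>R\<close>, because the
  entries of the generic matrices need not be integral.\<close>

definition val_dvd :: "'f \<Rightarrow> 'f \<Rightarrow> bool" where
  "val_dvd x y \<longleftrightarrow> (\<exists>q\<in>R. y = q * x)"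

lemma val_dvd_refl: "val_dvd x x"
  unfolding val_dvd_def using one_closed by force

lemma val_dvd_trans: "val_dvd x y \<Longrightarrow> val_dvd y z \<Longrightarrow> val_dvd x z"
  unfolding val_dvd_def using mult_closed by (metis mult.assoc)

lemma val_dvd_0 [simp]: "val_dvd x 0"
  unfolding val_dvd_def using zero_closed by force

lemma val_dvd_diff: "val_dvd x y \<Longrightarrow> val_dvd x z \<Longrightarrow> val_dvd x (y - z)"
  unfolding val_dvd_def by (metis diff_closed left_diff_distrib)

lemma val_dvd_mult: "q \<in> R \<Longrightarrow> val_dvd x y \<Longrightarrow> val_dvd x (q * y)"
  unfolding val_dvd_def by (metis mult_closed mult.assoc)

lemma val_dvd_linear: "val_dvd x y \<or> val_dvd y x"
proof (cases "x = 0 \<or> y = 0")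
  case False
  have "y / x \<in> R \<or> x / y \<in> R" using valuation[of "y / x"] by simp
  then show ?thesis unfolding val_dvd_def using False
    by (metis nonzero_divide_eq_eq)
qed auto

lemma val_dvd_min:
  assumes "finite S" "S \<noteq> {}"
  shows "\<exists>x\<in>S. \<forall>y\<in>S. val_dvd x y"
  using assms
proof (induction S rule: finite_ne_induct)
  case (singleton x)
  then show ?case using val_dvd_refl by simp
next
  case (insert x S)
  then obtain m where m: "m \<in> S" "\<forall>y\<in>S. val_dvd m y" by blast
  show ?case
    using val_dvd_linear[of m x] m val_dvd_trans val_dvd_refl by (metis insert_iff)
qed

end

section \<open>Invertible matrices over a field and the slice rank of the unit tensor\<close>

definition indep_rows :: "nat \<Rightarrow> (nat \<Rightarrow> nat \<Rightarrow> 'k::field) \<Rightarrow> bool" where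
  "indep_rows r A \<longleftrightarrow>
     (\<forall>c. (\<forall>l\<in>{1..r}. (\<Sum>j=1..r. c j * A j l) = 0) \<longrightarrow> (\<forall>j\<in>{1..r}. c j = 0))"

lemma indep_rowsD:
  "indep_rows r A \<Longrightarrow> (\<And>l. l \<in> {1..r} \<Longrightarrow> (\<Sum>j=1..r. c j * A j l) = 0) \<Longrightarrow> j \<in> {1..r} \<Longrightarrow> c j = 0"
  unfolding indep_rows_def by blast

lemma indep_rows_permute:
  fixes A :: "nat \<Rightarrow> nat \<Rightarrow> 'k::field"
  assumes A: "indep_rows r A" and \<pi>: "bij_betw \<pi> {1..r} {1..r}"
  shows "indep_rows r (\<lambda>j. A (\<pi> j))"
  unfolding indep_rows_def
proof (intro allI impI ballI)
  fix c j assume *: "\<forall>l\<in>{1..r}. (\<Sum>j=1..r. c j * A (\<pi> j) l) = 0" and j: "j \<in> {1..r}"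
  define e where "e m = c (inv_into {1..r} \<pi> m)" for m
  have e: "e (\<pi> j) = c j" if "j \<in> {1..r}" for j
    using \<pi> that by (simp add: e_def bij_betw_def inv_into_f_f)
  have "(\<Sum>m=1..r. e m * A m l) = 0" if "l \<in> {1..r}" for l
  proof -
    have "(\<Sum>m=1..r. e m * A m l) = (\<Sum>j=1..r. e (\<pi> j) * A (\<pi> j) l)"
      by (rule sum.reindex_bij_betw[OF \<pi>, symmetric])
    also have "\<dots> = (\<Sum>j=1..r. c j * A (\<pi> j) l)"
      by (intro sum.cong) (auto simp: e)
    finally show ?thesis using * that by simp
  qed
  moreover have "\<pi> j \<in> {1..r}" using \<pi> j by (auto simp: bij_betw_def)
  ultimately have "e (\<pi> j) = 0" using indep_rowsD[OF A, of e] by blast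
  then show "c j = 0" using e j by simp
qed

text \<open>A relation \<open>c\<close> among the new rows is a relation among the old ones once its
  coefficient at t is lowered by S, the sum of the c j q j. Independence kills \<open>c\<close> off
  t, and as q t = 0 this makes S vanish, hence also c t.\<close>

lemma indep_rows_eliminate:
  fixes A :: "nat \<Rightarrow> nat \<Rightarrow> 'k::field"
  assumes A: "indep_rows r A" and t: "t \<in> {1..r}" and q: "q t = 0"
  shows "indep_rows r (\<lambda>j l. A j l - q j * A t l)"
  unfolding indep_rows_def
proof (intro allI impI)
  fix c assume *: "\<forall>l\<in>{1..r}. (\<Sum>j=1..r. c j * (A j l - q j * A t l)) = 0"
  define S where "S = (\<Sum>j=1..r. c j * q j)"
  define e where "e j = c j - (if j = t then S else 0)" for j
  have "(\<Sum>j=1..r. e j * A j l) = 0" if "l \<in> {1..r}" for l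
  proof -
    have "(\<Sum>j=1..r. e j * A j l) = (\<Sum>j=1..r. c j * A j l) - (\<Sum>j=1..r. if j = t then S * A j l else 0)"
      unfolding sum_subtractf[symmetric] by (intro sum.cong) (auto simp: e_def algebra_simps)
    also have "\<dots> = (\<Sum>j=1..r. c j * A j l) - S * A t l"
      using t by (simp add: sum.delta)
    also have "\<dots> = (\<Sum>j=1..r. c j * (A j l - q j * A t l))"
      unfolding S_def sum_distrib_right sum_subtractf[symmetric]
      by (intro sum.cong) (auto simp: algebra_simps)
    finally show ?thesis using * that by simp
  qed
  then have e0: "e j = 0" if "j \<in> {1..r}" for j
    using indep_rowsD[OF A, of e] that by blast
  have "c j * q j = 0" if "j \<in> {1..r}" for j
    using e0[OF that] q by (cases "j = t") (auto simp: e_def)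
  then have "S = 0" unfolding S_def by (intro sum.neutral) blast
  then show "\<forall>j\<in>{1..r}. c j = 0" using e0 by (auto simp: e_def split: if_splits)
qed

lemma indep_rows_identity: "indep_rows r (\<lambda>j l. if j = l then 1 else 0)"
  unfolding indep_rows_def
proof (intro allI impI ballI)
  fix c :: "nat \<Rightarrow> 'a" and j
  assume *: "\<forall>l\<in>{1..r}. (\<Sum>j=1..r. c j * (if j = l then 1 else 0)) = 0" and j: "j \<in> {1..r}"
  have "(\<Sum>m=1..r. c m * (if m = j then 1 else 0)) = c j"
    using j by (simp add: if_distrib[of "\<lambda>x. _ * x"] sum.delta cong: if_cong)
  then show "c j = 0" using * j by metis
qed

lemma indep_rows_unitriangular:
  fixes M :: "nat \<Rightarrow> nat \<Rightarrow> 'k::field"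
  assumes diag: "\<And>j. j \<in> {1..s} \<Longrightarrow> M j j = 1"
    and low: "\<And>j l. j \<in> {1..s} \<Longrightarrow> l \<in> {1..s} \<Longrightarrow> l < j \<Longrightarrow> M j l = 0"
  shows "indep_rows s M"
  unfolding indep_rows_def
proof (intro allI impI ballI)
  fix c l assume *: "\<forall>l\<in>{1..s}. (\<Sum>j=1..s. c j * M j l) = 0" and "l \<in> {1..s}"
  from this(2) show "c l = 0"
  proof (induction l rule: less_induct)
    case (less l)
    have "(\<Sum>j=1..s. c j * M j l) = (\<Sum>j=1..s. if j = l then c j else 0)"
    proof (intro sum.cong refl)
      fix j assume j: "j \<in> {1..s}"
      show "c j * M j l = (if j = l then c j else 0)"
        using less.IH[of j] low[of j l] diag[of l] j less.prems by (cases j l rule: linorder_cases) auto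
    qed
    also have "\<dots> = c l" using less.prems by (simp add: sum.delta)
    finally show ?case using * less.prems by simp
  qed
qed

lemma indep_rows_left_inverse:
  fixes M :: "nat \<Rightarrow> nat \<Rightarrow> 'k::field"
  assumes M: "indep_rows s M"
  shows "\<exists>\<tau>. \<forall>k\<in>{1..s}. \<forall>l\<in>{1..s}. (\<Sum>j=1..s. \<tau> k j * M j l) = (if k = l then 1 else 0)"
proof -
  have "\<exists>t. \<forall>l\<in>{1..s}. (\<Sum>j=1..s. t j * M j l) = (if k = l then 1 else 0)" if k: "k \<in> {1..s}" for k
  proof -
    \<comment> \<open>Row 0 holds minus the k-th unit vector, beside the s rows of \<open>M\<close>.
      These s + 1 rows in s columns are dependent, and independence of \<open>M\<close> forces a
      nonzero coefficient at row 0; dividing by it expresses the unit vector through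
      \<open>M\<close>.\<close>
    define a where "a j l = (if j = 0 then if k = l then - 1 else 0 else M j l)" for j l :: nat
    obtain c where c: "\<exists>j\<in>{0..s}. c j \<noteq> 0" "\<forall>l\<in>{1..s}. (\<Sum>j\<in>{0..s}. c j * a j l) = 0"
      using nontrivial_solution[of "{1..s}" "{0..s}" a] by auto
    have eq: "(\<Sum>j=1..s. c j * M j l) = c 0 * (if k = l then 1 else 0)" if "l \<in> {1..s}" for l
    proof -
      have "(\<Sum>j\<in>{0..s}. c j * a j l) = c 0 * a 0 l + (\<Sum>j=1..s. c j * a j l)"
        by (simp add: sum.atLeast_Suc_atMost)
      also have "(\<Sum>j=1..s. c j * a j l) = (\<Sum>j=1..s. c j * M j l)"
        by (intro sum.cong) (auto simp: a_def)
      finally show ?thesis using c(2) that by (auto simp: a_def eq_neg_iff_add_eq_0)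
    qed
    have "c 0 \<noteq> 0"
    proof
      assume "c 0 = 0"
      then have "c j = 0" if "j \<in> {1..s}" for j
        using indep_rowsD[OF M, of c] eq that by simp
      with c(1) \<open>c 0 = 0\<close> show False by (metis atLeastAtMost_iff less_one not_le)
    qed
    then have "(\<Sum>j=1..s. c j / c 0 * M j l) = (if k = l then 1 else 0)" if "l \<in> {1..s}" for l
      using eq[OF that] by (simp add: sum_divide_distrib[symmetric])
    then show ?thesis by (intro exI[of _ "\<lambda>j. c j / c 0"]) blast
  qed
  then show ?thesis by (rule bchoice[unfolded Ball_def[symmetric], OF ballI])
qed

text \<open>\<open>f\<close> orders the columns, and a pivot is the leading column of a combination
  of the rows in \<open>B\<close>. With fewer pivots than rows, a nontrivial combination would
  vanish at every pivot; but it is not zero, and its own leading column is a pivot.\<close>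

lemma indep_rows_pivots:
  fixes A :: "nat \<Rightarrow> nat \<Rightarrow> 'k::field" and f :: "nat \<Rightarrow> int"
  assumes A: "indep_rows r A" and B: "B \<subseteq> {1..r}" and f: "inj_on f {1..r}"
  shows "card B \<le> card {l \<in> {1..r}. \<exists>c. (\<Sum>j\<in>B. c j * A j l) \<noteq> 0 \<and>
           (\<forall>m\<in>{1..r}. f m < f l \<longrightarrow> (\<Sum>j\<in>B. c j * A j m) = 0)}" (is "_ \<le> card ?P")
proof (rule ccontr)
  assume "\<not> card B \<le> card ?P"
  then obtain c where c: "\<exists>j\<in>B. c j \<noteq> 0" "\<forall>l\<in>?P. (\<Sum>j\<in>B. c j * A j l) = 0"
    using nontrivial_solution[of ?P B A] finite_subset[OF B] by auto
  define S where "S = {l \<in> {1..r}. (\<Sum>j\<in>B. c j * A j l) \<noteq> 0}"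
  have "S \<noteq> {}"
  proof
    assume S: "S = {}"
    define e where "e j = (if j \<in> B then c j else 0)" for j
    have "(\<Sum>j=1..r. e j * A j l) = 0" if "l \<in> {1..r}" for l
    proof -
      have "(\<Sum>j=1..r. e j * A j l) = (\<Sum>j\<in>B. c j * A j l)"
        using B by (intro sum.mono_neutral_cong_right) (auto simp: e_def)
      then show ?thesis using S that by (auto simp: S_def)
    qed
    then have "e j = 0" if "j \<in> {1..r}" for j using indep_rowsD[OF A, of e] that by blast
    moreover obtain j where "j \<in> B" "c j \<noteq> 0" using c(1) by blast
    ultimately show False using B by (metis e_def subsetD)
  qed
  moreover have "finite S" by (simp add: S_def)
  ultimately have "\<exists>l. is_arg_min f (\<lambda>l. l \<in> S) l" by (rule ex_is_arg_min_if_finite[rotated])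
  then obtain l where l: "l \<in> S" "\<And>m. m \<in> S \<Longrightarrow> f l \<le> f m"
    by (auto simp: is_arg_min_linorder)
  have "l \<in> ?P"
  proof -
    have "(\<Sum>j\<in>B. c j * A j m) = 0" if "m \<in> {1..r}" "f m < f l" for m
    proof (rule ccontr)
      assume "(\<Sum>j\<in>B. c j * A j m) \<noteq> 0"
      with that(1) have "m \<in> S" unfolding S_def by blast
      from l(2)[OF this] that(2) show False by simp
    qed
    then show ?thesis using l(1) unfolding S_def by blast
  qed
  then show False using c(2) l(1) by (auto simp: S_def)
qed

text \<open>
  Lower bound for the slice rank of the unit tensor.  A common pivot \<open>l\<close> of suitable
  combinations of the rows, leading for the first factor and trailing for the second one,
  isolates the \<open>l\<close>-th summand.
\<close>

lemma unit_tensor_block_nonzero: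
  fixes A :: "nat \<Rightarrow> nat \<Rightarrow> nat \<Rightarrow> 'k::field"
  assumes d: "d \<ge> 2"
    and A: "\<And>i. i \<in> {1..d} \<Longrightarrow> indep_rows r (A i)"
    and B: "\<And>i. i \<in> {1..d} \<Longrightarrow> B i \<subseteq> {1..r}"
    and card: "(\<Sum>i=1..d. r - card (B i)) < r"
  shows "\<exists>J\<in>Pi\<^sub>E {1..d} B. (\<Sum>l=1..r. \<Prod>i=1..d. A i (J i) l) \<noteq> 0"
proof -
  \<comment> \<open>Reversing the order in the second factor makes combinations of factor 1 vanish
    before a common pivot and those of factor 2 after it, so that only one column survives in the
    product.\<close>
  define f where "f i = (if i = 2 then \<lambda>m. - int m else int)" for i :: nat
  have inj: "inj_on (f i) {1..r}" for i by (auto simp: f_def inj_on_def)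
  define P where "P i = {l \<in> {1..r}. \<exists>c. (\<Sum>j\<in>B i. c j * A i j l) \<noteq> 0 \<and>
      (\<forall>m\<in>{1..r}. f i m < f i l \<longrightarrow> (\<Sum>j\<in>B i. c j * A i j m) = 0)}" for i
  have cardP: "card (B i) \<le> card (P i)" if "i \<in> {1..d}" for i
    unfolding P_def by (rule indep_rows_pivots[OF A B inj]) (use that in auto)
  have Pr: "P i \<subseteq> {1..r}" for i by (auto simp: P_def)
  \<comment> \<open>In factor i at most r - card (B i) columns fail to be pivots. Together these are
    fewer than r columns and cannot cover {1..r}.\<close>
  have "\<exists>l\<in>{1..r}. \<forall>i\<in>{1..d}. l \<in> P i"
  proof (rule ccontr)
    assume "\<not> ?thesis"
    then have "{1..r} \<subseteq> (\<Union>i\<in>{1..d}. {1..r} - P i)" by blast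
    then have "card {1..r} \<le> card (\<Union>i\<in>{1..d}. {1..r} - P i)" by (intro card_mono) auto
    also have "\<dots> \<le> (\<Sum>i=1..d. card ({1..r} - P i))" by (rule card_UN_le) simp
    also have "\<dots> \<le> (\<Sum>i=1..d. r - card (B i))"
    proof (rule sum_mono)
      fix i assume "i \<in> {1..d}"
      then show "card ({1..r} - P i) \<le> r - card (B i)"
        using card_Diff_subset[OF finite_subset[OF Pr] Pr, of i] cardP[of i] by simp
    qed
    finally show False using card by simp
  qed
  then obtain l where l: "l \<in> {1..r}" "\<And>i. i \<in> {1..d} \<Longrightarrow> l \<in> P i" by blast
  then have "\<forall>i\<in>{1..d}. \<exists>c. (\<Sum>j\<in>B i. c j * A i j l) \<noteq> 0 \<and>
      (\<forall>m\<in>{1..r}. f i m < f i l \<longrightarrow> (\<Sum>j\<in>B i. c j * A i j m) = 0)"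
    unfolding P_def by blast
  from bchoice[OF this] obtain c where
    c: "\<And>i. i \<in> {1..d} \<Longrightarrow> (\<Sum>j\<in>B i. c i j * A i j l) \<noteq> 0"
       "\<And>i m. i \<in> {1..d} \<Longrightarrow> m \<in> {1..r} \<Longrightarrow> f i m < f i l \<Longrightarrow> (\<Sum>j\<in>B i. c i j * A i j m) = 0"
    by blast
  define x where "x i m = (\<Sum>j\<in>B i. c i j * A i j m)" for i m
  have fB: "finite (B i)" if "i \<in> {1..d}" for i using B[OF that] finite_subset by blast
  have off: "(\<Prod>i=1..d. x i m) = 0" if m: "m \<in> {1..r}" "m \<noteq> l" for m
  proof -
    define i where "i = (if m < l then 1 else 2 :: nat)"
    have i: "i \<in> {1..d}" using d by (auto simp: i_def)
    have "f i m < f i l" using m by (auto simp: i_def f_def)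
    then have "x i m = 0" using c(2)[OF i m(1)] by (simp add: x_def)
    then show ?thesis using i by (intro prod_zero) auto
  qed
  have "(\<Sum>m=1..r. \<Prod>i=1..d. x i m) = (\<Prod>i=1..d. x i l)"
  proof -
    have "(\<Sum>m\<in>{1..r}. \<Prod>i=1..d. x i m) = (\<Sum>m\<in>{l}. \<Prod>i=1..d. x i m)"
      by (rule sum.mono_neutral_right) (use l(1) off in blast)+
    then show ?thesis by simp
  qed
  also have "\<dots> \<noteq> 0" using c(1) by (simp add: x_def)
  finally have ne: "(\<Sum>m=1..r. \<Prod>i=1..d. x i m) \<noteq> 0" .
  \<comment> \<open>Multilinearity turns the nonzero sum into a combination of entries with indices
    in the blocks, so one of those entries is nonzero.\<close>
  have "(\<Sum>m=1..r. \<Prod>i=1..d. x i m) =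
      (\<Sum>m=1..r. \<Sum>J\<in>Pi\<^sub>E {1..d} B. \<Prod>i=1..d. c i (J i) * A i (J i) m)"
    unfolding x_def by (intro sum.cong refl prod_sum_PiE) (auto intro: fB)
  also have "\<dots> = (\<Sum>J\<in>Pi\<^sub>E {1..d} B. \<Sum>m=1..r. \<Prod>i=1..d. c i (J i) * A i (J i) m)"
    by (rule sum.swap)
  also have "\<dots> = (\<Sum>J\<in>Pi\<^sub>E {1..d} B. (\<Prod>i=1..d. c i (J i)) * (\<Sum>m=1..r. \<Prod>i=1..d. A i (J i) m))"
    by (simp add: prod.distrib sum_distrib_left)
  finally have "(\<Sum>J\<in>Pi\<^sub>E {1..d} B. (\<Prod>i=1..d. c i (J i)) * (\<Sum>m=1..r. \<Prod>i=1..d. A i (J i) m)) \<noteq> 0"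
    using ne by simp
  then obtain J where "J \<in> Pi\<^sub>E {1..d} B" "(\<Prod>i=1..d. c i (J i)) * (\<Sum>m=1..r. \<Prod>i=1..d. A i (J i) m) \<noteq> 0"
    by (rule sum.not_neutral_contains_not_neutral)
  then show ?thesis by auto
qed

lemma indep_rows_cong:
  assumes "\<And>j l. j \<in> {1..r} \<Longrightarrow> l \<in> {1..r} \<Longrightarrow> A j l = B j l" and "indep_rows r A"
  shows "indep_rows r B"
proof -
  have "(\<Sum>j=1..r. c j * A j l) = (\<Sum>j=1..r. c j * B j l)" if "l \<in> {1..r}" for c l
    using assms(1) that by (intro sum.cong) auto
  then show ?thesis using assms(2) unfolding indep_rows_def by simp
qed

section \<open>Row reduction over the valuation ring\<close>

definition row_comb :: "nat \<Rightarrow> (nat \<Rightarrow> nat \<Rightarrow> 'f::field) \<Rightarrow> (nat \<Rightarrow> 'c \<Rightarrow> 'f) \<Rightarrow> nat \<Rightarrow> 'c \<Rightarrow> 'f" where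
  "row_comb r g X j k = (\<Sum>l=1..r. g j l * X l k)"

context place
begin

text \<open>Invariant of the reduction after \<open>t\<close> rows of g X: a finished row is
  \<open>a j\<close> times an integral row with entry 1 at its pivot \<open>c j\<close>,
  \<open>a j\<close> divides everything that comes later, and later rows vanish in the pivot column.
  A zero row is recorded by a j = 0 and has no pivot.\<close>

definition reduced_rows ::
  "nat \<Rightarrow> 'c set \<Rightarrow> (nat \<Rightarrow> 'c \<Rightarrow> 'f) \<Rightarrow> nat \<Rightarrow> (nat \<Rightarrow> nat \<Rightarrow> 'f) \<Rightarrow> (nat \<Rightarrow> 'f) \<Rightarrow>
   (nat \<Rightarrow> 'c \<Rightarrow> 'f) \<Rightarrow> (nat \<Rightarrow> 'c) \<Rightarrow> bool" where
  "reduced_rows r N X t g a h c \<longleftrightarrow>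
     (\<forall>j\<in>{1..r}. \<forall>l\<in>{1..r}. g j l \<in> R) \<and> indep_rows r (\<lambda>j l. \<psi> (g j l)) \<and>
     (\<forall>j\<in>{1..t}. \<forall>k\<in>N. row_comb r g X j k = a j * h j k \<and> h j k \<in> R) \<and>
     (\<forall>j\<in>{1..t}. \<forall>j'\<in>{j..t}. val_dvd (a j) (a j')) \<and>
     (\<forall>j\<in>{1..t}. \<forall>j'\<in>{t<..r}. \<forall>k\<in>N. val_dvd (a j) (row_comb r g X j' k)) \<and>
     (\<forall>j\<in>{1..t}. a j \<noteq> 0 \<longrightarrow> c j \<in> N \<and> h j (c j) = 1 \<and>
        (\<forall>j'\<in>{j<..r}. row_comb r g X j' (c j) = 0))"

text \<open>The pivot is an entry of the remaining rows that divides all the others. The multipliers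
  of the elimination are then integral, so \<open>g\<close> stays integral with invertible reduction
  although \<open>X\<close> itself need not be integral.\<close>

lemma reduced_rows_exists:
  assumes N: "finite N" and "t \<le> r"
  shows "\<exists>g a h c. reduced_rows r N X t g a h c"
  using \<open>t \<le> r\<close>
proof (induction t)
  case 0
  have "indep_rows r (\<lambda>j l. \<psi> (if j = l then 1 else 0))"
    by (rule indep_rows_cong[OF _ indep_rows_identity]) (auto simp: hom_one hom_zero)
  then show ?case
    by (intro exI[of _ "\<lambda>j l. if j = l then 1 else 0"])
      (auto simp: reduced_rows_def one_closed zero_closed)
next
  case (Suc t)
  then obtain g a h c where "reduced_rows r N X t g a h c" by auto
  then have gR: "\<And>j l. j \<in> {1..r} \<Longrightarrow> l \<in> {1..r} \<Longrightarrow> g j l \<in> R"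
    and indep: "indep_rows r (\<lambda>j l. \<psi> (g j l))"
    and fact: "\<And>j k. j \<in> {1..t} \<Longrightarrow> k \<in> N \<Longrightarrow> row_comb r g X j k = a j * h j k \<and> h j k \<in> R"
    and chain: "\<And>j j'. j \<in> {1..t} \<Longrightarrow> j' \<in> {j..t} \<Longrightarrow> val_dvd (a j) (a j')"
    and below: "\<And>j j' k. j \<in> {1..t} \<Longrightarrow> j' \<in> {t<..r} \<Longrightarrow> k \<in> N \<Longrightarrow> val_dvd (a j) (row_comb r g X j' k)"
    and piv: "\<And>j. j \<in> {1..t} \<Longrightarrow> a j \<noteq> 0 \<Longrightarrow> c j \<in> N \<and> h j (c j) = 1"
    and piv0: "\<And>j j'. j \<in> {1..t} \<Longrightarrow> a j \<noteq> 0 \<Longrightarrow> j' \<in> {j<..r} \<Longrightarrow> row_comb r g X j' (c j) = 0"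
    unfolding reduced_rows_def by blast+
  let ?y = "row_comb r g X"
  show ?case
  proof (cases "\<forall>j\<in>{t<..r}. \<forall>k\<in>N. ?y j k = 0")
    case True
    have "reduced_rows r N X (Suc t) g (a(Suc t := 0)) (h(Suc t := \<lambda>_. 0)) c"
      unfolding reduced_rows_def
    proof (intro conjI ballI impI)
      fix j k assume j: "j \<in> {1..Suc t}" and k: "k \<in> N"
      have "j \<in> {1..t} \<or> j = Suc t" using j by auto
      then show "?y j k = (a(Suc t := 0)) j * (h(Suc t := \<lambda>_. 0)) j k" "(h(Suc t := \<lambda>_. 0)) j k \<in> R"
        using fact[of j k] k True Suc.prems zero_closed by auto
    next
      fix j j' assume j: "j \<in> {1..Suc t}" and j': "j' \<in> {j..Suc t}"
      show "val_dvd ((a(Suc t := 0)) j) ((a(Suc t := 0)) j')"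
        using chain[of j j'] j j' by auto
    next
      fix j j' k assume "j \<in> {1..Suc t}" "j' \<in> {Suc t<..r}" "k \<in> N"
      then show "val_dvd ((a(Suc t := 0)) j) (?y j' k)" using True by auto
    next
      fix j assume j: "j \<in> {1..Suc t}" "(a(Suc t := 0)) j \<noteq> 0"
      then have j': "j \<in> {1..t}" "a j \<noteq> 0" by (auto split: if_splits)
      then show "c j \<in> N" "(h(Suc t := \<lambda>_. 0)) j (c j) = 1"
        using piv[OF j'] by auto
      fix j2 assume "j2 \<in> {j<..r}"
      then show "?y j2 (c j) = 0" using piv0[OF j'] by blast
    qed (use gR indep in auto)
    then show ?thesis by blast
  next
    case False
    define S where "S = (\<lambda>(j, k). ?y j k) ` ({t<..r} \<times> N)"
    have "finite S" "S \<noteq> {}" using N False by (auto simp: S_def)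
    from val_dvd_min[OF this] obtain js ks where js: "js \<in> {t<..r}" and ks: "ks \<in> N"
      and min: "\<forall>x\<in>S. val_dvd (?y js ks) x" unfolding S_def by auto
    define m where "m = ?y js ks"
    have m_dvd: "val_dvd m (?y j k)" if "j \<in> {t<..r}" "k \<in> N" for j k
      using min that by (auto simp: m_def S_def)
    have m0: "m \<noteq> 0"
    proof
      assume "m = 0"
      then have "?y j k = 0" if "j \<in> {t<..r}" "k \<in> N" for j k
        using m_dvd[OF that] by (auto simp: val_dvd_def)
      then show False using False by blast
    qed
    have quot: "?y j k / m \<in> R" if "j \<in> {t<..r}" "k \<in> N" for j k
      using m_dvd[OF that] m0 by (auto simp: val_dvd_def)
    define \<pi> where "\<pi> j = (if j = js then Suc t else if j = Suc t then js else j)" for j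
    have \<pi>: "bij_betw \<pi> {1..r} {1..r}"
      by (rule bij_betw_byWitness[where f' = \<pi>]) (use js Suc.prems in \<open>auto simp: \<pi>_def\<close>)
    have \<pi>_in: "\<pi> j \<in> {1..r}" if "j \<in> {1..r}" for j using \<pi> that by (auto simp: bij_betw_def)
    have \<pi>_low: "\<pi> j = j" if "j \<le> t" for j using that js by (auto simp: \<pi>_def)
    have \<pi>_Suc: "\<pi> (Suc t) = js" by (simp add: \<pi>_def)
    have \<pi>_high: "\<pi> j \<in> {t<..r}" if "j \<in> {t<..r}" for j
      using that js by (auto simp: \<pi>_def)
    \<comment> \<open>Multipliers are 0 up to and including row Suc t, so that finished rows and the
      new pivot row survive the elimination.\<close>
    define q where "q j = (if j > Suc t then ?y (\<pi> j) ks / m else 0)" for j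
    have qR: "q j \<in> R" if "j \<in> {1..r}" for j
      using quot[OF \<pi>_high ks, of j] that zero_closed by (auto simp: q_def)
    define g' where "g' j l = g (\<pi> j) l - q j * g js l" for j l
    have y': "row_comb r g' X j k = ?y (\<pi> j) k - q j * ?y js k" for j k
      by (simp add: row_comb_def g'_def algebra_simps sum_subtractf sum_distrib_left)
    have js1: "js \<in> {1..r}" using js by auto
    define a' where "a' = a(Suc t := m)"
    define h' where "h' = h(Suc t := \<lambda>k. ?y js k / m)"
    define c' where "c' = c(Suc t := ks)"
    have low: "a' j = a j" "h' j = h j" "c' j = c j" if "j \<in> {1..t}" for j
      using that by (auto simp: a'_def h'_def c'_def)
    have top: "a' (Suc t) = m" "h' (Suc t) = (\<lambda>k. ?y js k / m)" "c' (Suc t) = ks"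
      by (auto simp: a'_def h'_def c'_def)
    have cases_j: "j \<in> {1..t} \<or> j = Suc t" if "j \<in> {1..Suc t}" for j using that by auto
    have "reduced_rows r N X (Suc t) g' a' h' c'"
      unfolding reduced_rows_def
    proof (intro conjI ballI impI)
      show "g' j l \<in> R" if "j \<in> {1..r}" "l \<in> {1..r}" for j l
        unfolding g'_def using that by (intro diff_closed mult_closed gR qR \<pi>_in js1)
      have "indep_rows r (\<lambda>j l. \<psi> (g (\<pi> j) l) - \<psi> (q j) * \<psi> (g (\<pi> (Suc t)) l))"
        by (rule indep_rows_eliminate[OF indep_rows_permute[OF indep \<pi>]])
          (use Suc.prems in \<open>auto simp: q_def hom_zero\<close>)
      then show "indep_rows r (\<lambda>j l. \<psi> (g' j l))"
        by (rule indep_rows_cong[rotated])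
          (simp only: g'_def \<pi>_Suc hom_diff hom_mult gR qR \<pi>_in js1 mult_closed)
    next
      fix j k assume j: "j \<in> {1..Suc t}" and k: "k \<in> N"
      from cases_j[OF j] have "row_comb r g' X j k = a' j * h' j k \<and> h' j k \<in> R"
      proof
        assume j: "j \<in> {1..t}"
        then have "q j = 0" "\<pi> j = j" using \<pi>_low by (auto simp: q_def)
        then show ?thesis using fact[OF j k] by (simp add: y' low[OF j])
      next
        assume j: "j = Suc t"
        show ?thesis using quot[OF js k] m0 by (simp add: j y' q_def \<pi>_Suc top)
      qed
      then show "row_comb r g' X j k = a' j * h' j k" "h' j k \<in> R" by blast+
    next
      fix j j' assume j: "j \<in> {1..Suc t}" and j': "j' \<in> {j..Suc t}"
      show "val_dvd (a' j) (a' j')"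
      proof (cases "j' = Suc t")
        case True
        from cases_j[OF j] show ?thesis
          using below[OF _ js ks, of j] True low(1)[of j] by (auto simp: top m_def val_dvd_refl)
      next
        case False
        then have "j' \<in> {j..t}" "j \<in> {1..t}" "j' \<in> {1..t}" using j j' by auto
        then show ?thesis using chain low by simp
      qed
    next
      fix j j' k assume j: "j \<in> {1..Suc t}" and j': "j' \<in> {Suc t<..r}" and k: "k \<in> N"
      have j'2: "j' \<in> {t<..r}" "j' \<in> {1..r}" using j' by auto
      have dv: "val_dvd (a' j) (?y i k)" if "i \<in> {t<..r}" for i
        using cases_j[OF j] below[OF _ that k, of j] m_dvd[OF that k] low(1)[of j] top by auto
      show "val_dvd (a' j) (row_comb r g' X j' k)"
        unfolding y' by (intro val_dvd_diff val_dvd_mult dv qR \<pi>_high j'2 js)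
    next
      fix j assume j: "j \<in> {1..Suc t}" and aj: "a' j \<noteq> 0"
      from cases_j[OF j] have "c' j \<in> N \<and> h' j (c' j) = 1 \<and>
          (\<forall>j'\<in>{j<..r}. row_comb r g' X j' (c' j) = 0)"
      proof
        assume j: "j \<in> {1..t}"
        then have aj: "a j \<noteq> 0" using aj low by simp
        have "row_comb r g' X j' (c j) = 0" if j': "j' \<in> {j<..r}" for j'
        proof -
          have "\<pi> j' \<in> {j<..r}"
          proof (cases "j' \<le> t")
            case True then show ?thesis using \<pi>_low j' by simp
          next
            case False
            then show ?thesis using \<pi>_high[of j'] j' j by auto
          qed
          moreover have "js \<in> {j<..r}" using js j by auto
          ultimately show ?thesis using piv0[OF j aj] by (simp add: y')
        qed
        then show ?thesis using piv[OF j aj] low[OF j] by simp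
      next
        assume j: "j = Suc t"
        have "row_comb r g' X j' ks = 0" if j': "j' \<in> {Suc t<..r}" for j'
          using j' m0 by (simp add: y' q_def m_def)
        then show ?thesis using ks m0 by (simp add: j top m_def)
      qed
      then show "c' j \<in> N" "h' j (c' j) = 1"
        "\<And>j'. j' \<in> {j<..r} \<Longrightarrow> row_comb r g' X j' (c' j) = 0" by blast+
    qed
    then show ?thesis by blast
  qed
qed

text \<open>At t = r the zeros below a pivot pass from g X to \<open>h\<close> wherever the diagonal
  entry of the row can be cancelled. This makes \<open>h\<close> triangular on the pivot
  columns.\<close>

lemma row_reduction:
  assumes N: "finite N"
  shows "\<exists>g a h c. (\<forall>j\<in>{1..r}. \<forall>l\<in>{1..r}. g j l \<in> R) \<and>
      indep_rows r (\<lambda>j l. \<psi> (g j l)) \<and>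
      (\<forall>j\<in>{1..r}. \<forall>k\<in>N. (\<Sum>l=1..r. g j l * X l k) = a j * h j k \<and> h j k \<in> R) \<and>
      (\<forall>j\<in>{1..r}. \<forall>j'\<in>{j..r}. val_dvd (a j) (a j')) \<and>
      (\<forall>j\<in>{1..r}. a j \<noteq> 0 \<longrightarrow> c j \<in> N \<and> h j (c j) = 1) \<and>
      (\<forall>j\<in>{1..r}. \<forall>j'\<in>{j<..r}. a j' \<noteq> 0 \<longrightarrow> h j' (c j) = 0)"
proof -
  obtain g a h c where red: "reduced_rows r N X r g a h c"
    using reduced_rows_exists[OF N order_refl] by blast
  have "h j' (c j) = 0" if j: "j \<in> {1..r}" and j': "j' \<in> {j<..r}" and aj': "a j' \<noteq> 0" for j j'
  proof -
    have j'1: "j' \<in> {1..r}" "j' \<in> {j..r}" using j j' by auto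
    have "val_dvd (a j) (a j')" using red j j'1 unfolding reduced_rows_def by blast
    then have aj: "a j \<noteq> 0" using aj' by (auto simp: val_dvd_def)
    then have "c j \<in> N" "row_comb r g X j' (c j) = 0"
      using red j j' unfolding reduced_rows_def by blast+
    moreover have "row_comb r g X j' (c j) = a j' * h j' (c j)"
      using red j'1 \<open>c j \<in> N\<close> unfolding reduced_rows_def by blast
    ultimately show "h j' (c j) = 0" using aj' by simp
  qed
  with red show ?thesis
    unfolding reduced_rows_def row_comb_def
    by (intro exI[of _ g] exI[of _ a] exI[of _ h] exI[of _ c]) blast
qed

end

section \<open>From an integral limit to a restriction over the residue field\<close>

text \<open>Contracting leg i of a sum of product tensors with g i acts on the i-th vectors
  separately. This serves for the row operations on the generic tensor, for the unit tensor and for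
  the final normalisation.\<close>

lemma sum_PiE_contract:
  fixes g :: "'i \<Rightarrow> 'b \<Rightarrow> 'a::comm_semiring_1"
  assumes "finite I" "\<And>i. i \<in> I \<Longrightarrow> finite (B i)"
  shows "(\<Sum>L\<in>Pi\<^sub>E I B. (\<Prod>i\<in>I. g i (L i)) * (\<Sum>K\<in>S. t K * (\<Prod>i\<in>I. X i (L i) K)))
       = (\<Sum>K\<in>S. t K * (\<Prod>i\<in>I. \<Sum>l\<in>B i. g i l * X i l K))"
proof -
  have "(\<Sum>L\<in>Pi\<^sub>E I B. (\<Prod>i\<in>I. g i (L i)) * (\<Sum>K\<in>S. t K * (\<Prod>i\<in>I. X i (L i) K)))
      = (\<Sum>L\<in>Pi\<^sub>E I B. \<Sum>K\<in>S. t K * (\<Prod>i\<in>I. g i (L i) * X i (L i) K))"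
    by (simp add: sum_distrib_left prod.distrib ac_simps)
  also have "\<dots> = (\<Sum>K\<in>S. t K * (\<Sum>L\<in>Pi\<^sub>E I B. \<Prod>i\<in>I. g i (L i) * X i (L i) K))"
    by (subst sum.swap) (simp add: sum_distrib_left)
  also have "\<dots> = (\<Sum>K\<in>S. t K * (\<Prod>i\<in>I. \<Sum>l\<in>B i. g i l * X i l K))"
    by (subst prod_sum_PiE) (use assms in auto)
  finally show ?thesis .
qed

context place
begin

context
  fixes d r :: nat and n :: "nat \<Rightarrow> nat" and X :: "nat \<Rightarrow> nat \<Rightarrow> nat \<Rightarrow> 'f"
    and T :: "(nat \<Rightarrow> nat) \<Rightarrow> 'k"
  assumes d: "d \<ge> 2"
    and lim: "\<And>L. L \<in> Pi\<^sub>E {1..d} (\<lambda>_. {1..r}) \<Longrightarrow>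
      (\<Sum>K\<in>Pi\<^sub>E {1..d} (\<lambda>i. {1..n i}). \<iota> (T K) * (\<Prod>i=1..d. X i (L i) (K i))) \<in> R \<and>
      \<psi> (\<Sum>K\<in>Pi\<^sub>E {1..d} (\<lambda>i. {1..n i}). \<iota> (T K) * (\<Prod>i=1..d. X i (L i) (K i)))
        = (\<Sum>l=1..r. \<Prod>i=1..d. if L i = l then 1 else 0)"
begin

text \<open>\<open>Z\<close> is the generic tensor after the row operations \<open>g\<close>:
  integral, with residue the unit tensor moved by the invertible \<open>\<gamma> i\<close>. It is
  also a product of diagonal entries times \<open>H\<close>, the restriction of \<open>T\<close>
  along the integral \<open>h i\<close>. Comparison gives both claims: nonzero residues of
  \<open>Z\<close> keep the diagonal entries from being too small, and dividing by them shows the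
  residue of \<open>H\<close> on the small rows to be a sum of r product tensors.\<close>

lemma limit_restriction:
  shows limit_restriction_le: "\<And>i. i \<in> {1..d} \<Longrightarrow> r \<le> n i"
    and limit_restriction_ex: "s = r div d \<Longrightarrow> \<exists>p u c.
      (\<forall>i\<in>{1..d}. \<forall>j\<in>{1..s}. c i j \<in> {1..n i}) \<and>
      (\<forall>i\<in>{1..d}. \<forall>j\<in>{1..s}. \<forall>l\<in>{1..s}. p i j (c i l) = (if j = l then 1 else 0)) \<and>
      (\<forall>L\<in>Pi\<^sub>E {1..d} (\<lambda>_. {1..s}).
         (\<Sum>K\<in>Pi\<^sub>E {1..d} (\<lambda>i. {1..n i}). T K * (\<Prod>i=1..d. p i (L i) (K i)))
         = (\<Sum>l=1..r. \<Prod>i=1..d. u i (L i) l))"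
proof -
  have "\<forall>i. \<exists>g a h c. (\<forall>j\<in>{1..r}. \<forall>l\<in>{1..r}. g j l \<in> R) \<and>
      indep_rows r (\<lambda>j l. \<psi> (g j l)) \<and>
      (\<forall>j\<in>{1..r}. \<forall>k\<in>{1..n i}. (\<Sum>l=1..r. g j l * X i l k) = a j * h j k \<and> h j k \<in> R) \<and>
      (\<forall>j\<in>{1..r}. \<forall>j'\<in>{j..r}. val_dvd (a j) (a j')) \<and>
      (\<forall>j\<in>{1..r}. a j \<noteq> 0 \<longrightarrow> c j \<in> {1..n i} \<and> h j (c j) = 1) \<and>
      (\<forall>j\<in>{1..r}. \<forall>j'\<in>{j<..r}. a j' \<noteq> 0 \<longrightarrow> h j' (c j) = 0)"
    (is "\<forall>i. \<exists>g a h c. ?P i g a h c")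
    using row_reduction[OF finite_atLeastAtMost] by blast
  from choice[OF this] obtain g where "\<forall>i. \<exists>a h c. ?P i (g i) a h c" ..
  from choice[OF this] obtain a where "\<forall>i. \<exists>h c. ?P i (g i) (a i) h c" ..
  from choice[OF this] obtain h where "\<forall>i. \<exists>c. ?P i (g i) (a i) (h i) c" ..
  from choice[OF this] obtain c where P: "\<forall>i. ?P i (g i) (a i) (h i) (c i)" ..
  have gR: "g i j l \<in> R" if "j \<in> {1..r}" "l \<in> {1..r}" for i j l using P that by blast
  have indep: "indep_rows r (\<lambda>j l. \<psi> (g i j l))" for i using P by blast
  have fact: "(\<Sum>l=1..r. g i j l * X i l k) = a i j * h i j k" "h i j k \<in> R"
    if "j \<in> {1..r}" "k \<in> {1..n i}" for i j k using P that by blast+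
  have chain: "val_dvd (a i j) (a i j')" if "j \<in> {1..r}" "j' \<in> {j..r}" for i j j' using P that by blast
  have piv: "c i j \<in> {1..n i}" "h i j (c i j) = 1" if "j \<in> {1..r}" "a i j \<noteq> 0" for i j
    using P that by blast+
  have piv0: "h i j' (c i j) = 0" if "j \<in> {1..r}" "j' \<in> {j<..r}" "a i j' \<noteq> 0" for i j j'
    using P that by blast
  have a_le: "a i j \<noteq> 0" if "j \<in> {1..r}" "j' \<in> {j..r}" "a i j' \<noteq> 0" for i j j'
    using chain[OF that(1,2), of i] that(3) by (auto simp: val_dvd_def)
  define \<gamma> where "\<gamma> i j l = \<psi> (g i j l)" for i j l
  define W where "W L = (\<Sum>K\<in>Pi\<^sub>E {1..d} (\<lambda>i. {1..n i}). \<iota> (T K) * (\<Prod>i=1..d. X i (L i) (K i)))" for L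
  define Z where "Z J = (\<Sum>L\<in>Pi\<^sub>E {1..d} (\<lambda>_. {1..r}). (\<Prod>i=1..d. g i (J i) (L i)) * W L)" for J
  define H where "H J = (\<Sum>K\<in>Pi\<^sub>E {1..d} (\<lambda>i. {1..n i}). \<iota> (T K) * (\<Prod>i=1..d. h i (J i) (K i)))" for J
  have PiE_in: "J i \<in> B i" if "J \<in> Pi\<^sub>E {1..d} B" "i \<in> {1..d}" for J i and B :: "nat \<Rightarrow> nat set"
    using that by blast
  have gL: "g i (J i) (L i) \<in> R" if "J \<in> Pi\<^sub>E {1..d} (\<lambda>_. {1..r})" "L \<in> Pi\<^sub>E {1..d} (\<lambda>_. {1..r})" "i \<in> {1..d}" for i J L
    using gR PiE_in[OF that(1,3)] PiE_in[OF that(2,3)] by blast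
  have ZR: "Z J \<in> R" if J: "J \<in> Pi\<^sub>E {1..d} (\<lambda>_. {1..r})" for J
    unfolding Z_def using lim by (intro sum_closed mult_closed prod_closed gL[OF J]) (auto simp: W_def)
  have \<psi>Z: "\<psi> (Z J) = (\<Sum>l=1..r. \<Prod>i=1..d. \<gamma> i (J i) l)" if J: "J \<in> Pi\<^sub>E {1..d} (\<lambda>_. {1..r})" for J
  proof -
    have "\<psi> (Z J) = (\<Sum>L\<in>Pi\<^sub>E {1..d} (\<lambda>_. {1..r}). \<psi> ((\<Prod>i=1..d. g i (J i) (L i)) * W L))"
      unfolding Z_def using lim
      by (intro hom_sum mult_closed prod_closed gL[OF J]) (auto simp: W_def)
    also have "\<dots> = (\<Sum>L\<in>Pi\<^sub>E {1..d} (\<lambda>_. {1..r}). (\<Prod>i=1..d. \<gamma> i (J i) (L i)) *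
        (\<Sum>l=1..r. 1 * (\<Prod>i=1..d. if L i = l then 1 else 0)))"
    proof (intro sum.cong refl)
      fix L assume L: "L \<in> Pi\<^sub>E {1..d} (\<lambda>_. {1..r})"
      have "\<psi> ((\<Prod>i=1..d. g i (J i) (L i)) * W L) = \<psi> (\<Prod>i=1..d. g i (J i) (L i)) * \<psi> (W L)"
        using lim[OF L] by (intro hom_mult prod_closed gL[OF J L]) (auto simp: W_def)
      also have "\<psi> (\<Prod>i=1..d. g i (J i) (L i)) = (\<Prod>i=1..d. \<gamma> i (J i) (L i))"
        unfolding \<gamma>_def by (intro hom_prod gL[OF J L])
      finally show "\<psi> ((\<Prod>i=1..d. g i (J i) (L i)) * W L) = (\<Prod>i=1..d. \<gamma> i (J i) (L i)) *
        (\<Sum>l=1..r. 1 * (\<Prod>i=1..d. if L i = l then 1 else 0))"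
        using lim[OF L] by (simp add: W_def)
    qed
    also have "\<dots> = (\<Sum>l=1..r. 1 * (\<Prod>i=1..d. \<Sum>m\<in>{1..r}. \<gamma> i (J i) m * (if m = l then 1 else 0)))"
      by (rule sum_PiE_contract) auto
    also have "\<dots> = (\<Sum>l=1..r. \<Prod>i=1..d. \<gamma> i (J i) l)"
      by (intro sum.cong refl) (simp add: if_distrib[of "\<lambda>x. _ * x"] sum.delta cong: if_cong)
    finally show ?thesis .
  qed
  have hR: "h i (J i) (K i) \<in> R"
    if "J \<in> Pi\<^sub>E {1..d} (\<lambda>_. {1..r})" "K \<in> Pi\<^sub>E {1..d} (\<lambda>i. {1..n i})" "i \<in> {1..d}" for i J K
    using fact(2) PiE_in[OF that(1,3)] PiE_in[OF that(2,3)] by blast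
  have ZH: "Z J = (\<Prod>i=1..d. a i (J i)) * H J" if J: "J \<in> Pi\<^sub>E {1..d} (\<lambda>_. {1..r})" for J
  proof -
    have "Z J = (\<Sum>K\<in>Pi\<^sub>E {1..d} (\<lambda>i. {1..n i}). \<iota> (T K) *
        (\<Prod>i=1..d. \<Sum>l\<in>{1..r}. g i (J i) l * X i l (K i)))"
      unfolding Z_def W_def by (rule sum_PiE_contract) auto
    also have "\<dots> = (\<Sum>K\<in>Pi\<^sub>E {1..d} (\<lambda>i. {1..n i}). \<iota> (T K) *
        (\<Prod>i=1..d. a i (J i) * h i (J i) (K i)))"
      using PiE_in[OF J] by (intro sum.cong prod.cong refl arg_cong2[of _ _ _ _ "(*)"] fact(1)) auto
    also have "\<dots> = (\<Prod>i=1..d. a i (J i)) * H J"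
      by (simp add: H_def prod.distrib sum_distrib_left ac_simps)
    finally show ?thesis .
  qed
  have HR: "H J \<in> R" if J: "J \<in> Pi\<^sub>E {1..d} (\<lambda>_. {1..r})" for J
    unfolding H_def by (intro sum_closed mult_closed prod_closed const_closed hR[OF J])
  have \<psi>H: "\<psi> (H J) = (\<Sum>K\<in>Pi\<^sub>E {1..d} (\<lambda>i. {1..n i}). T K * (\<Prod>i=1..d. \<psi> (h i (J i) (K i))))"
    if J: "J \<in> Pi\<^sub>E {1..d} (\<lambda>_. {1..r})" for J
  proof -
    have "\<psi> (H J) = (\<Sum>K\<in>Pi\<^sub>E {1..d} (\<lambda>i. {1..n i}). \<psi> (\<iota> (T K) * (\<Prod>i=1..d. h i (J i) (K i))))"
      unfolding H_def by (intro hom_sum mult_closed prod_closed const_closed hR[OF J])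
    also have "\<dots> = (\<Sum>K\<in>Pi\<^sub>E {1..d} (\<lambda>i. {1..n i}). T K * (\<Prod>i=1..d. \<psi> (h i (J i) (K i))))"
    proof (intro sum.cong refl)
      fix K assume K: "K \<in> Pi\<^sub>E {1..d} (\<lambda>i. {1..n i})"
      have "\<psi> (\<iota> (T K) * (\<Prod>i=1..d. h i (J i) (K i))) = \<psi> (\<iota> (T K)) * \<psi> (\<Prod>i=1..d. h i (J i) (K i))"
        by (intro hom_mult prod_closed const_closed hR[OF J K])
      also have "\<psi> (\<Prod>i=1..d. h i (J i) (K i)) = (\<Prod>i=1..d. \<psi> (h i (J i) (K i)))"
        by (intro hom_prod hR[OF J K])
      finally show "\<psi> (\<iota> (T K) * (\<Prod>i=1..d. h i (J i) (K i))) = T K * (\<Prod>i=1..d. \<psi> (h i (J i) (K i)))"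
        by (simp add: hom_const)
    qed
    finally show ?thesis .
  qed
  \<comment> \<open>The slice rank bound, read at the residue: a block omitting fewer than r rows
    over all factors has an entry of \<open>Z\<close> outside the maximal ideal.\<close>
  have block: "\<exists>J\<in>Pi\<^sub>E {1..d} B. J \<in> Pi\<^sub>E {1..d} (\<lambda>_. {1..r}) \<and> \<psi> (Z J) \<noteq> 0"
    if B: "\<And>i. i \<in> {1..d} \<Longrightarrow> B i \<subseteq> {1..r}" and card: "(\<Sum>i=1..d. r - card (B i)) < r" for B
  proof -
    obtain J where J: "J \<in> Pi\<^sub>E {1..d} B" "(\<Sum>l=1..r. \<Prod>i=1..d. \<gamma> i (J i) l) \<noteq> 0"
      using unit_tensor_block_nonzero[OF d, of r \<gamma> B] indep B card unfolding \<gamma>_def by blast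
    have "J \<in> Pi\<^sub>E {1..d} (\<lambda>_. {1..r})" using J(1) PiE_mono[of "{1..d}" B "\<lambda>_. {1..r}"] B by blast
    with J \<psi>Z show ?thesis by metis
  qed
  show "r \<le> n i0" if i0: "i0 \<in> {1..d}" for i0
  proof (rule ccontr)
    assume "\<not> r \<le> n i0"
    then have r: "r \<ge> 1" "n i0 < r" by auto
    \<comment> \<open>Otherwise all r diagonal entries of factor i0 are nonzero, which gives r
      distinct pivot columns among only n i0.\<close>
    have "a i0 r = 0"
    proof (rule ccontr)
      assume "a i0 r \<noteq> 0"
      then have a0: "a i0 j \<noteq> 0" if "j \<in> {1..r}" for j using a_le[OF that] that by auto
      have ne: "c i0 j \<noteq> c i0 j'" if "j \<in> {1..r}" "j' \<in> {1..r}" "j < j'" for j j'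
      proof
        assume "c i0 j = c i0 j'"
        then have "h i0 j' (c i0 j') = 0" using piv0[of j j' i0] a0 that by simp
        then show False using piv(2)[of j' i0] a0 that by simp
      qed
      have "inj_on (c i0) {1..r}"
        using ne by (intro inj_onI) (metis linorder_neqE_nat)
      moreover have "c i0 ` {1..r} \<subseteq> {1..n i0}" using piv(1) a0 by blast
      ultimately have "card {1..r} \<le> card {1..n i0}" by (intro card_inj_on_le[of "c i0"]) auto
      then show False using r by simp
    qed
    \<comment> \<open>Keeping only the last row of factor i0 omits r - 1 rows, one too few to kill
      the residue; yet this slice of \<open>Z\<close> is zero because a i0 r = 0.\<close>
    define B where "B i = (if i = i0 then {r} else {1..r})" for i
    have "(\<Sum>i=1..d. r - card (B i)) = (\<Sum>i=1..d. if i = i0 then r - 1 else 0)"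
      by (intro sum.cong) (auto simp: B_def)
    also have "\<dots> < r" using i0 r by (simp add: sum.delta)
    finally have card: "(\<Sum>i=1..d. r - card (B i)) < r" .
    have "B i \<subseteq> {1..r}" for i using r by (simp add: B_def)
    from block[OF this card] obtain J where
      J: "J \<in> Pi\<^sub>E {1..d} B" "J \<in> Pi\<^sub>E {1..d} (\<lambda>_. {1..r})" "\<psi> (Z J) \<noteq> 0" by blast
    have "J i0 = r" using PiE_in[OF J(1) i0] by (simp add: B_def)
    then have prod0: "(\<Prod>i=1..d. a i (J i)) = 0" using \<open>a i0 r = 0\<close> i0 by (intro prod_zero) auto
    have "Z J = 0" by (simp only: ZH[OF J(2)] prod0 mult_zero_left)
    then show False using J(3) hom_zero by simp
  qed
  assume s: "s = r div d"
  show "\<exists>p u c.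
      (\<forall>i\<in>{1..d}. \<forall>j\<in>{1..s}. c i j \<in> {1..n i}) \<and>
      (\<forall>i\<in>{1..d}. \<forall>j\<in>{1..s}. \<forall>l\<in>{1..s}. p i j (c i l) = (if j = l then 1 else 0)) \<and>
      (\<forall>L\<in>Pi\<^sub>E {1..d} (\<lambda>_. {1..s}).
         (\<Sum>K\<in>Pi\<^sub>E {1..d} (\<lambda>i. {1..n i}). T K * (\<Prod>i=1..d. p i (L i) (K i)))
         = (\<Sum>l=1..r. \<Prod>i=1..d. u i (L i) l))"
  proof (cases "s = 0")
    case True
    then have "Pi\<^sub>E {1..d} (\<lambda>_. {1..s}) = {}" using d by (auto simp: PiE_eq_empty_iff)
    then show ?thesis using True by simp
  next
    case False
    have ds: "d * s \<le> r" using s by simp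
    have sr: "s \<le> r" using ds d False by (metis div_le_dividend s)
    define b where "b = (\<Prod>i=1..d. a i s)"
    \<comment> \<open>Keeping the rows s..r in every factor omits d (s - 1) < r rows, so some entry
      of the block has nonzero residue. Since \<open>b\<close> divides every entry of the block, it
      cannot lie in the maximal ideal.\<close>
    have not_small: "\<not> (b \<in> R \<and> \<psi> b = 0)"
    proof
      assume b: "b \<in> R \<and> \<psi> b = 0"
      have "(\<Sum>i=1..d. r - card {s..r}) = d * (s - 1)" using sr False by simp
      also have "\<dots> < r" using ds d False by (cases s) auto
      finally have card: "(\<Sum>i=1..d. r - card {s..r}) < r" .
      have "{s..r} \<subseteq> {1..r}" using False by simp
      from block[OF this card] obtain J where
        J: "J \<in> Pi\<^sub>E {1..d} (\<lambda>_. {s..r})" "J \<in> Pi\<^sub>E {1..d} (\<lambda>_. {1..r})" "\<psi> (Z J) \<noteq> 0" by blast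
      have "\<forall>i\<in>{1..d}. \<exists>q\<in>R. a i (J i) = q * a i s"
      proof
        fix i assume "i \<in> {1..d}"
        then have "J i \<in> {s..r}" using PiE_in[OF J(1)] by blast
        then show "\<exists>q\<in>R. a i (J i) = q * a i s"
          using chain[of s "J i" i] sr False by (auto simp: val_dvd_def)
      qed
      from bchoice[OF this[unfolded Bex_def]] obtain q where
        q: "\<And>i. i \<in> {1..d} \<Longrightarrow> q i \<in> R \<and> a i (J i) = q i * a i s" by blast
      have "(\<Prod>i=1..d. a i (J i)) = (\<Prod>i=1..d. q i) * b"
        unfolding b_def prod.distrib[symmetric] using q by (intro prod.cong) auto
      then have "Z J = ((\<Prod>i=1..d. q i) * H J) * b" using ZH[OF J(2)] by simp
      moreover have "(\<Prod>i=1..d. q i) * H J \<in> R" using q HR[OF J(2)] by (intro mult_closed prod_closed) auto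
      ultimately have "\<psi> (Z J) = 0" using b hom_mult by simp
      with J show False by simp
    qed
    have b0: "b \<noteq> 0" using not_small zero_closed hom_zero by auto
    \<comment> \<open>\<open>b\<close> may lie outside \<open>R\<close>. In that case the valuation
      axiom makes its inverse integral, otherwise its nonzero residue does.\<close>
    have binv: "inverse b \<in> R" using not_small valuation[of b] unit_closed[of b] by blast
    have s1: "s \<in> {1..r}" using sr False by auto
    have as0: "a i s \<noteq> 0" if "i \<in> {1..d}" for i
      using b0 that unfolding b_def by (metis finite_atLeastAtMost prod_zero)
    have "\<forall>i j. \<exists>q. j \<in> {1..s} \<longrightarrow> q \<in> R \<and> a i s = q * a i j"
      using chain[of _ s] sr unfolding val_dvd_def by (metis atLeastAtMost_iff order_trans)
    then obtain q where q: "\<And>i j. j \<in> {1..s} \<Longrightarrow> q i j \<in> R \<and> a i s = q i j * a i j" by metis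
    have sub: "J \<in> Pi\<^sub>E {1..d} (\<lambda>_. {1..r})" if "J \<in> Pi\<^sub>E {1..d} (\<lambda>_. {1..s})" for J
      using that PiE_mono[of "{1..d}" "\<lambda>_. {1..s}" "\<lambda>_. {1..r}"] sr by auto
    \<comment> \<open>H J equals Z J times 1/b times the product of the q i (J i). The scalar 1/b
      belongs to no particular factor and is put into the first.\<close>
    define u0 where "u0 i j l = (if i = 1 then \<psi> (inverse b) else 1) * \<psi> (q i j) * \<gamma> i j l" for i j l
    have \<psi>H2: "\<psi> (H J) = (\<Sum>l=1..r. 1 * (\<Prod>i=1..d. u0 i (J i) l))" if J: "J \<in> Pi\<^sub>E {1..d} (\<lambda>_. {1..s})" for J
    proof -
      have qJ: "q i (J i) \<in> R \<and> a i s = q i (J i) * a i (J i)" if "i \<in> {1..d}" for i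
        using q PiE_in[OF J that] by blast
      have prod_b: "(\<Prod>i=1..d. q i (J i)) * (\<Prod>i=1..d. a i (J i)) = b"
        unfolding b_def prod.distrib[symmetric] using qJ by (intro prod.cong) auto
      have "H J = inverse b * (\<Prod>i=1..d. q i (J i)) * Z J"
        unfolding ZH[OF sub[OF J]] using prod_b b0
        by (metis (no_types, lifting) left_inverse mult.assoc mult.left_neutral)
      moreover have qR: "(\<Prod>i=1..d. q i (J i)) \<in> R" using qJ by (intro prod_closed) blast
      ultimately have "\<psi> (H J) = \<psi> (inverse b * (\<Prod>i=1..d. q i (J i))) * \<psi> (Z J)"
        by (simp only: hom_mult mult_closed binv ZR[OF sub[OF J]])
      also have "\<psi> (inverse b * (\<Prod>i=1..d. q i (J i))) = \<psi> (inverse b) * \<psi> (\<Prod>i=1..d. q i (J i))"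
        by (rule hom_mult[OF binv qR])
      also have "\<psi> (\<Prod>i=1..d. q i (J i)) = (\<Prod>i=1..d. \<psi> (q i (J i)))"
        using qJ by (intro hom_prod) blast
      also have "\<psi> (inverse b) = (\<Prod>i=1..d. if i = 1 then \<psi> (inverse b) else 1)"
        using d by (simp add: prod.delta)
      finally show ?thesis
        unfolding \<psi>Z[OF sub[OF J]] u0_def
        by (simp only: sum_distrib_left prod.distrib mult_1)
    qed
    \<comment> \<open>On the first s pivot columns the residues of h i form a unitriangular matrix.
      Its left inverse \<open>\<tau>\<close> changes the rows so that this submatrix becomes the
      identity.\<close>
    have "\<forall>i\<in>{1..d}. \<exists>\<tau>. \<forall>k\<in>{1..s}. \<forall>l\<in>{1..s}.
        (\<Sum>j=1..s. \<tau> k j * \<psi> (h i j (c i l))) = (if k = l then 1 else 0)"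
    proof
      fix i assume i: "i \<in> {1..d}"
      have a0: "a i j \<noteq> 0" if "j \<in> {1..s}" for j
        using a_le[of j s i] as0[OF i] that sr by auto
      show "\<exists>\<tau>. \<forall>k\<in>{1..s}. \<forall>l\<in>{1..s}.
        (\<Sum>j=1..s. \<tau> k j * \<psi> (h i j (c i l))) = (if k = l then 1 else 0)"
      proof (intro indep_rows_left_inverse indep_rows_unitriangular)
        show "\<psi> (h i j (c i j)) = 1" if "j \<in> {1..s}" for j
          using piv(2)[of j i] a0[OF that] that sr hom_one by auto
        show "\<psi> (h i j (c i l)) = 0" if "j \<in> {1..s}" "l \<in> {1..s}" "l < j" for j l
          using piv0[of l j i] a0[OF that(1)] that sr hom_zero by auto
      qed
    qed
    from bchoice[OF this] obtain \<tau> where \<tau>: "\<And>i k l. i \<in> {1..d} \<Longrightarrow> k \<in> {1..s} \<Longrightarrow> l \<in> {1..s} \<Longrightarrow>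
        (\<Sum>j=1..s. \<tau> i k j * \<psi> (h i j (c i l))) = (if k = l then 1 else 0)" by blast
    define p where "p i k m = (\<Sum>j\<in>{1..s}. \<tau> i k j * \<psi> (h i j m))" for i k m
    define u where "u i k l = (\<Sum>j\<in>{1..s}. \<tau> i k j * u0 i j l)" for i k l
    have "(\<Sum>K\<in>Pi\<^sub>E {1..d} (\<lambda>i. {1..n i}). T K * (\<Prod>i=1..d. p i (L i) (K i)))
         = (\<Sum>l=1..r. \<Prod>i=1..d. u i (L i) l)" for L
    proof -
      have "(\<Sum>K\<in>Pi\<^sub>E {1..d} (\<lambda>i. {1..n i}). T K * (\<Prod>i=1..d. p i (L i) (K i)))
          = (\<Sum>J\<in>Pi\<^sub>E {1..d} (\<lambda>_. {1..s}). (\<Prod>i=1..d. \<tau> i (L i) (J i)) *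
             (\<Sum>K\<in>Pi\<^sub>E {1..d} (\<lambda>i. {1..n i}). T K * (\<Prod>i=1..d. \<psi> (h i (J i) (K i)))))"
        unfolding p_def by (rule sum_PiE_contract[symmetric]) auto
      also have "\<dots> = (\<Sum>J\<in>Pi\<^sub>E {1..d} (\<lambda>_. {1..s}). (\<Prod>i=1..d. \<tau> i (L i) (J i)) *
             (\<Sum>l=1..r. 1 * (\<Prod>i=1..d. u0 i (J i) l)))"
        by (intro sum.cong refl) (simp only: \<psi>H[OF sub, symmetric] \<psi>H2)
      also have "\<dots> = (\<Sum>l=1..r. 1 * (\<Prod>i=1..d. u i (L i) l))"
        unfolding u_def by (rule sum_PiE_contract) auto
      finally show ?thesis by simp
    qed
    moreover have "c i j \<in> {1..n i}" if "i \<in> {1..d}" "j \<in> {1..s}" for i j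
      using piv(1)[of j i] a_le[of j s i] as0[OF that(1)] that sr by auto
    moreover have "p i j (c i l) = (if j = l then 1 else 0)" if "i \<in> {1..d}" "j \<in> {1..s}" "l \<in> {1..s}" for i j l
      using \<tau>[OF that] by (simp add: p_def)
    ultimately show ?thesis by blast
  qed
qed

end

end

subsection \<open>Points of the closure as specialisations of the generic point\<close>

text \<open>Syntax for polynomials with unknowns from any type, so that one expression can be
  evaluated at the polynomials \<open>w\<close> as well as at points over k.\<close>

datatype ('v, 'k) poly_expr =
  PConst 'k
| PVar 'v
| PAdd "('v, 'k) poly_expr" "('v, 'k) poly_expr"
| PMul "('v, 'k) poly_expr" "('v, 'k) poly_expr"

primrec peval :: "('k \<Rightarrow> 'a::comm_ring_1) \<Rightarrow> ('v \<Rightarrow> 'a) \<Rightarrow> ('v, 'k) poly_expr \<Rightarrow> 'a" where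
  "peval \<iota> x (PConst c) = \<iota> c"
| "peval \<iota> x (PVar v) = x v"
| "peval \<iota> x (PAdd e f) = peval \<iota> x e + peval \<iota> x f"
| "peval \<iota> x (PMul e f) = peval \<iota> x e * peval \<iota> x f"

section \<open>Evaluation of multivariate polynomials\<close>

type_synonym 'k mpoly = "(nat \<Rightarrow>\<^sub>0 nat) \<Rightarrow>\<^sub>0 'k"

definition mono_eval :: "(nat \<Rightarrow> 'k::comm_ring_1) \<Rightarrow> (nat \<Rightarrow>\<^sub>0 nat) \<Rightarrow> 'k" where
  "mono_eval x m = (\<Prod>v\<in>Poly_Mapping.keys m. x v ^ Poly_Mapping.lookup m v)"

definition mpoly_eval :: "(nat \<Rightarrow> 'k::comm_ring_1) \<Rightarrow> 'k mpoly \<Rightarrow> 'k" where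
  "mpoly_eval x p = (\<Sum>m\<in>Poly_Mapping.keys p. Poly_Mapping.lookup p m * mono_eval x m)"

abbreviation mpoly_const :: "'k::comm_ring_1 \<Rightarrow> 'k mpoly" where
  "mpoly_const c \<equiv> Poly_Mapping.single 0 c"

abbreviation mpoly_var :: "nat \<Rightarrow> 'k::comm_ring_1 mpoly" where
  "mpoly_var v \<equiv> Poly_Mapping.single (Poly_Mapping.single v 1) 1"

lemma mono_eval_superset:
  assumes "finite V" "Poly_Mapping.keys m \<subseteq> V"
  shows "mono_eval x m = (\<Prod>v\<in>V. x v ^ Poly_Mapping.lookup m v)"
  unfolding mono_eval_def using assms
  by (intro prod.mono_neutral_left) (auto simp: in_keys_iff)

lemma mono_eval_add: "mono_eval x (m + m') = mono_eval x m * mono_eval x m'"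
proof -
  let ?V = "Poly_Mapping.keys m \<union> Poly_Mapping.keys m'"
  have "Poly_Mapping.keys (m + m') \<subseteq> ?V" by (rule Poly_Mapping.keys_add)
  then have "mono_eval x (m + m') = (\<Prod>v\<in>?V. x v ^ Poly_Mapping.lookup (m + m') v)"
    by (intro mono_eval_superset) auto
  also have "\<dots> = mono_eval x m * mono_eval x m'"
    by (simp add: mono_eval_superset[of ?V] lookup_add power_add prod.distrib)
  finally show ?thesis .
qed

lemma mpoly_eval_superset:
  assumes "finite V" "Poly_Mapping.keys p \<subseteq> V"
  shows "mpoly_eval x p = (\<Sum>m\<in>V. Poly_Mapping.lookup p m * mono_eval x m)"
  unfolding mpoly_eval_def using assms
  by (intro sum.mono_neutral_left) (auto simp: in_keys_iff)

lemma mpoly_eval_add: "mpoly_eval x (p + q) = mpoly_eval x p + mpoly_eval x q"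
proof -
  let ?V = "Poly_Mapping.keys p \<union> Poly_Mapping.keys q"
  have "Poly_Mapping.keys (p + q) \<subseteq> ?V" by (rule Poly_Mapping.keys_add)
  then have "mpoly_eval x (p + q) = (\<Sum>v\<in>?V. Poly_Mapping.lookup (p + q) v * mono_eval x v)"
    by (intro mpoly_eval_superset) auto
  also have "\<dots> = mpoly_eval x p + mpoly_eval x q"
    by (simp add: mpoly_eval_superset[of ?V] lookup_add distrib_right sum.distrib)
  finally show ?thesis .
qed

lemma mpoly_eval_0: "mpoly_eval x 0 = 0"
  by (simp add: mpoly_eval_def)

lemma mpoly_eval_sum: "mpoly_eval x (sum f I) = (\<Sum>i\<in>I. mpoly_eval x (f i))"
  by (induction I rule: infinite_finite_induct) (auto simp: mpoly_eval_0 mpoly_eval_add)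

lemma mpoly_eval_single: "mpoly_eval x (Poly_Mapping.single m c) = c * mono_eval x m"
  by (simp add: mpoly_eval_def)

lemma mpoly_eval_const: "mpoly_eval x (mpoly_const c) = c"
  by (simp add: mpoly_eval_single mono_eval_def)

lemma mpoly_eval_var: "mpoly_eval x (mpoly_var v) = x v"
  by (simp add: mpoly_eval_single mono_eval_def)

lemma poly_mapping_as_sum:
  "p = (\<Sum>m\<in>Poly_Mapping.keys p. Poly_Mapping.single m (Poly_Mapping.lookup p m))"
  by (rule poly_mapping_eqI) (simp add: lookup_sum lookup_single when_def in_keys_iff sum.delta)

lemma mpoly_eval_mult: "mpoly_eval x (p * q) = mpoly_eval x p * mpoly_eval x q"
proof -
  have "p * q = (\<Sum>m\<in>Poly_Mapping.keys p. \<Sum>m'\<in>Poly_Mapping.keys q.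
      Poly_Mapping.single (m + m') (Poly_Mapping.lookup p m * Poly_Mapping.lookup q m'))"
    by (subst poly_mapping_as_sum[of p], subst poly_mapping_as_sum[of q]) (simp add: sum_product mult_single)
  then show ?thesis
    by (simp add: mpoly_eval_sum mpoly_eval_single mono_eval_add mpoly_eval_def[of x p]
        mpoly_eval_def[of x q] sum_product ac_simps)
qed

lemma mpoly_eval_prod: "mpoly_eval x (prod f I) = (\<Prod>i\<in>I. mpoly_eval x (f i))"
  by (induction I rule: infinite_finite_induct)
    (auto simp: mpoly_eval_mult mpoly_eval_const[of x 1, unfolded single_one])

lemma mpoly_eval_peval:
  "mpoly_eval x (peval mpoly_const w e) = peval (\<lambda>c. c) (\<lambda>l. mpoly_eval x (w l)) e"
  by (induction e) (simp_all add: mpoly_eval_const mpoly_eval_add mpoly_eval_mult)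

lemma to_fract_prod: "to_fract (prod f I) = (\<Prod>i\<in>I. to_fract (f i))"
  by (induction I rule: infinite_finite_induct) auto

text \<open>
  A point \<open>\<delta>\<close> of the closure of the image of a polynomial map \<open>w\<close> is the specialisation of
  the generic point of that image along a place of the field of rational functions.
\<close>

lemma place_of_closure_point:
  fixes w :: "'l \<Rightarrow> 'k::alg_closed_field mpoly"
  assumes closure: "\<And>e. (\<And>x. peval (\<lambda>c. c) (\<lambda>l. mpoly_eval x (w l)) e = 0) \<Longrightarrow> peval (\<lambda>c. c) \<delta> e = 0"
  shows "\<exists>R \<psi>. place R \<psi> (\<lambda>c. to_fract (mpoly_const c)) \<and>
    (\<forall>l. to_fract (w l) \<in> R \<and> \<psi> (to_fract (w l)) = \<delta> l)"
proof -
  \<comment> \<open>Graph of the homomorphism sending w l to \<delta> l, on the ring generated by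
    the constants and the w l. It is single-valued because an expression that is zero at
    \<open>w\<close> vanishes at every point of the image, and \<open>closure\<close> carries this
    to \<delta>.\<close>
  define G0 where "G0 = {(to_fract (peval mpoly_const w e), peval (\<lambda>c. c) \<delta> e) | e. True}"
  have G0I: "a = to_fract (peval mpoly_const w e) \<Longrightarrow> b = peval (\<lambda>c. c) \<delta> e \<Longrightarrow> (a, b) \<in> G0" for a b e
    unfolding G0_def by blast
  have "partial_hom G0"
  proof (rule partial_homI)
    show "(1, 1) \<in> G0" by (rule G0I[of _ "PConst 1"]) simp_all
  next
    fix x a y b assume "(x, a) \<in> G0" "(y, b) \<in> G0"
    then obtain e f where e: "x = to_fract (peval mpoly_const w e)" "a = peval (\<lambda>c. c) \<delta> e"
      and f: "y = to_fract (peval mpoly_const w f)" "b = peval (\<lambda>c. c) \<delta> f"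
      unfolding G0_def by blast
    show "(x - y, a - b) \<in> G0"
      by (rule G0I[of _ "PAdd e (PMul (PConst (- 1)) f)"])
        (simp_all add: e f single_uminus)
    show "(x * y, a * b) \<in> G0"
      by (rule G0I[of _ "PMul e f"]) (simp_all add: e f)
  next
    fix a assume "(0, a) \<in> G0"
    then obtain e where e: "0 = to_fract (peval mpoly_const w e)" "a = peval (\<lambda>c. c) \<delta> e"
      unfolding G0_def by blast
    then have "peval mpoly_const w e = 0" by (metis to_fract_eq_0_iff)
    then have "peval (\<lambda>c. c) (\<lambda>l. mpoly_eval x (w l)) e = 0" for x
      by (simp add: mpoly_eval_peval[symmetric] mpoly_eval_0)
    then show "a = 0" using closure e by blast
  qed
  moreover have "(to_fract (mpoly_const c), c) \<in> G0" for c
    by (rule G0I[of _ "PConst c"]) simp_all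
  ultimately obtain R \<psi> where "place R \<psi> (\<lambda>c. to_fract (mpoly_const c))"
    and *: "\<And>x a. (x, a) \<in> G0 \<Longrightarrow> x \<in> R \<and> \<psi> x = a"
    by (rule chevalley_place_extension[of G0 "\<lambda>c. to_fract (mpoly_const c)"]) blast
  moreover have "(to_fract (w l), \<delta> l) \<in> G0" for l
    by (rule G0I[of _ "PVar l"]) simp_all
  ultimately show ?thesis by blast
qed

text \<open>
  The hypothesis says that the \<open>r'\<close>-th unit tensor is in the closure of the restrictions of \<open>T\<close>,
  in terms of polynomial expressions \<open>e\<close> in the entries.
\<close>

lemma restriction_of_degeneration:
  fixes T :: "(nat \<Rightarrow> nat) \<Rightarrow> 'k::alg_closed_field"
  assumes d: "d \<ge> 2" and r: "r \<le> r'"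
    and closure: "\<And>e. (\<And>x. peval (\<lambda>c. c) (\<lambda>L. \<Sum>K\<in>Pi\<^sub>E {1..d} (\<lambda>i. {1..n i}).
          T K * (\<Prod>i=1..d. x i (L i) (K i))) e = 0) \<Longrightarrow>
        peval (\<lambda>c. c) (\<lambda>L. \<Sum>l=1..r'. \<Prod>i=1..d. if L i = l then 1 else 0) e = 0"
  shows "i \<in> {1..d} \<Longrightarrow> r \<le> n i"
    and "s = r div d \<Longrightarrow> \<exists>p u c.
      (\<forall>i\<in>{1..d}. \<forall>j\<in>{1..s}. c i j \<in> {1..n i}) \<and>
      (\<forall>i\<in>{1..d}. \<forall>j\<in>{1..s}. \<forall>l\<in>{1..s}. p i j (c i l) = (if j = l then 1 else 0)) \<and>
      (\<forall>L\<in>Pi\<^sub>E {1..d} (\<lambda>_. {1..s}).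
         (\<Sum>K\<in>Pi\<^sub>E {1..d} (\<lambda>i. {1..n i}). T K * (\<Prod>i=1..d. p i (L i) (K i)))
         = (\<Sum>l=1..r. \<Prod>i=1..d. u i (L i) l))"
proof -
  \<comment> \<open>The generic restriction, with one variable for each entry (i, l, k) of the
    matrices, numbered by \<open>to_nat\<close>.\<close>
  define w where "w L = (\<Sum>K\<in>Pi\<^sub>E {1..d} (\<lambda>i. {1..n i}). mpoly_const (T K) *
      (\<Prod>i=1..d. mpoly_var (to_nat (i, L i, K i))))" for L :: "nat \<Rightarrow> nat"
  define \<delta> :: "(nat \<Rightarrow> nat) \<Rightarrow> 'k" where "\<delta> = (\<lambda>L. \<Sum>l=1..r'. \<Prod>i=1..d. if L i = l then 1 else 0)"
  have w_eval: "mpoly_eval x (w L) = (\<Sum>K\<in>Pi\<^sub>E {1..d} (\<lambda>i. {1..n i}).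
          T K * (\<Prod>i=1..d. x (to_nat (i, L i, K i))))" for x L
    by (simp add: w_def mpoly_eval_sum mpoly_eval_mult mpoly_eval_const mpoly_eval_prod mpoly_eval_var
        del: One_nat_def)
  have closure': "peval (\<lambda>c. c) \<delta> e = 0"
    if "\<And>x. peval (\<lambda>c. c) (\<lambda>l. mpoly_eval x (w l)) e = 0" for e
  proof -
    have "peval (\<lambda>c. c) (\<lambda>L. \<Sum>K\<in>Pi\<^sub>E {1..d} (\<lambda>i. {1..n i}).
          T K * (\<Prod>i=1..d. x i (L i) (K i))) e = 0" for x
      using that[of "\<lambda>v. case from_nat v of (i, l, k) \<Rightarrow> x i l k"] by (simp add: w_eval del: One_nat_def)
    from closure[OF this] show ?thesis by (simp only: \<delta>_def)
  qed
  obtain R and \<psi> :: "'k mpoly fract \<Rightarrow> 'k" where place: "place R \<psi> (\<lambda>c. to_fract (mpoly_const c))"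
    and w: "\<forall>l. to_fract (w l) \<in> R \<and> \<psi> (to_fract (w l)) = \<delta> l"
    using place_of_closure_point[of w \<delta>, OF closure'] by blast
  interpret place R \<psi> "\<lambda>c. to_fract (mpoly_const c)" by (rule place)
  define X :: "nat \<Rightarrow> nat \<Rightarrow> nat \<Rightarrow> 'k mpoly fract" where "X i l k = to_fract (mpoly_var (to_nat (i, l, k)))" for i l k
  have fw: "to_fract (w L) = (\<Sum>K\<in>Pi\<^sub>E {1..d} (\<lambda>i. {1..n i}). to_fract (mpoly_const (T K)) *
      (\<Prod>i=1..d. X i (L i) (K i)))" for L
    by (simp add: w_def X_def to_fract_prod del: One_nat_def)
  \<comment> \<open>For indices up to r the summands with l > r vanish, so the r'-th unit tensor
    truncates to the r-th. This is where the argument passes from r' to r.\<close>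
  have \<delta>: "\<delta> L = (\<Sum>l=1..r. \<Prod>i=1..d. if L i = l then 1 else 0)" if L: "L \<in> Pi\<^sub>E {1..d} (\<lambda>_. {1..r})" for L
    unfolding \<delta>_def
  proof (intro sum.mono_neutral_right ballI)
    fix l assume l: "l \<in> {1..r'} - {1..r}"
    have "1 \<in> {1..d}" "L 1 \<in> {1..r}" using L d by (auto simp del: One_nat_def)
    then show "(\<Prod>i=1..d. if L i = l then 1 else 0 :: 'k) = 0" using l by (intro prod_zero bexI[of _ 1]) auto
  qed (use r in auto)
  have lim: "(\<Sum>K\<in>Pi\<^sub>E {1..d} (\<lambda>i. {1..n i}). to_fract (mpoly_const (T K)) * (\<Prod>i=1..d. X i (L i) (K i))) \<in> R \<and>
      \<psi> (\<Sum>K\<in>Pi\<^sub>E {1..d} (\<lambda>i. {1..n i}). to_fract (mpoly_const (T K)) * (\<Prod>i=1..d. X i (L i) (K i)))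
        = (\<Sum>l=1..r. \<Prod>i=1..d. if L i = l then 1 else 0)" if "L \<in> Pi\<^sub>E {1..d} (\<lambda>_. {1..r})" for L
    using spec[OF w, of L] unfolding fw \<delta>[OF that] .
  show "i \<in> {1..d} \<Longrightarrow> r \<le> n i" by (rule limit_restriction_le[OF d lim])
  show "s = r div d \<Longrightarrow> \<exists>p u c.
      (\<forall>i\<in>{1..d}. \<forall>j\<in>{1..s}. c i j \<in> {1..n i}) \<and>
      (\<forall>i\<in>{1..d}. \<forall>j\<in>{1..s}. \<forall>l\<in>{1..s}. p i j (c i l) = (if j = l then 1 else 0)) \<and>
      (\<forall>L\<in>Pi\<^sub>E {1..d} (\<lambda>_. {1..s}).
         (\<Sum>K\<in>Pi\<^sub>E {1..d} (\<lambda>i. {1..n i}). T K * (\<Prod>i=1..d. p i (L i) (K i)))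
         = (\<Sum>l=1..r. \<Prod>i=1..d. u i (L i) l))"
    by (rule limit_restriction_ex[OF d lim])
qed

subsection \<open>Dimension and algebraic independence\<close>

definition monomial_fun :: "'x set \<Rightarrow> ('x \<Rightarrow> nat) \<Rightarrow> ('x \<Rightarrow> 'k::field) \<Rightarrow> 'k" where
  "monomial_fun M \<beta> y = (\<Prod>i\<in>M. y i ^ \<beta> i)"

text \<open>The bound is on each exponent separately and not on the total degree, so the monomials
  form a box of size (e + 1) ^ card M, the number compared in the dimension count.\<close>

definition degree_le :: "'x set \<Rightarrow> nat \<Rightarrow> (('x \<Rightarrow> 'k::field) \<Rightarrow> 'k) set" where
  "degree_le M e = {g. \<exists>b. \<forall>y. g y = (\<Sum>\<beta>\<in>Pi\<^sub>E M (\<lambda>_. {0..e}). b \<beta> * monomial_fun M \<beta> y)}"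

inductive_set polynomial_maps :: "'x set \<Rightarrow> (('x \<Rightarrow> 'k::field) \<Rightarrow> 'k) set" for M where
  const: "(\<lambda>_. c) \<in> polynomial_maps M"
| var: "i \<in> M \<Longrightarrow> (\<lambda>y. y i) \<in> polynomial_maps M"
| add: "\<lbrakk>f \<in> polynomial_maps M; g \<in> polynomial_maps M\<rbrakk> \<Longrightarrow> (\<lambda>y. f y + g y) \<in> polynomial_maps M"
| mult: "\<lbrakk>f \<in> polynomial_maps M; g \<in> polynomial_maps M\<rbrakk> \<Longrightarrow> (\<lambda>y. f y * g y) \<in> polynomial_maps M"

lemma polynomial_maps_sum:
  "(\<And>i. i \<in> I \<Longrightarrow> f i \<in> polynomial_maps M) \<Longrightarrow> (\<lambda>y. \<Sum>i\<in>I. f i y) \<in> polynomial_maps M"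
  by (induction I rule: infinite_finite_induct)
    (auto intro: polynomial_maps.const[of 0] polynomial_maps.add)

lemma polynomial_maps_prod:
  "(\<And>i. i \<in> I \<Longrightarrow> f i \<in> polynomial_maps M) \<Longrightarrow> (\<lambda>y. \<Prod>i\<in>I. f i y) \<in> polynomial_maps M"
  by (induction I rule: infinite_finite_induct)
    (auto intro: polynomial_maps.const[of 1] polynomial_maps.mult)

lemma polynomial_maps_diff:
  assumes "f \<in> polynomial_maps M" "g \<in> polynomial_maps M"
  shows "(\<lambda>y. f y - g y) \<in> polynomial_maps M"
  using polynomial_maps.add[OF assms(1) polynomial_maps.mult[OF polynomial_maps.const[of "-1"] assms(2)]]
  by simp

lemma polynomial_functions_sum:
  "(\<And>i. i \<in> I \<Longrightarrow> f i \<in> polynomial_functions scl W) \<Longrightarrow> (\<lambda>x. \<Sum>i\<in>I. f i x) \<in> polynomial_functions scl W"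
  by (induction I rule: infinite_finite_induct)
    (auto intro: polynomial_functions.const[of 0] polynomial_functions.add)

lemma polynomial_functions_prod:
  "(\<And>i. i \<in> I \<Longrightarrow> f i \<in> polynomial_functions scl W) \<Longrightarrow> (\<lambda>x. \<Prod>i\<in>I. f i x) \<in> polynomial_functions scl W"
  by (induction I rule: infinite_finite_induct)
    (auto intro: polynomial_functions.const[of 1] polynomial_functions.mult)

lemma polynomial_functions_power:
  "f \<in> polynomial_functions scl W \<Longrightarrow> (\<lambda>x. f x ^ n) \<in> polynomial_functions scl W"
  by (induction n) (auto intro: polynomial_functions.const[of 1] polynomial_functions.mult)

lemma degree_leI:
  "(\<And>y. g y = (\<Sum>\<beta>\<in>Pi\<^sub>E M (\<lambda>_. {0..e}). b \<beta> * monomial_fun M \<beta> y)) \<Longrightarrow> g \<in> degree_le M e"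
  unfolding degree_le_def by blast

lemma degree_le_zero: "(\<lambda>_. 0) \<in> degree_le M e"
  by (rule degree_leI[where b = "\<lambda>_. 0"]) simp

lemma degree_le_add:
  assumes "f \<in> degree_le M e" "g \<in> degree_le M e"
  shows "(\<lambda>y. f y + g y) \<in> degree_le M e"
proof -
  obtain b b' where "\<And>y. f y = (\<Sum>\<beta>\<in>Pi\<^sub>E M (\<lambda>_. {0..e}). b \<beta> * monomial_fun M \<beta> y)"
    "\<And>y. g y = (\<Sum>\<beta>\<in>Pi\<^sub>E M (\<lambda>_. {0..e}). b' \<beta> * monomial_fun M \<beta> y)"
    using assms unfolding degree_le_def by blast
  then show ?thesis
    by (intro degree_leI[where b = "\<lambda>\<beta>. b \<beta> + b' \<beta>"]) (simp add: sum.distrib algebra_simps)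
qed

lemma degree_le_scale:
  assumes "f \<in> degree_le M e"
  shows "(\<lambda>y. c * f y) \<in> degree_le M e"
proof -
  obtain b where "\<And>y. f y = (\<Sum>\<beta>\<in>Pi\<^sub>E M (\<lambda>_. {0..e}). b \<beta> * monomial_fun M \<beta> y)"
    using assms unfolding degree_le_def by blast
  then show ?thesis
    by (intro degree_leI[where b = "\<lambda>\<beta>. c * b \<beta>"]) (simp add: sum_distrib_left algebra_simps)
qed

lemma degree_le_sum:
  "(\<And>i. i \<in> I \<Longrightarrow> f i \<in> degree_le M e) \<Longrightarrow> (\<lambda>y. \<Sum>i\<in>I. f i y) \<in> degree_le M e"
  by (induction I rule: infinite_finite_induct) (auto intro: degree_le_zero degree_le_add)

lemma monomial_degree_le:
  assumes M: "finite M" and \<beta>: "\<And>i. i \<in> M \<Longrightarrow> \<beta> i \<le> e"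
  shows "monomial_fun M \<beta> \<in> degree_le M e"
proof (rule degree_leI[where b = "\<lambda>\<alpha>. if \<alpha> = restrict \<beta> M then 1 else 0"])
  fix y
  have "restrict \<beta> M \<in> Pi\<^sub>E M (\<lambda>_. {0..e})" using \<beta> by auto
  moreover have "finite (Pi\<^sub>E M (\<lambda>_. {0..e}))" using M by (simp add: finite_PiE)
  ultimately have "(\<Sum>\<alpha>\<in>Pi\<^sub>E M (\<lambda>_. {0..e}). (if \<alpha> = restrict \<beta> M then 1 else 0) * monomial_fun M \<alpha> y)
      = monomial_fun M (restrict \<beta> M) y"
    by (simp add: if_distrib[of "\<lambda>x. x * _"] sum.delta cong: if_cong)
  then show "monomial_fun M \<beta> y = (\<Sum>\<alpha>\<in>Pi\<^sub>E M (\<lambda>_. {0..e}). (if \<alpha> = restrict \<beta> M then 1 else 0) * monomial_fun M \<alpha> y)"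
    by (simp add: monomial_fun_def)
qed

lemma degree_le_mult:
  assumes M: "finite M" and f: "f \<in> degree_le M e" and g: "g \<in> degree_le M e'"
  shows "(\<lambda>y. f y * g y) \<in> degree_le M (e + e')"
proof -
  obtain b where b: "\<And>y. f y = (\<Sum>\<beta>\<in>Pi\<^sub>E M (\<lambda>_. {0..e}). b \<beta> * monomial_fun M \<beta> y)"
    using f unfolding degree_le_def by blast
  obtain b' where b': "\<And>y. g y = (\<Sum>\<beta>\<in>Pi\<^sub>E M (\<lambda>_. {0..e'}). b' \<beta> * monomial_fun M \<beta> y)"
    using g unfolding degree_le_def by blast
  have "f y * g y = (\<Sum>\<beta>\<in>Pi\<^sub>E M (\<lambda>_. {0..e}). \<Sum>\<beta>'\<in>Pi\<^sub>E M (\<lambda>_. {0..e'}).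
      (b \<beta> * b' \<beta>') * monomial_fun M (\<lambda>i. \<beta> i + \<beta>' i) y)" for y
    unfolding b b' sum_product
    by (intro sum.cong refl) (simp add: monomial_fun_def power_add prod.distrib)
  moreover have "(\<lambda>y. \<Sum>\<beta>\<in>Pi\<^sub>E M (\<lambda>_. {0..e}). \<Sum>\<beta>'\<in>Pi\<^sub>E M (\<lambda>_. {0..e'}).
      (b \<beta> * b' \<beta>') * monomial_fun M (\<lambda>i. \<beta> i + \<beta>' i) y) \<in> degree_le M (e + e')"
    by (intro degree_le_sum degree_le_scale monomial_degree_le[OF M] add_mono)
      (drule (1) PiE_mem, simp)+
  ultimately show ?thesis by simp
qed

lemma degree_le_mono:
  assumes M: "finite M" and "e \<le> e'" "f \<in> degree_le M e"
  shows "f \<in> degree_le M e'"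
proof -
  obtain b where b: "\<And>y. f y = (\<Sum>\<beta>\<in>Pi\<^sub>E M (\<lambda>_. {0..e}). b \<beta> * monomial_fun M \<beta> y)"
    using assms(3) unfolding degree_le_def by blast
  have "(\<lambda>y. \<Sum>\<beta>\<in>Pi\<^sub>E M (\<lambda>_. {0..e}). b \<beta> * monomial_fun M \<beta> y) \<in> degree_le M e'"
    using assms(2) by (intro degree_le_sum degree_le_scale monomial_degree_le[OF M]) (drule (1) PiE_mem, simp)
  then show ?thesis by (simp add: b[symmetric])
qed

lemma degree_le_const:
  assumes M: "finite M"
  shows "(\<lambda>_. c) \<in> degree_le M e"
proof -
  have "(\<lambda>y. c * monomial_fun M (\<lambda>_. 0) y) \<in> degree_le M e"
    by (intro degree_le_scale monomial_degree_le[OF M]) simp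
  then show ?thesis by (simp add: monomial_fun_def)
qed

lemma degree_le_power:
  assumes M: "finite M" and f: "f \<in> degree_le M e"
  shows "(\<lambda>y. f y ^ n) \<in> degree_le M (e * n)"
proof (induction n)
  case 0
  show ?case using degree_le_const[OF M, of 1] by simp
next
  case (Suc n)
  show ?case using degree_le_mult[OF M f Suc] by simp
qed

lemma degree_le_prod:
  assumes M: "finite M"
  shows "finite I \<Longrightarrow> (\<And>i. i \<in> I \<Longrightarrow> f i \<in> degree_le M (e i)) \<Longrightarrow> (\<lambda>y. \<Prod>i\<in>I. f i y) \<in> degree_le M (\<Sum>i\<in>I. e i)"
  by (induction I rule: finite_induct) (auto intro: degree_le_const[OF M] degree_le_mult[OF M])

lemma polynomial_maps_degree_le:
  fixes g :: "('x \<Rightarrow> 'k::field) \<Rightarrow> 'k"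
  assumes M: "finite M" and "g \<in> polynomial_maps M"
  shows "\<exists>e. g \<in> degree_le M e"
  using assms(2)
proof induction
  case (const c)
  then show ?case using degree_le_const[OF M] by blast
next
  case (var i)
  have deg: "(monomial_fun M (\<lambda>j. if j = i then 1 else 0) :: ('x \<Rightarrow> 'k) \<Rightarrow> 'k) \<in> degree_le M 1"
    by (rule monomial_degree_le[OF M]) simp
  have "monomial_fun M (\<lambda>j. if j = i then 1 else 0) y = y i" for y :: "'x \<Rightarrow> 'k"
  proof -
    have "monomial_fun M (\<lambda>j. if j = i then 1 else 0) y = (\<Prod>j\<in>M. if j = i then y j else 1)"
      unfolding monomial_fun_def by (intro prod.cong) auto
    then show ?thesis using M var by (simp add: prod.delta)
  qed
  then have "monomial_fun M (\<lambda>j. if j = i then 1 else 0) = (\<lambda>y :: 'x \<Rightarrow> 'k. y i)" by (rule ext)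
  with deg have "(\<lambda>y :: 'x \<Rightarrow> 'k. y i) \<in> degree_le M 1" by (simp only:)
  then show ?case by blast
next
  case (add f g)
  then obtain e e' where "f \<in> degree_le M e" "g \<in> degree_le M e'" by blast
  then have "f \<in> degree_le M (max e e')" "g \<in> degree_le M (max e e')"
    using degree_le_mono[OF M] by (meson max.cobounded1 max.cobounded2)+
  then show ?case using degree_le_add by blast
next
  case (mult f g)
  then show ?case using degree_le_mult[OF M] by blast
qed

lemma polynomial_functions_pullback:
  assumes "\<And>l. l \<in> Hom_space scl W (*) UNIV \<Longrightarrow> (\<lambda>y. l (F y)) \<in> polynomial_maps M"
    and "f \<in> polynomial_functions scl W"
  shows "(\<lambda>y. f (F y)) \<in> polynomial_maps M"
  using assms(2)
  by induction (auto intro: assms(1) polynomial_maps.const polynomial_maps.add polynomial_maps.mult)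

text \<open>
  The lowest coefficient of a relation, viewed as a polynomial in the last function, is a relation
  on the previous set of the chain.
\<close>

lemma chain_algebraically_independent:
  fixes f :: "nat \<Rightarrow> 'w::ab_group_add \<Rightarrow> 'k::field"
  assumes Z0: "Z 0 \<noteq> {}"
    and mono: "\<And>j. j < k \<Longrightarrow> Z j \<subseteq> Z (Suc j)"
    and irr: "\<And>j g h. j \<le> k \<Longrightarrow> g \<in> polynomial_functions scl W \<Longrightarrow> h \<in> polynomial_functions scl W \<Longrightarrow>
       (\<And>x. x \<in> Z j \<Longrightarrow> g x * h x = 0) \<Longrightarrow> (\<forall>x\<in>Z j. g x = 0) \<or> (\<forall>x\<in>Z j. h x = 0)"
    and f: "\<And>j. j < k \<Longrightarrow> f (Suc j) \<in> polynomial_functions scl W"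
    and f0: "\<And>j x. j < k \<Longrightarrow> x \<in> Z j \<Longrightarrow> f (Suc j) x = 0"
    and f1: "\<And>j. j < k \<Longrightarrow> \<exists>x\<in>Z (Suc j). f (Suc j) x \<noteq> 0"
    and "j \<le> k"
    and rel: "\<And>x. x \<in> Z j \<Longrightarrow> (\<Sum>\<alpha>\<in>Pi\<^sub>E {1..j} (\<lambda>_. {0..D}). c \<alpha> * (\<Prod>i=1..j. f i x ^ \<alpha> i)) = 0"
    and \<alpha>: "\<alpha> \<in> Pi\<^sub>E {1..j} (\<lambda>_. {0..D})"
  shows "c \<alpha> = 0"
  using \<open>j \<le> k\<close> rel \<alpha>
proof (induction j arbitrary: c \<alpha>)
  case 0
  then show ?case using Z0 by auto
next
  case (Suc j)
  let ?P = "Pi\<^sub>E {1..j} (\<lambda>_. {0..D})"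
  have j: "j < k" using Suc.prems by simp
  have ins: "{1..Suc j} = insert (Suc j) {1..j}" by auto
  \<comment> \<open>The coefficient of the e-th power of the last function, itself an expression in
    the first j functions.\<close>
  define G where "G e x = (\<Sum>\<beta>\<in>?P. c (\<beta>(Suc j := e)) * (\<Prod>i=1..j. f i x ^ \<beta> i))" for e x
  have fPF: "f i \<in> polynomial_functions scl W" if "i \<in> {1..Suc j}" for i
    using f[of "i - 1"] that j by auto
  have GPF: "G e \<in> polynomial_functions scl W" for e
    unfolding G_def[abs_def]
    by (intro polynomial_functions_sum polynomial_functions.mult polynomial_functions.const
        polynomial_functions_prod polynomial_functions_power fPF) auto
  have expand: "(\<Sum>\<alpha>\<in>Pi\<^sub>E {1..Suc j} (\<lambda>_. {0..D}). c \<alpha> * (\<Prod>i=1..Suc j. f i x ^ \<alpha> i))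
      = (\<Sum>e\<in>{0..D}. G e x * f (Suc j) x ^ e)" for x
  proof -
    have inj: "inj_on (\<lambda>(e, \<beta>). \<beta>(Suc j := e)) ({0..D} \<times> ?P)"
      by (rule inj_combinator) auto
    have "(\<Sum>\<alpha>\<in>Pi\<^sub>E {1..Suc j} (\<lambda>_. {0..D}). c \<alpha> * (\<Prod>i=1..Suc j. f i x ^ \<alpha> i))
        = (\<Sum>(e, \<beta>)\<in>{0..D} \<times> ?P. c (\<beta>(Suc j := e)) * (\<Prod>i=1..Suc j. f i x ^ (\<beta>(Suc j := e)) i))"
      unfolding ins PiE_insert_eq by (subst sum.reindex[OF inj]) (simp add: case_prod_unfold)
    also have "\<dots> = (\<Sum>(e, \<beta>)\<in>{0..D} \<times> ?P. c (\<beta>(Suc j := e)) * (\<Prod>i=1..j. f i x ^ \<beta> i) * f (Suc j) x ^ e)"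
      by (intro sum.cong refl) (auto simp: case_prod_unfold intro!: prod.cong)
    also have "\<dots> = (\<Sum>e\<in>{0..D}. G e x * f (Suc j) x ^ e)"
      by (simp add: G_def sum.cartesian_product[symmetric] sum_distrib_right)
    finally show ?thesis .
  qed
  have zero: "\<forall>\<beta>\<in>?P. c (\<beta>(Suc j := e)) = 0" if "e \<le> D" for e
    using that
  proof (induction e rule: less_induct)
    case (less e)
    \<comment> \<open>The relation with its vanishing lower coefficients dropped and f (Suc j) ^ e
      divided out. Irreducibility of Z (Suc j), where f (Suc j) is not identically zero, makes
      \<open>H\<close> vanish there; on Z j only the term G e of \<open>H\<close> is left.\<close>
    define H where "H x = (\<Sum>e'\<in>{e..D}. G e' x * f (Suc j) x ^ (e' - e))" for x
    have HPF: "H \<in> polynomial_functions scl W"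
      unfolding H_def[abs_def]
      by (intro polynomial_functions_sum polynomial_functions.mult GPF polynomial_functions_power fPF) auto
    have lower: "G e' x = 0" if "e' < e" for e' x
      proof -
      have "c (\<beta>(Suc j := e')) = 0" if "\<beta> \<in> ?P" for \<beta>
      proof -
        have "e' \<le> D" using less.prems \<open>e' < e\<close> by simp
        from less.IH[OF \<open>e' < e\<close> this] that show ?thesis by blast
      qed
      then show ?thesis unfolding G_def by (intro sum.neutral ballI) (simp only: mult_zero_left)
    qed
    have "f (Suc j) x ^ e * H x = 0" if "x \<in> Z (Suc j)" for x
    proof -
      have "f (Suc j) x ^ e * H x = (\<Sum>e'\<in>{e..D}. G e' x * f (Suc j) x ^ e')"
        unfolding H_def sum_distrib_left
        by (intro sum.cong refl) (simp add: power_add[symmetric] algebra_simps)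
      also have "\<dots> = (\<Sum>e'\<in>{0..D}. G e' x * f (Suc j) x ^ e')"
        using lower by (intro sum.mono_neutral_left) auto
      also have "\<dots> = 0" using expand[of x] Suc.prems(2)[OF that] by simp
      finally show ?thesis .
    qed
    from irr[OF Suc.prems(1) polynomial_functions_power[OF fPF] HPF this]
    have "\<forall>x\<in>Z (Suc j). H x = 0"
      using f1[OF j] by auto
    then have G0: "G e x = 0" if x: "x \<in> Z j" for x
    proof -
      have "H x = (\<Sum>e'\<in>{e..D}. if e' = e then G e x else 0)"
        unfolding H_def using f0[OF j x] by (intro sum.cong) auto
      also have "\<dots> = G e x" using less.prems by (simp add: sum.delta)
      finally show ?thesis using \<open>\<forall>x\<in>Z (Suc j). H x = 0\<close> mono[OF j] x by auto
    qed
    show ?case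
    proof
      fix \<beta> assume \<beta>: "\<beta> \<in> ?P"
      have "(\<Sum>\<beta>\<in>?P. c (\<beta>(Suc j := e)) * (\<Prod>i=1..j. f i x ^ \<beta> i)) = 0" if "x \<in> Z j" for x
        using G0[OF that] by (simp only: G_def)
      from Suc.IH[of "\<lambda>\<beta>. c (\<beta>(Suc j := e))", OF less_imp_le[OF j] this \<beta>]
      show "c (\<beta>(Suc j := e)) = 0" .
    qed
  qed
  obtain e \<beta> where "\<alpha> = \<beta>(Suc j := e)" "e \<in> {0..D}" "\<beta> \<in> ?P"
    using Suc.prems(3) unfolding ins PiE_insert_eq by auto
  then show ?case using zero by (metis atLeastAtMost_iff)
qed

text \<open>A chain of length k gives k functions without algebraic relation on its top set. If k >
  m, their monomials outnumber the coefficients of all pullbacks to the finitely many parameter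
  spaces, so a nontrivial relation holds on \<open>S\<close> and hence on its closure, a
  contradiction.\<close>

theorem constructible_dim_le:
  fixes scl :: "'k::field \<Rightarrow> 'w::ab_group_add \<Rightarrow> 'w" and F :: "'s \<Rightarrow> ('x \<Rightarrow> 'k) \<Rightarrow> 'w"
  assumes \<Sigma>: "finite \<Sigma>" and M: "\<And>\<sigma>. \<sigma> \<in> \<Sigma> \<Longrightarrow> finite (M \<sigma>)" "\<And>\<sigma>. \<sigma> \<in> \<Sigma> \<Longrightarrow> card (M \<sigma>) \<le> m"
    and S: "S \<subseteq> W" "\<And>x. x \<in> S \<Longrightarrow> \<exists>\<sigma>\<in>\<Sigma>. \<exists>y. x = F \<sigma> y"
    and F: "\<And>\<sigma> l. \<sigma> \<in> \<Sigma> \<Longrightarrow> l \<in> Hom_space scl W (*) UNIV \<Longrightarrow> (\<lambda>y. l (F \<sigma> y)) \<in> polynomial_maps (M \<sigma>)"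
  shows "constructible_dim (zariski_topology scl W) S \<le> ereal (real m)"
  unfolding constructible_dim_def krull_dim_def
proof (rule Sup_least)
  let ?X = "zariski_topology scl W"
  let ?C = "?X closure_of S"
  fix v assume "v \<in> {ereal (real m) | m. \<exists>Z :: nat \<Rightarrow> 'w set.
    (\<forall>j\<le>m. irreducible_closedin (subtopology ?X ?C) (Z j)) \<and> (\<forall>j<m. Z j \<subset> Z (Suc j))}"
  then obtain k Z where v: "v = ereal (real k)"
    and irr: "\<And>j. j \<le> k \<Longrightarrow> irreducible_closedin (subtopology ?X ?C) (Z j)"
    and chain: "\<And>j. j < k \<Longrightarrow> Z j \<subset> Z (Suc j)" by blast
  have sub_closed: "closedin (subtopology ?X ?C) A \<longleftrightarrow> closedin ?X A \<and> A \<subseteq> ?C" for A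
    by (rule closedin_closed_subtopology) (rule closedin_closure_of)
  have ZX: "closedin ?X (Z j)" "Z j \<subseteq> ?C" "Z j \<noteq> {}" if "j \<le> k" for j
    using irr[OF that] sub_closed by (auto simp: irreducible_closedin_def)
  have ZW: "Z j \<subseteq> W" if "j \<le> k" for j
    using closedin_subset[OF ZX(1)[OF that]] by simp
  have zero_closed: "closedin ?X {x \<in> W. g x = 0}" if "g \<in> polynomial_functions scl W" for g
    unfolding closedin_zariski_topology zariski_closed_def using that by (intro exI[of _ "{g}"]) auto
  have irr_prod: "(\<forall>x\<in>Z j. g x = 0) \<or> (\<forall>x\<in>Z j. h x = 0)"
    if j: "j \<le> k" and g: "g \<in> polynomial_functions scl W" and h: "h \<in> polynomial_functions scl W"
      and gh: "\<And>x. x \<in> Z j \<Longrightarrow> g x * h x = 0" for j g h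
  proof -
    define A where "A = Z j \<inter> {x \<in> W. g x = 0}"
    define B where "B = Z j \<inter> {x \<in> W. h x = 0}"
    have "closedin ?X A" "closedin ?X B"
      unfolding A_def B_def by (intro closedin_Int ZX j zero_closed g h)+
    then have "closedin (subtopology ?X ?C) A" "closedin (subtopology ?X ?C) B"
      using ZX[OF j] by (auto simp: sub_closed A_def B_def)
    moreover have "Z j = A \<union> B" using gh ZW[OF j] by (auto simp: A_def B_def)
    ultimately have "Z j = A \<or> Z j = B" using irr[OF j] unfolding irreducible_closedin_def by blast
    then show ?thesis by (auto simp: A_def B_def)
  qed
  \<comment> \<open>Z j is closed and misses a point of Z (Suc j), so one of its equations is not
    satisfied on Z (Suc j).\<close>
  have "\<forall>j. \<exists>g. j < k \<longrightarrow> g \<in> polynomial_functions scl W \<and> (\<forall>x\<in>Z j. g x = 0) \<and> (\<exists>x\<in>Z (Suc j). g x \<noteq> 0)"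
  proof (intro allI)
    fix j
    show "\<exists>g. j < k \<longrightarrow> g \<in> polynomial_functions scl W \<and> (\<forall>x\<in>Z j. g x = 0) \<and> (\<exists>x\<in>Z (Suc j). g x \<noteq> 0)"
    proof (cases "j < k")
      case True
      then obtain Fs where Fs: "Fs \<subseteq> polynomial_functions scl W" "Z j = {x \<in> W. \<forall>g\<in>Fs. g x = 0}"
        using ZX(1)[of j] by (auto simp: closedin_zariski_topology zariski_closed_def)
      obtain x where x: "x \<in> Z (Suc j)" "x \<notin> Z j" using chain[OF True] by blast
      then have "x \<in> W" using ZW[of "Suc j"] True by auto
      then obtain g where "g \<in> Fs" "g x \<noteq> 0" using x Fs by blast
      then show ?thesis using Fs x by blast
    qed auto
  qed
  from choice[OF this] obtain f' where f': "\<And>j. j < k \<Longrightarrow> f' j \<in> polynomial_functions scl W"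
    "\<And>j x. j < k \<Longrightarrow> x \<in> Z j \<Longrightarrow> f' j x = 0" "\<And>j. j < k \<Longrightarrow> \<exists>x\<in>Z (Suc j). f' j x \<noteq> 0" by blast
  define f where "f i = f' (i - 1)" for i
  have fPF: "f i \<in> polynomial_functions scl W" if "i \<in> {1..k}" for i
    using that f'(1)[of "i - 1"] by (auto simp: f_def)
  have "k \<le> m"
  proof (rule ccontr)
    assume "\<not> k \<le> m"
    then have mk: "m < k" by simp
    have "\<forall>p\<in>{1..k} \<times> \<Sigma>. \<exists>e. (\<lambda>y. f (fst p) (F (snd p) y)) \<in> degree_le (M (snd p)) e"
    proof
      fix p assume "p \<in> {1..k} \<times> \<Sigma>"
      then have p: "fst p \<in> {1..k}" "snd p \<in> \<Sigma>" by auto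
      show "\<exists>e. (\<lambda>y. f (fst p) (F (snd p) y)) \<in> degree_le (M (snd p)) e"
        by (rule polynomial_maps_degree_le[OF M(1)[OF p(2)]
              polynomial_functions_pullback[of scl W "F (snd p)", OF F[OF p(2)] fPF[OF p(1)]]])
    qed
    from bchoice[OF this] obtain e0 where
      e0: "\<And>i \<sigma>. i \<in> {1..k} \<Longrightarrow> \<sigma> \<in> \<Sigma> \<Longrightarrow> (\<lambda>y. f i (F \<sigma> y)) \<in> degree_le (M \<sigma>) (e0 (i, \<sigma>))" by force
    define e where "e = Max (insert 0 (e0 ` ({1..k} \<times> \<Sigma>)))"
    have e: "(\<lambda>y. f i (F \<sigma> y)) \<in> degree_le (M \<sigma>) e" if "i \<in> {1..k}" "\<sigma> \<in> \<Sigma>" for i \<sigma>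
    proof (rule degree_le_mono[OF M(1)[OF that(2)] _ e0[OF that]])
      show "e0 (i, \<sigma>) \<le> e" unfolding e_def using that \<Sigma> by (intro Max_ge) auto
    qed
    \<comment> \<open>Monomials in the k functions with exponents up to D pull back to exponents at
      most E = e k D, and E + 1 <= A (D + 1). With D = card \<Sigma> * A ^ m the number of
      conditions is at most D (D + 1) ^ m, below the number (D + 1) ^ k of unknowns since k >
      m.\<close>
    define A where "A = e * k + 1"
    define D where "D = card \<Sigma> * A ^ m"
    define E where "E = e * k * D"
    let ?J = "Pi\<^sub>E {1..k} (\<lambda>_. {0..D})"
    let ?P = "Sigma \<Sigma> (\<lambda>\<sigma>. Pi\<^sub>E (M \<sigma>) (\<lambda>_. {0..E}))"
    have finP: "finite ?P" using \<Sigma> M(1) by (intro finite_SigmaI finite_PiE) auto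
    have finJ: "finite ?J" by (intro finite_PiE) auto
    have "card ?P = (\<Sum>\<sigma>\<in>\<Sigma>. (E + 1) ^ card (M \<sigma>))"
      using \<Sigma> M(1) by (subst card_SigmaI) (auto simp: card_PiE finite_PiE)
    also have "\<dots> \<le> (\<Sum>\<sigma>\<in>\<Sigma>. (E + 1) ^ m)"
      using M(2) by (intro sum_mono power_increasing) auto
    also have "\<dots> = card \<Sigma> * (E + 1) ^ m" by simp
    also have "\<dots> \<le> card \<Sigma> * (A * (D + 1)) ^ m"
      by (intro mult_left_mono power_mono) (auto simp: E_def A_def algebra_simps)
    also have "\<dots> = D * (D + 1) ^ m" by (simp only: D_def power_mult_distrib mult.assoc)
    also have "\<dots> < (D + 1) ^ Suc m" by simp
    also have "\<dots> \<le> (D + 1) ^ k" using mk by (intro power_increasing) auto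
    also have "\<dots> = card ?J" by (simp add: card_PiE)
    finally have card: "card ?P < card ?J" .
    have "(\<lambda>y. \<Prod>i=1..k. f i (F \<sigma> y) ^ \<alpha> i) \<in> degree_le (M \<sigma>) E"
      if \<sigma>: "\<sigma> \<in> \<Sigma>" and \<alpha>: "\<alpha> \<in> ?J" for \<sigma> \<alpha>
    proof (rule degree_le_mono[OF M(1)[OF \<sigma>]])
      show "(\<lambda>y. \<Prod>i=1..k. f i (F \<sigma> y) ^ \<alpha> i) \<in> degree_le (M \<sigma>) (\<Sum>i=1..k. e * \<alpha> i)"
        by (intro degree_le_prod degree_le_power M(1) \<sigma> e) auto
      have "(\<Sum>i=1..k. e * \<alpha> i) \<le> (\<Sum>i=1..k. e * D)"
        using \<alpha> by (intro sum_mono mult_left_mono) (auto simp: PiE_iff)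
      then show "(\<Sum>i=1..k. e * \<alpha> i) \<le> E" by (simp add: E_def ac_simps)
    qed
    then have "\<exists>b. \<forall>y. (\<Prod>i=1..k. f i (F \<sigma> y) ^ \<alpha> i) =
        (\<Sum>\<beta>\<in>Pi\<^sub>E (M \<sigma>) (\<lambda>_. {0..E}). b \<beta> * monomial_fun (M \<sigma>) \<beta> y)"
      if "\<sigma> \<in> \<Sigma>" "\<alpha> \<in> ?J" for \<sigma> \<alpha>
      using that unfolding degree_le_def by blast
    then have "\<forall>\<sigma>. \<forall>\<alpha>. \<exists>b. \<sigma> \<in> \<Sigma> \<longrightarrow> \<alpha> \<in> ?J \<longrightarrow> (\<forall>y. (\<Prod>i=1..k. f i (F \<sigma> y) ^ \<alpha> i) =
        (\<Sum>\<beta>\<in>Pi\<^sub>E (M \<sigma>) (\<lambda>_. {0..E}). b \<beta> * monomial_fun (M \<sigma>) \<beta> y))"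
      (is "\<forall>\<sigma>. \<forall>\<alpha>. \<exists>b. ?Q \<sigma> \<alpha> b") by blast
    then have "\<forall>\<sigma>. \<exists>b. \<forall>\<alpha>. ?Q \<sigma> \<alpha> (b \<alpha>)" by (intro allI choice) blast
    from choice[OF this] obtain b where "\<forall>\<sigma>. \<forall>\<alpha>. ?Q \<sigma> \<alpha> (b \<sigma> \<alpha>)" ..
    then have b: "\<And>\<sigma> \<alpha> y. \<sigma> \<in> \<Sigma> \<Longrightarrow> \<alpha> \<in> ?J \<Longrightarrow> (\<Prod>i=1..k. f i (F \<sigma> y) ^ \<alpha> i) =
        (\<Sum>\<beta>\<in>Pi\<^sub>E (M \<sigma>) (\<lambda>_. {0..E}). b \<sigma> \<alpha> \<beta> * monomial_fun (M \<sigma>) \<beta> y)" by blast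
    obtain c where c0: "\<exists>\<alpha>\<in>?J. c \<alpha> \<noteq> 0"
      and c: "\<forall>p\<in>?P. (\<Sum>\<alpha>\<in>?J. c \<alpha> * b (fst p) \<alpha> (snd p)) = 0"
      using nontrivial_solution[OF finP finJ card, of "\<lambda>\<alpha> p. b (fst p) \<alpha> (snd p)"] by blast
    define g where "g x = (\<Sum>\<alpha>\<in>?J. c \<alpha> * (\<Prod>i=1..k. f i x ^ \<alpha> i))" for x
    have gPF: "g \<in> polynomial_functions scl W"
      unfolding g_def[abs_def]
      by (intro polynomial_functions_sum polynomial_functions.mult polynomial_functions.const
          polynomial_functions_prod polynomial_functions_power fPF)
    have "g x = 0" if xS: "x \<in> S" for x
    proof -
      obtain \<sigma> y where \<sigma>: "\<sigma> \<in> \<Sigma>" and x: "x = F \<sigma> y" using S(2)[OF xS] by blast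
      have "g x = (\<Sum>\<alpha>\<in>?J. \<Sum>\<beta>\<in>Pi\<^sub>E (M \<sigma>) (\<lambda>_. {0..E}). c \<alpha> * b \<sigma> \<alpha> \<beta> * monomial_fun (M \<sigma>) \<beta> y)"
        unfolding g_def x by (intro sum.cong refl) (simp only: b[OF \<sigma>] sum_distrib_left mult.assoc)
      also have "\<dots> = (\<Sum>\<beta>\<in>Pi\<^sub>E (M \<sigma>) (\<lambda>_. {0..E}). (\<Sum>\<alpha>\<in>?J. c \<alpha> * b \<sigma> \<alpha> \<beta>) * monomial_fun (M \<sigma>) \<beta> y)"
        by (subst sum.swap) (simp add: sum_distrib_right)
      also have "\<dots> = 0"
        using c \<sigma> by (intro sum.neutral) auto
      finally show ?thesis .
    qed
    then have "S \<subseteq> {x \<in> W. g x = 0}" using S(1) by blast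
    then have "?C \<subseteq> {x \<in> W. g x = 0}" by (rule closure_of_minimal[OF _ zero_closed[OF gPF]])
    then have gZ: "g x = 0" if "x \<in> Z k" for x using that ZX(2)[of k] by blast
    have "c \<alpha> = 0" if "\<alpha> \<in> ?J" for \<alpha>
    proof (rule chain_algebraically_independent[where Z = Z and k = k and j = k and f = f and D = D
          and scl = scl and W = W and c = c and \<alpha> = \<alpha>])
      show "Z 0 \<noteq> {}" using ZX(3)[of 0] by simp
      show "Z j \<subseteq> Z (Suc j)" if "j < k" for j using chain[OF that] by blast
      show "(\<Sum>\<alpha>\<in>?J. c \<alpha> * (\<Prod>i=1..k. f i x ^ \<alpha> i)) = 0" if "x \<in> Z k" for x
        using gZ[OF that] by (simp add: g_def)
      show "f (Suc j) \<in> polynomial_functions scl W" if "j < k" for j using f'(1)[OF that] by (simp add: f_def)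
      show "f (Suc j) x = 0" if "j < k" "x \<in> Z j" for j x using f'(2)[OF that] by (simp add: f_def)
      show "\<exists>x\<in>Z (Suc j). f (Suc j) x \<noteq> 0" if "j < k" for j using f'(3)[OF that] by (simp add: f_def)
    qed (use irr_prod that in auto)
    then show False using c0 by blast
  qed
  then show "v \<le> ereal (real m)" by (simp add: v)
qed

subsection \<open>Coordinates on tensor products\<close>

lemma Hom_space_sum:
  assumes "vector_space scl" "module.subspace scl V" and f: "f \<in> Hom_space scl V (*) UNIV"
    and x: "\<And>k. k \<in> I \<Longrightarrow> x k \<in> V"
  shows "f (\<Sum>k\<in>I. scl (c k) (x k)) = (\<Sum>k\<in>I. c k * f (x k))"
proof -
  interpret vector_space scl by fact
  have add: "f (u + v) = f u + f v" if "u \<in> V" "v \<in> V" for u v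
    using f that by (simp add: Hom_space_def)
  have scale: "f (scl c u) = c * f u" if "u \<in> V" for c u
    using f that by (simp add: Hom_space_def)
  have zero: "f 0 = 0" using scale[of 0 0] subspace_0[OF assms(2)] by simp
  show ?thesis using x
  proof (induction I rule: infinite_finite_induct)
    case (insert k I)
    have "(\<Sum>k\<in>I. scl (c k) (x k)) \<in> V" "scl (c k) (x k) \<in> V"
      using insert.prems by (auto intro!: subspace_sum[OF assms(2)] subspace_scale[OF assms(2)])
    then show ?case using insert by (simp add: add scale)
  qed (simp_all add: zero)
qed

lemma finite_dim_coordinates:
  assumes "vector_space scl" "module.subspace scl V"
    and fin: "\<exists>B. finite B \<and> module.span scl B = V" and dim: "vector_space.dim scl V = n"
  shows "\<exists>b co. (\<forall>k\<in>{1..n}. b k \<in> V \<and> co k \<in> Hom_space scl V (*) UNIV) \<and>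
    (\<forall>v\<in>V. v = (\<Sum>k=1..n. scl (co k v) (b k)))"
proof -
  interpret vector_space scl by fact
  obtain B0 where B0: "finite B0" "span B0 = V" using fin by blast
  obtain B where B: "B \<subseteq> V" "independent B" "V \<subseteq> span B" "card B = dim V"
    using basis_exists by blast
  have finB: "finite B" using independent_span_bound[OF B0(1) B(2)] B(1) B0(2) by blast
  have spanB: "span B = V" using B assms(2) span_minimal by blast
  obtain b where b: "bij_betw b {1..n} B"
    using ex_bij_betw_nat_finite_1[OF finB] B(4) dim by auto
  have "(\<lambda>v. representation B v (b k)) \<in> Hom_space scl V (*) UNIV" for k
    using B(2) spanB by (auto simp: Hom_space_def representation_add representation_scale)
  moreover have "b k \<in> V" if "k \<in> {1..n}" for k
    using that b B(1) by (auto simp: bij_betw_def)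
  moreover have "v = (\<Sum>k=1..n. scl (representation B v (b k)) (b k))" if "v \<in> V" for v
    using sum_representation_eq[OF B(2) _ finB order_refl, of v] that spanB
      sum.reindex_bij_betw[OF b, of "\<lambda>x. scl (representation B v x) x"] by simp
  ultimately show ?thesis
    by (intro exI[of _ b] exI[of _ "\<lambda>k v. representation B v (b k)"]) blast
qed

lemma prod_form_multilinear:
  assumes "\<And>i. i \<in> {1..d} \<Longrightarrow> \<phi> i \<in> Hom_space scl (V i) (*) UNIV"
    and sub: "vector_space scl" "\<And>i. i \<in> {1..d} \<Longrightarrow> module.subspace scl (V i)"
  shows "(\<lambda>v\<in>Pi\<^sub>E {1..d} V. \<Prod>i=1..d. \<phi> i (v i)) \<in> multilinear_forms d scl V"
  unfolding multilinear_forms_def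
proof (intro CollectI conjI ballI)
  interpret vector_space scl by fact
  fix v i assume v: "v \<in> Pi\<^sub>E {1..d} V" and i: "i \<in> {1..d}"
  define f where "f = (\<lambda>v\<in>Pi\<^sub>E {1..d} V. \<Prod>i=1..d. \<phi> i (v i))"
  define c where "c = (\<Prod>j\<in>{1..d} - {i}. \<phi> j (v j))"
  have eq: "f (v(i := x)) = \<phi> i x * c" if "x \<in> V i" for x
  proof -
    have "v(i := x) \<in> Pi\<^sub>E {1..d} V" using v that i by (auto simp: PiE_iff extensional_def)
    then have "f (v(i := x)) = (\<Prod>j=1..d. \<phi> j ((v(i := x)) j))" by (simp add: f_def)
    also have "\<dots> = \<phi> i ((v(i := x)) i) * (\<Prod>j\<in>{1..d} - {i}. \<phi> j ((v(i := x)) j))"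
      using i by (intro prod.remove) auto
    also have "(\<Prod>j\<in>{1..d} - {i}. \<phi> j ((v(i := x)) j)) = c"
      unfolding c_def by (intro prod.cong) auto
    finally show ?thesis by (simp only: fun_upd_same)
  qed
  have "(\<lambda>x. f (v(i := x))) \<in> Hom_space scl (V i) (*) UNIV"
    using assms(1)[OF i] subspace_add[OF sub(2)[OF i]] subspace_scale[OF sub(2)[OF i]]
    by (auto simp: Hom_space_def eq algebra_simps simp del: fun_upd_apply)
  then show "(\<lambda>x. (\<lambda>v\<in>Pi\<^sub>E {1..d} V. \<Prod>i=1..d. \<phi> i (v i)) (v(i := x))) \<in> Hom_space scl (V i) (*) UNIV"
    by (simp only: f_def)
qed simp

text \<open>Coordinates enter through the reconstruction formula \<open>co_sum\<close>, from which
  the expansions of forms and tensors are derived.\<close>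

locale tensor_coordinates = vector_space scl
  for scl :: "'k::field \<Rightarrow> 'v::ab_group_add \<Rightarrow> 'v" +
  fixes V :: "nat \<Rightarrow> 'v set" and d :: nat and n :: "nat \<Rightarrow> nat"
    and b :: "nat \<Rightarrow> nat \<Rightarrow> 'v" and co :: "nat \<Rightarrow> nat \<Rightarrow> 'v \<Rightarrow> 'k"
  assumes subspace_V: "i \<in> {1..d} \<Longrightarrow> subspace (V i)"
    and b_in: "i \<in> {1..d} \<Longrightarrow> k \<in> {1..n i} \<Longrightarrow> b i k \<in> V i"
    and co_Hom: "i \<in> {1..d} \<Longrightarrow> k \<in> {1..n i} \<Longrightarrow> co i k \<in> Hom_space scl (V i) (*) UNIV"
    and co_sum: "i \<in> {1..d} \<Longrightarrow> v \<in> V i \<Longrightarrow> v = (\<Sum>k=1..n i. scl (co i k v) (b i k))"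
begin

definition indices :: "(nat \<Rightarrow> nat) set" where
  "indices = Pi\<^sub>E {1..d} (\<lambda>i. {1..n i})"

definition basis_vec :: "(nat \<Rightarrow> nat) \<Rightarrow> nat \<Rightarrow> 'v" where
  "basis_vec J = (\<lambda>i\<in>{1..d}. b i (J i))"

definition coord_form :: "(nat \<Rightarrow> nat) \<Rightarrow> (nat \<Rightarrow> 'v) \<Rightarrow> 'k" where
  "coord_form J = (\<lambda>v\<in>Pi\<^sub>E {1..d} V. \<Prod>i=1..d. co i (J i) (v i))"

lemma finite_indices: "finite indices"
  unfolding indices_def by (intro finite_PiE) auto

lemma basis_vec_in: "J \<in> indices \<Longrightarrow> basis_vec J \<in> Pi\<^sub>E {1..d} V"
  using b_in by (auto simp: basis_vec_def indices_def PiE_iff)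

lemma coord_form_multilinear: "J \<in> indices \<Longrightarrow> coord_form J \<in> multilinear_forms d scl V"
  unfolding coord_form_def
  by (rule prod_form_multilinear) (use co_Hom subspace_V vector_space_axioms in \<open>auto simp: indices_def PiE_iff\<close>)

lemma multilinear_expansion:
  assumes g: "g \<in> multilinear_forms d scl V" and v: "v \<in> Pi\<^sub>E {1..d} V"
  shows "g v = (\<Sum>J\<in>indices. (\<Prod>i=1..d. co i (J i) (v i)) * g (basis_vec J))"
proof -
  \<comment> \<open>Induction on m: the first m arguments are already basis vectors, the others
    still come from \<open>v\<close>.\<close>
  have "g v = (\<Sum>J\<in>Pi\<^sub>E {1..m} (\<lambda>i. {1..n i}). (\<Prod>i=1..m. co i (J i) (v i)) *
      g (\<lambda>i\<in>{1..d}. if i \<le> m then b i (J i) else v i))" if "m \<le> d" for m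
    using that
  proof (induction m)
    case 0
    have "(\<lambda>i\<in>{1..d}. if i \<le> 0 then b i (J i) else v i) = v" for J
      using v by (auto simp: fun_eq_iff PiE_iff extensional_def)
    then show ?case by simp
  next
    case (Suc m)
    let ?P = "Pi\<^sub>E {1..m} (\<lambda>i. {1..n i})"
    have ins: "{1..Suc m} = insert (Suc m) {1..m}" by auto
    have m: "Suc m \<in> {1..d}" using Suc.prems by simp
    have step: "g (\<lambda>i\<in>{1..d}. if i \<le> m then b i (J i) else v i) =
        (\<Sum>k=1..n (Suc m). co (Suc m) k (v (Suc m)) *
          g (\<lambda>i\<in>{1..d}. if i \<le> Suc m then b i ((J(Suc m := k)) i) else v i))" if J: "J \<in> ?P" for J
    proof -
      define w where "w = (\<lambda>i\<in>{1..d}. if i \<le> m then b i (J i) else v i)"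
      have w: "w \<in> Pi\<^sub>E {1..d} V"
        using v J b_in by (auto simp: w_def PiE_iff)
      have lin: "(\<lambda>x. g (w(Suc m := x))) \<in> Hom_space scl (V (Suc m)) (*) UNIV"
        using g w m unfolding multilinear_forms_def by blast
      have vm: "v (Suc m) \<in> V (Suc m)" using v m by blast
      have "w = w(Suc m := v (Suc m))" using m by (auto simp: w_def fun_eq_iff)
      then have "g w = g (w(Suc m := (\<Sum>k=1..n (Suc m). scl (co (Suc m) k (v (Suc m))) (b (Suc m) k))))"
        using co_sum[OF m vm] by simp
      also have "\<dots> = (\<Sum>k=1..n (Suc m). co (Suc m) k (v (Suc m)) * g (w(Suc m := b (Suc m) k)))"
        by (rule Hom_space_sum[OF vector_space_axioms subspace_V[OF m] lin]) (rule b_in[OF m])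
      also have "\<dots> = (\<Sum>k=1..n (Suc m). co (Suc m) k (v (Suc m)) *
          g (\<lambda>i\<in>{1..d}. if i \<le> Suc m then b i ((J(Suc m := k)) i) else v i))"
      proof (intro sum.cong refl arg_cong2[of _ _ _ _ "(*)"] arg_cong[of _ _ g])
        fix k
        show "w(Suc m := b (Suc m) k) = (\<lambda>i\<in>{1..d}. if i \<le> Suc m then b i ((J(Suc m := k)) i) else v i)"
          using m by (auto simp: w_def fun_eq_iff)
      qed
      finally show ?thesis by (simp only: w_def)
    qed
    have inj: "inj_on (\<lambda>(k, J). J(Suc m := k)) ({1..n (Suc m)} \<times> ?P)"
      by (rule inj_combinator) auto
    have "(\<Sum>J\<in>Pi\<^sub>E {1..Suc m} (\<lambda>i. {1..n i}). (\<Prod>i=1..Suc m. co i (J i) (v i)) *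
      g (\<lambda>i\<in>{1..d}. if i \<le> Suc m then b i (J i) else v i)) =
      (\<Sum>(k, J)\<in>{1..n (Suc m)} \<times> ?P. (\<Prod>i=1..Suc m. co i ((J(Suc m := k)) i) (v i)) *
      g (\<lambda>i\<in>{1..d}. if i \<le> Suc m then b i ((J(Suc m := k)) i) else v i))"
      unfolding ins PiE_insert_eq by (subst sum.reindex[OF inj]) (simp add: case_prod_unfold)
    also have "\<dots> = (\<Sum>(k, J)\<in>{1..n (Suc m)} \<times> ?P. (\<Prod>i=1..m. co i (J i) (v i)) * (co (Suc m) k (v (Suc m)) *
      g (\<lambda>i\<in>{1..d}. if i \<le> Suc m then b i ((J(Suc m := k)) i) else v i)))"
    proof (intro sum.cong refl, clarify)
      fix k J
      have "(\<Prod>i=1..Suc m. co i ((J(Suc m := k)) i) (v i)) =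
          (\<Prod>i=1..m. co i ((J(Suc m := k)) i) (v i)) * co (Suc m) k (v (Suc m))" by simp
      also have "(\<Prod>i=1..m. co i ((J(Suc m := k)) i) (v i)) = (\<Prod>i=1..m. co i (J i) (v i))"
        by (intro prod.cong) auto
      finally show "(\<Prod>i=1..Suc m. co i ((J(Suc m := k)) i) (v i)) *
        g (\<lambda>i\<in>{1..d}. if i \<le> Suc m then b i ((J(Suc m := k)) i) else v i) =
        (\<Prod>i=1..m. co i (J i) (v i)) * (co (Suc m) k (v (Suc m)) *
        g (\<lambda>i\<in>{1..d}. if i \<le> Suc m then b i ((J(Suc m := k)) i) else v i))"
        by (simp only: mult.assoc)
    qed
    also have "\<dots> = (\<Sum>k=1..n (Suc m). \<Sum>J\<in>?P. (\<Prod>i=1..m. co i (J i) (v i)) * (co (Suc m) k (v (Suc m)) *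
      g (\<lambda>i\<in>{1..d}. if i \<le> Suc m then b i ((J(Suc m := k)) i) else v i)))"
      by (rule sum.cartesian_product[symmetric])
    also have "\<dots> = (\<Sum>J\<in>?P. (\<Prod>i=1..m. co i (J i) (v i)) * (\<Sum>k=1..n (Suc m). co (Suc m) k (v (Suc m)) *
      g (\<lambda>i\<in>{1..d}. if i \<le> Suc m then b i ((J(Suc m := k)) i) else v i)))"
      by (subst sum.swap) (simp only: sum_distrib_left)
    also have "\<dots> = g v"
      using Suc.IH Suc.prems by (simp only: step[symmetric] Suc_leD cong: sum.cong)
    finally show ?case by (rule sym)
  qed
  from this[OF order_refl] have "g v = (\<Sum>J\<in>indices. (\<Prod>i=1..d. co i (J i) (v i)) *
      g (\<lambda>i\<in>{1..d}. if i \<le> d then b i (J i) else v i))" by (simp only: indices_def)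
  moreover have "(\<lambda>i\<in>{1..d}. if i \<le> d then b i (J i) else v i) = basis_vec J" for J
    by (auto simp: basis_vec_def fun_eq_iff)
  ultimately show ?thesis by simp
qed

text \<open>Both properties cut out a linear subspace containing the pure tensors, hence hold on
  their span. The second reflects the default value 0 of \<open>pure_tensor\<close>; with it the
  coordinates determine \<open>T\<close> as a function on all arguments.\<close>

lemma tensor_expansion:
  assumes T: "T \<in> tensor_space d scl V"
  shows "g \<in> multilinear_forms d scl V \<Longrightarrow> T g = (\<Sum>J\<in>indices. T (coord_form J) * g (basis_vec J))"
    and "g \<notin> multilinear_forms d scl V \<Longrightarrow> T g = 0"
proof -
  interpret fs: vector_space "fun_scale :: 'k \<Rightarrow> (((nat \<Rightarrow> 'v) \<Rightarrow> 'k) \<Rightarrow> 'k) \<Rightarrow> _"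
    by (rule vector_space_fun_scale)
  define A where "A = {T. (\<forall>g\<in>multilinear_forms d scl V. T g = (\<Sum>J\<in>indices. T (coord_form J) * g (basis_vec J))) \<and>
    (\<forall>g. g \<notin> multilinear_forms d scl V \<longrightarrow> T g = 0)}"
  have "fs.subspace A"
    unfolding fs.subspace_def A_def
    by (auto simp: fun_scale_def sum.distrib distrib_right sum_distrib_left mult.assoc)
  moreover have "pure_tensor d scl V ` Pi\<^sub>E {1..d} V \<subseteq> A"
  proof
    fix t assume "t \<in> pure_tensor d scl V ` Pi\<^sub>E {1..d} V"
    then obtain v where v: "v \<in> Pi\<^sub>E {1..d} V" and t: "t = pure_tensor d scl V v" by blast
    have "t (coord_form J) = (\<Prod>i=1..d. co i (J i) (v i))" if "J \<in> indices" for J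
      using coord_form_multilinear[OF that] v by (simp add: t pure_tensor_def coord_form_def)
    then show "t \<in> A"
      using multilinear_expansion[OF _ v] by (auto simp: A_def t pure_tensor_def)
  qed
  ultimately have "T \<in> A" using T fs.span_minimal unfolding tensor_space_def by blast
  then show "g \<in> multilinear_forms d scl V \<Longrightarrow> T g = (\<Sum>J\<in>indices. T (coord_form J) * g (basis_vec J))"
    and "g \<notin> multilinear_forms d scl V \<Longrightarrow> T g = 0" by (auto simp: A_def)
qed

lemma tensor_as_sum:
  assumes T: "T \<in> tensor_space d scl V"
  shows "T = (\<Sum>J\<in>indices. fun_scale (T (coord_form J)) (pure_tensor d scl V (basis_vec J)))"
proof
  fix g
  have app: "(\<Sum>J\<in>I. f J) g = (\<Sum>J\<in>I. f J g)" for f :: "(nat \<Rightarrow> nat) \<Rightarrow> ((nat \<Rightarrow> 'v) \<Rightarrow> 'k) \<Rightarrow> 'k" and I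
    by (induction I rule: infinite_finite_induct) auto
  show "T g = (\<Sum>J\<in>indices. fun_scale (T (coord_form J)) (pure_tensor d scl V (basis_vec J))) g"
    using tensor_expansion[OF T, of g]
    by (cases "g \<in> multilinear_forms d scl V") (simp_all add: app fun_scale_def pure_tensor_def)
qed

end

subsection \<open>Border subrank\<close>

text \<open>\<open>L\<close> is any function, as \<open>peval\<close> takes a whole type of
  unknowns; the entry is 0 if L i lies outside {1..r} for some i in {1..d}.\<close>

definition entry_form :: "nat \<Rightarrow> nat \<Rightarrow> (nat \<Rightarrow> nat) \<Rightarrow> (nat \<Rightarrow> nat \<Rightarrow> 'k::field) \<Rightarrow> 'k" where
  "entry_form d r L = (\<lambda>v\<in>Pi\<^sub>E {1..d} (\<lambda>_. coord_space r). \<Prod>i=1..d. v i (L i))"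

lemma subspace_coord_space: "module.subspace fun_scale (coord_space r :: (nat \<Rightarrow> 'k::field) set)"
proof -
  interpret vector_space "fun_scale :: 'k \<Rightarrow> (nat \<Rightarrow> 'k) \<Rightarrow> _" by (rule vector_space_fun_scale)
  show ?thesis by (auto simp: subspace_def coord_space_def fun_scale_def)
qed

lemma entry_form_multilinear:
  "entry_form d r L \<in> multilinear_forms d fun_scale (\<lambda>_. coord_space r :: (nat \<Rightarrow> 'k::field) set)"
  unfolding entry_form_def
  by (rule prod_form_multilinear[OF _ vector_space_fun_scale subspace_coord_space])
    (auto simp: Hom_space_def fun_scale_def)

lemma unit_tensor_entry:
  "unit_tensor d r (entry_form d r L) = (\<Sum>l=1..r. \<Prod>i=1..d. if L i = l then 1 else (0::'k::field))"
proof -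
  have app: "(\<Sum>J\<in>I. f J) g = (\<Sum>J\<in>I. f J g)"
    for f :: "nat \<Rightarrow> ((nat \<Rightarrow> nat \<Rightarrow> 'k) \<Rightarrow> 'k) \<Rightarrow> 'k" and I g
    by (induction I rule: infinite_finite_induct) auto
  have "(\<lambda>i\<in>{1..d}. std_basis l) \<in> Pi\<^sub>E {1..d} (\<lambda>_. coord_space r :: (nat \<Rightarrow> 'k) set)" if "l \<in> {1..r}" for l
    using that by (auto simp: coord_space_def std_basis_def)
  moreover have "entry_form d r L \<in> multilinear_forms d fun_scale (\<lambda>_. coord_space r :: (nat \<Rightarrow> 'k) set)"
    by (rule entry_form_multilinear)
  ultimately have "pure_tensor d fun_scale (\<lambda>_. coord_space r) (\<lambda>i\<in>{1..d}. std_basis l) (entry_form d r L) =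
      (\<Prod>i=1..d. if L i = l then 1 else (0::'k))" if "l \<in> {1..r}" for l
    using that
    by (simp add: pure_tensor_def entry_form_def std_basis_def del: One_nat_def)
  then show ?thesis unfolding unit_tensor_def app by (intro sum.cong) auto
qed

context tensor_coordinates
begin

lemma tensor_map_entry:
  assumes T: "T \<in> tensor_space d scl V"
    and \<phi>: "\<And>i. i \<in> {1..d} \<Longrightarrow> \<phi> i \<in> Hom_space scl (V i) fun_scale (coord_space r)"
  shows "tensor_map d V fun_scale (\<lambda>_. coord_space r) \<phi> T (entry_form d r L) =
    (\<Sum>K\<in>indices. T (coord_form K) * (\<Prod>i=1..d. \<phi> i (b i (K i)) (L i)))"
proof -
  let ?h = "\<lambda>v\<in>Pi\<^sub>E {1..d} V. entry_form d r L (\<lambda>i\<in>{1..d}. \<phi> i (v i))"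
  have h: "?h \<in> multilinear_forms d scl V"
    by (rule pullback_multilinear_form[OF vector_space_axioms subspace_V \<phi> entry_form_multilinear])
  have "?h (basis_vec K) = (\<Prod>i=1..d. \<phi> i (b i (K i)) (L i))" if K: "K \<in> indices" for K
  proof -
    have "(\<lambda>i\<in>{1..d}. \<phi> i (basis_vec K i)) \<in> Pi\<^sub>E {1..d} (\<lambda>_. coord_space r)"
      using \<phi> basis_vec_in[OF K] by (auto simp: Hom_space_def PiE_iff Pi_iff)
    then show ?thesis
      using basis_vec_in[OF K] by (simp add: entry_form_def basis_vec_def)
  qed
  moreover have "entry_form d r L \<in> multilinear_forms d fun_scale (\<lambda>_. coord_space r :: (nat \<Rightarrow> 'k) set)"
    by (rule entry_form_multilinear)
  ultimately show ?thesis
    using tensor_expansion(1)[OF T h] by (simp add: tensor_map_def)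
qed

text \<open>Evaluation at a form is linear, so an expression in the entries is a polynomial
  function. Its zero set is closed and contains all restrictions of \<open>T\<close>, hence their
  closure.\<close>

lemma closure_point_entries:
  assumes T: "T \<in> tensor_space d scl V"
    and closure: "U \<in> zariski_topology fun_scale (coord_tensor_space d r) closure_of
          {tensor_map d V fun_scale (\<lambda>_. coord_space r) \<phi> T | \<phi>.
             \<forall>i\<in>{1..d}. \<phi> i \<in> Hom_space scl (V i) fun_scale (coord_space r)}"
    and e: "\<And>x. peval (\<lambda>c. c) (\<lambda>L. \<Sum>K\<in>indices. T (coord_form K) * (\<Prod>i=1..d. x i (L i) (K i))) e = 0"
  shows "peval (\<lambda>c. c) (\<lambda>L. U (entry_form d r L)) e = 0"
proof -
  let ?W = "coord_tensor_space d r :: (((nat \<Rightarrow> nat \<Rightarrow> 'k) \<Rightarrow> 'k) \<Rightarrow> 'k) set"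
  let ?X = "zariski_topology fun_scale ?W"
  let ?A = "{tensor_map d V fun_scale (\<lambda>_. coord_space r) \<phi> T | \<phi>.
             \<forall>i\<in>{1..d}. \<phi> i \<in> Hom_space scl (V i) fun_scale (coord_space r)}"
  define f where "f e U = peval (\<lambda>c. c) (\<lambda>L. U (entry_form d r L)) e"
    for e and U :: "((nat \<Rightarrow> nat \<Rightarrow> 'k) \<Rightarrow> 'k) \<Rightarrow> 'k"
  have lin: "(\<lambda>U. U h) \<in> polynomial_functions fun_scale ?W" for h :: "(nat \<Rightarrow> nat \<Rightarrow> 'k) \<Rightarrow> 'k"
    by (rule polynomial_functions.linear) (auto simp: Hom_space_def fun_scale_def)
  have f: "f e \<in> polynomial_functions fun_scale ?W" for e
    unfolding f_def[abs_def]
    by (induction e) (auto intro: lin polynomial_functions.const polynomial_functions.add polynomial_functions.mult)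
  have closed: "closedin ?X {U \<in> ?W. f e U = 0}"
    unfolding closedin_zariski_topology zariski_closed_def using f by (intro exI[of _ "{f e}"]) auto
  \<comment> \<open>Intersecting with the space leaves the closure unchanged and supplies membership
    in \<open>?W\<close>.\<close>
  have "topspace ?X \<inter> ?A \<subseteq> {U \<in> ?W. f e U = 0}"
  proof
    fix U assume "U \<in> topspace ?X \<inter> ?A"
    then obtain \<phi> where U: "U \<in> ?W" "U = tensor_map d V fun_scale (\<lambda>_. coord_space r) \<phi> T"
      and \<phi>: "\<And>i. i \<in> {1..d} \<Longrightarrow> \<phi> i \<in> Hom_space scl (V i) fun_scale (coord_space r)" by auto
    have "U (entry_form d r L) = (\<Sum>K\<in>indices. T (coord_form K) * (\<Prod>i=1..d. \<phi> i (b i (K i)) (L i)))" for L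
      unfolding U(2) by (rule tensor_map_entry[OF T \<phi>])
    then have "f e U = 0"
      using e[of "\<lambda>i l k. \<phi> i (b i k) l"] by (simp only: f_def)
    then show "U \<in> {U \<in> ?W. f e U = 0}" using U by blast
  qed
  then have "?X closure_of (topspace ?X \<inter> ?A) \<subseteq> {U \<in> ?W. f e U = 0}"
    by (rule closure_of_minimal[OF _ closed])
  then have "f e U = 0" using closure closure_of_restrict[of ?X ?A] by auto
  then show ?thesis by (simp add: f_def)
qed

text \<open>\<open>GREATEST\<close> is meaningful only if some r qualifies, and this provides r = 0.
  Zero maps realise it: with d >= 1 a multilinear form vanishes at the zero tuple.\<close>

lemma unit_tensor_0_in_closure:
  assumes T: "T \<in> tensor_space d scl V" and d: "d \<ge> 1"
  shows "unit_tensor d 0 \<in> zariski_topology fun_scale (coord_tensor_space d 0) closure_of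
          {tensor_map d V fun_scale (\<lambda>_. coord_space 0) \<phi> T | \<phi>.
             \<forall>i\<in>{1..d}. \<phi> i \<in> Hom_space scl (V i) fun_scale (coord_space 0)}" (is "_ \<in> ?X closure_of ?A")
proof -
  let ?W = "coord_tensor_space d 0 :: (((nat \<Rightarrow> nat \<Rightarrow> 'k) \<Rightarrow> 'k) \<Rightarrow> 'k) set"
  interpret fs: vector_space "fun_scale :: 'k \<Rightarrow> (((nat \<Rightarrow> nat \<Rightarrow> 'k) \<Rightarrow> 'k) \<Rightarrow> 'k) \<Rightarrow> _"
    by (rule vector_space_fun_scale)
  let ?\<phi> = "\<lambda>(i::nat) (v::'v). (0 :: nat \<Rightarrow> 'k)"
  have \<phi>: "?\<phi> i \<in> Hom_space scl (V i) fun_scale (coord_space 0)" for i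
    by (auto simp: Hom_space_def coord_space_def fun_scale_def)
  have "tensor_map d V fun_scale (\<lambda>_. coord_space 0) ?\<phi> T = (0 :: ((nat \<Rightarrow> nat \<Rightarrow> 'k) \<Rightarrow> 'k) \<Rightarrow> 'k)"
  proof
    fix g :: "(nat \<Rightarrow> nat \<Rightarrow> 'k) \<Rightarrow> 'k"
    let ?h = "\<lambda>v\<in>Pi\<^sub>E {1..d} V. g (\<lambda>i\<in>{1..d}. ?\<phi> i (v i))"
    show "tensor_map d V fun_scale (\<lambda>_. coord_space 0) ?\<phi> T g = 0 g"
    proof (cases "g \<in> multilinear_forms d fun_scale (\<lambda>_. coord_space 0)")
      case True
      define z where "z = (\<lambda>i\<in>{1..d}. (0 :: nat \<Rightarrow> 'k))"
      have z: "z \<in> Pi\<^sub>E {1..d} (\<lambda>_. coord_space 0)" by (auto simp: z_def coord_space_def)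
      have "(\<lambda>x. g (z(1 := x))) \<in> Hom_space fun_scale (coord_space 0) (*) UNIV"
        using True z d unfolding multilinear_forms_def by auto
      then have "g (z(1 := fun_scale 0 0)) = 0 * g (z(1 := 0))"
        unfolding Hom_space_def coord_space_def by fastforce
      moreover have "z(1 := fun_scale 0 0) = z" using d by (auto simp: z_def fun_scale_def fun_eq_iff)
      ultimately have gz: "g z = 0" by simp
      have h: "?h \<in> multilinear_forms d scl V"
        by (rule pullback_multilinear_form[OF vector_space_axioms subspace_V \<phi> True])
      have "T ?h = (\<Sum>J\<in>indices. T (coord_form J) * ?h (basis_vec J))"
        by (rule tensor_expansion(1)[OF T h])
      also have "\<dots> = 0" using gz basis_vec_in by (intro sum.neutral) (simp add: z_def)
      finally show ?thesis using True by (simp add: tensor_map_def)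
    qed (simp add: tensor_map_def)
  qed
  also have "0 = unit_tensor d 0" by (simp add: unit_tensor_def)
  finally have "unit_tensor d 0 \<in> ?A" using \<phi> by (intro CollectI exI[of _ ?\<phi>] conjI ballI) simp_all
  moreover have "unit_tensor d 0 \<in> ?W"
    unfolding unit_tensor_def coord_tensor_space_def tensor_space_def using fs.span_zero by simp
  ultimately have "unit_tensor d 0 \<in> topspace ?X \<inter> ?A" by simp
  then show ?thesis by (rule subsetD[OF closure_of_subset_Int])
qed

end

text \<open>The \<open>GREATEST\<close> is attained, since 0 qualifies and every r' that qualifies
  is at most n 1. So the closure condition holds at the border subrank itself, and
  \<open>restriction_of_degeneration\<close> passes from there down to r.\<close>

lemma border_subrank_locus_restriction:
  fixes scl :: "'k::alg_closed_field \<Rightarrow> 'v::ab_group_add \<Rightarrow> 'v"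
  assumes "tensor_coordinates scl V d n b co" and d: "d \<ge> 2"
    and T: "T \<in> border_subrank_locus d scl V r"
  shows "i \<in> {1..d} \<Longrightarrow> r \<le> n i"
    and "\<exists>p u c.
      (\<forall>i\<in>{1..d}. \<forall>j\<in>{1..r div d}. c i j \<in> {1..n i}) \<and>
      (\<forall>i\<in>{1..d}. \<forall>j\<in>{1..r div d}. \<forall>l\<in>{1..r div d}. p i j (c i l) = (if j = l then 1 else 0)) \<and>
      (\<forall>L\<in>Pi\<^sub>E {1..d} (\<lambda>_. {1..r div d}).
         (\<Sum>K\<in>Pi\<^sub>E {1..d} (\<lambda>i. {1..n i}).
            T (tensor_coordinates.coord_form V d co K) * (\<Prod>i=1..d. p i (L i) (K i)))
         = (\<Sum>l=1..r. \<Prod>i=1..d. u i (L i) l))"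
proof -
  interpret tensor_coordinates scl V d n b co by fact
  have TW: "T \<in> tensor_space d scl V" and Tr: "r \<le> border_subrank d scl V T"
    using T by (auto simp: border_subrank_locus_def)
  define P where "P r \<longleftrightarrow> unit_tensor d r \<in>
        zariski_topology fun_scale (coord_tensor_space d r) closure_of
          {tensor_map d V fun_scale (\<lambda>_. coord_space r) \<phi> T | \<phi>.
             \<forall>i\<in>{1..d}. \<phi> i \<in> Hom_space scl (V i) fun_scale (coord_space r)}" for r
  have degen: "peval (\<lambda>c. c) (\<lambda>L. \<Sum>l=1..r'. \<Prod>i=1..d. if L i = l then 1 else 0) e = (0 :: 'k)"
    if "P r'" and e: "\<And>x. peval (\<lambda>c. c) (\<lambda>L. \<Sum>K\<in>Pi\<^sub>E {1..d} (\<lambda>i. {1..n i}).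
          T (coord_form K) * (\<Prod>i=1..d. x i (L i) (K i))) e = 0" for r' e
    using closure_point_entries[OF TW that(1)[unfolded P_def] e[folded indices_def]]
    by (simp only: unit_tensor_entry)
  have bound: "r' \<le> n 1" if "P r'" for r'
    by (rule restriction_of_degeneration(1)[OF d order_refl degen[OF that], where i = 1]) (use d in auto)
  have "P 0" unfolding P_def using unit_tensor_0_in_closure[OF TW] d by simp
  then have "P (GREATEST r. P r)" using bound by (intro GreatestI_nat[of P 0 "n 1"]) auto
  moreover have "border_subrank d scl V T = (GREATEST r. P r)"
    by (simp only: border_subrank_def P_def)
  ultimately have *: "P (border_subrank d scl V T)" by simp
  show "i \<in> {1..d} \<Longrightarrow> r \<le> n i"
    by (rule restriction_of_degeneration(1)[OF d Tr degen[OF *]])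
  show "\<exists>p u c.
      (\<forall>i\<in>{1..d}. \<forall>j\<in>{1..r div d}. c i j \<in> {1..n i}) \<and>
      (\<forall>i\<in>{1..d}. \<forall>j\<in>{1..r div d}. \<forall>l\<in>{1..r div d}. p i j (c i l) = (if j = l then 1 else 0)) \<and>
      (\<forall>L\<in>Pi\<^sub>E {1..d} (\<lambda>_. {1..r div d}).
         (\<Sum>K\<in>Pi\<^sub>E {1..d} (\<lambda>i. {1..n i}). T (coord_form K) * (\<Prod>i=1..d. p i (L i) (K i)))
         = (\<Sum>l=1..r. \<Prod>i=1..d. u i (L i) l))"
    by (rule restriction_of_degeneration(2)[OF d Tr degen[OF *] refl])
qed

subsection \<open>The parameter count\<close>

definition comp_index :: "nat \<Rightarrow> (nat \<Rightarrow> nat \<Rightarrow> nat) \<Rightarrow> (nat \<Rightarrow> nat) \<Rightarrow> nat \<Rightarrow> nat" where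
  "comp_index d c L = (\<lambda>i\<in>{1..d}. c i (L i))"

lemma inj_on_comp_index:
  assumes "\<And>i. i \<in> {1..d} \<Longrightarrow> inj_on (c i) {1..s}"
  shows "inj_on (comp_index d c) (Pi\<^sub>E {1..d} (\<lambda>_. {1..s}))"
proof (rule inj_onI)
  fix L L' assume L: "L \<in> Pi\<^sub>E {1..d} (\<lambda>_. {1..s})" and L': "L' \<in> Pi\<^sub>E {1..d} (\<lambda>_. {1..s})"
    and eq: "comp_index d c L = comp_index d c L'"
  show "L = L'"
  proof (rule PiE_ext[OF L L'])
    fix i assume i: "i \<in> {1..d}"
    then have "c i (L i) = c i (L' i)" using fun_cong[OF eq, of i] by (simp add: comp_index_def)
    moreover have "L i \<in> {1..s}" "L' i \<in> {1..s}" using L L' i by (auto simp: PiE_iff)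
    ultimately show "L i = L' i" using inj_onD[OF assms[OF i]] by blast
  qed
qed

lemma comp_index_in:
  assumes "\<And>i j. i \<in> {1..d} \<Longrightarrow> j \<in> {1..s} \<Longrightarrow> c i j \<in> {1..n i}" "L \<in> Pi\<^sub>E {1..d} (\<lambda>_. {1..s})"
  shows "comp_index d c L \<in> Pi\<^sub>E {1..d} (\<lambda>i. {1..n i})"
  unfolding comp_index_def
  by (rule restrict_PiE_iff[THEN iffD2]) (use assms in \<open>auto simp del: atLeastAtMost_iff simp: PiE_iff\<close>)

text \<open>On the selected columns \<open>p\<close> is the identity, so the contraction at
  \<open>L\<close> contains a single entry of the block, with coefficient 1; its other terms involve
  only entries outside the block.\<close>

lemma block_entry_recovery:
  fixes T :: "(nat \<Rightarrow> nat) \<Rightarrow> 'k::field"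
  assumes c: "\<And>i j. i \<in> {1..d} \<Longrightarrow> j \<in> {1..s} \<Longrightarrow> c i j \<in> {1..n i}"
    and inj: "\<And>i. i \<in> {1..d} \<Longrightarrow> inj_on (c i) {1..s}"
    and p: "\<And>i j l. i \<in> {1..d} \<Longrightarrow> j \<in> {1..s} \<Longrightarrow> l \<in> {1..s} \<Longrightarrow> p i j (c i l) = (if j = l then 1 else 0)"
    and L: "L \<in> Pi\<^sub>E {1..d} (\<lambda>_. {1..s})"
  shows "T (comp_index d c L) =
    (\<Sum>K\<in>Pi\<^sub>E {1..d} (\<lambda>i. {1..n i}). T K * (\<Prod>i=1..d. p i (L i) (K i))) -
    (\<Sum>K\<in>Pi\<^sub>E {1..d} (\<lambda>i. {1..n i}) - comp_index d c ` Pi\<^sub>E {1..d} (\<lambda>_. {1..s}).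
       T K * (\<Prod>i=1..d. p i (L i) (K i)))"
proof -
  let ?I = "Pi\<^sub>E {1..d} (\<lambda>i. {1..n i})" and ?P = "Pi\<^sub>E {1..d} (\<lambda>_. {1..s})"
  let ?f = "\<lambda>K. T K * (\<Prod>i=1..d. p i (L i) (K i))"
  have fin: "finite ?I" "finite ?P" by (auto intro!: finite_PiE)
  have sub: "comp_index d c ` ?P \<subseteq> ?I" using comp_index_in[of d s c n] c by blast
  have "sum ?f (comp_index d c ` ?P) = (\<Sum>L'\<in>?P. ?f (comp_index d c L'))"
    by (simp only: sum.reindex[OF inj_on_comp_index[OF inj]] o_def)
  also have "\<dots> = (\<Sum>L'\<in>?P. if L' = L then T (comp_index d c L) else 0)"
  proof (intro sum.cong refl)
    fix L' assume L': "L' \<in> ?P"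
    have "(\<Prod>i=1..d. p i (L i) (comp_index d c L' i)) = (\<Prod>i=1..d. if L i = L' i then 1 else 0)"
      using p L L' by (intro prod.cong refl) (auto simp: comp_index_def PiE_iff)
    also have "\<dots> = (if L' = L then 1 else 0)"
    proof (cases "L' = L")
      case False
      then obtain i where "i \<in> {1..d}" "L i \<noteq> L' i" using PiE_ext[OF L' L] by metis
      then show ?thesis using False by (auto intro!: prod_zero)
    qed simp
    finally show "?f (comp_index d c L') = (if L' = L then T (comp_index d c L) else 0)" by simp
  qed
  also have "\<dots> = T (comp_index d c L)" using L fin by (simp add: sum.delta)
  finally show ?thesis using sum.subset_diff[OF sub fin(1), of ?f] by simp
qed

context tensor_coordinates
begin

definition block :: "nat \<Rightarrow> (nat \<Rightarrow> nat \<Rightarrow> nat) \<Rightarrow> (nat \<Rightarrow> nat) set" where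
  "block s c = comp_index d c ` Pi\<^sub>E {1..d} (\<lambda>_. {1..s})"

text \<open>The summands are the entries of the p i, the vectors u i of the rank decomposition, and
  the entries of \<open>T\<close> off the block. All entries of p i are counted, even those
  prescribed to be 0 or 1; the asserted bound leaves room for this.\<close>

definition params :: "nat \<Rightarrow> nat \<Rightarrow> (nat \<Rightarrow> nat \<Rightarrow> nat) \<Rightarrow>
    (nat \<times> nat \<times> nat + nat \<times> nat \<times> nat + (nat \<Rightarrow> nat)) set" where
  "params r s c = (SIGMA i:{1..d}. {1..s} \<times> {1..n i}) <+>
     ({1..d} \<times> {1..s} \<times> {1..r}) <+> (indices - block s c)"

text \<open>\<open>block_entry_recovery\<close> solved for the block, with the contraction replaced
  by its decomposition into r product tensors.\<close>

definition entry_param :: "nat \<Rightarrow> nat \<Rightarrow> (nat \<Rightarrow> nat \<Rightarrow> nat) \<Rightarrow> (nat \<Rightarrow> nat) \<Rightarrow>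
    (nat \<times> nat \<times> nat + nat \<times> nat \<times> nat + (nat \<Rightarrow> nat) \<Rightarrow> 'k) \<Rightarrow> 'k" where
  "entry_param r s c J y =
     (if J \<in> block s c then
        let L = inv_into (Pi\<^sub>E {1..d} (\<lambda>_. {1..s})) (comp_index d c) J in
        (\<Sum>l=1..r. \<Prod>i=1..d. y (Inr (Inl (i, L i, l)))) -
        (\<Sum>K\<in>indices - block s c. y (Inr (Inr K)) * (\<Prod>i=1..d. y (Inl (i, L i, K i))))
      else y (Inr (Inr J)))"

lemma entry_param_polynomial:
  assumes J: "J \<in> indices"
  shows "entry_param r s c J \<in> polynomial_maps (params r s c)"
proof (cases "J \<in> block s c")
  case True
  define L where "L = inv_into (Pi\<^sub>E {1..d} (\<lambda>_. {1..s})) (comp_index d c) J"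
  have L: "L i \<in> {1..s}" if "i \<in> {1..d}" for i
    using inv_into_into[of J "comp_index d c" "Pi\<^sub>E {1..d} (\<lambda>_. {1..s})"] True that
    unfolding block_def L_def by blast
  have eq: "entry_param r s c J = (\<lambda>y. (\<Sum>l=1..r. \<Prod>i=1..d. y (Inr (Inl (i, L i, l)))) -
        (\<Sum>K\<in>indices - block s c. y (Inr (Inr K)) * (\<Prod>i=1..d. y (Inl (i, L i, K i)))))"
    using True by (simp add: entry_param_def[abs_def] L_def Let_def)
  have mem: "Inr (Inl (i, L i, l)) \<in> params r s c" if "i \<in> {1..d}" "l \<in> {1..r}" for i l
    using that L[of i] by (auto simp: params_def)
  have mem2: "Inr (Inr K) \<in> params r s c" if "K \<in> indices - block s c" for K
    using that by (auto simp: params_def)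
  have mem3: "Inl (i, L i, K i) \<in> params r s c" if "K \<in> indices - block s c" "i \<in> {1..d}" for i K
  proof -
    have "K i \<in> {1..n i}" using that by (auto simp: indices_def)
    then show ?thesis using that(2) L[of i] by (auto simp: params_def)
  qed
  have "(\<lambda>y. \<Sum>l=1..r. \<Prod>i=1..d. y (Inr (Inl (i, L i, l)))) \<in> polynomial_maps (params r s c)"
    by (intro polynomial_maps_sum polynomial_maps_prod polynomial_maps.var mem)
  moreover have "(\<lambda>y. \<Sum>K\<in>indices - block s c. y (Inr (Inr K)) * (\<Prod>i=1..d. y (Inl (i, L i, K i))))
      \<in> polynomial_maps (params r s c)"
    by (intro polynomial_maps_sum polynomial_maps.mult polynomial_maps_prod polynomial_maps.var mem2 mem3)
  ultimately show ?thesis unfolding eq by (rule polynomial_maps_diff)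
next
  case False
  then have "entry_param r s c J = (\<lambda>y. y (Inr (Inr J)))" by (simp add: entry_param_def[abs_def])
  then show ?thesis using J False by (auto simp: params_def intro!: polynomial_maps.var)
qed

lemma card_params:
  assumes c: "\<And>i j. i \<in> {1..d} \<Longrightarrow> j \<in> {1..s} \<Longrightarrow> c i j \<in> {1..n i}"
    and inj: "\<And>i. i \<in> {1..d} \<Longrightarrow> inj_on (c i) {1..s}"
  shows "finite (params r s c)"
    and "card (params r s c) = (\<Sum>i=1..d. s * n i) + (d * s * r + ((\<Prod>i=1..d. n i) - s ^ d))"
proof -
  show "finite (params r s c)" by (simp add: params_def finite_indices)
  have sub: "block s c \<subseteq> indices"
    using comp_index_in[of d s c n] c unfolding block_def indices_def by blast
  have "card (block s c) = card (Pi\<^sub>E {1..d} (\<lambda>_. {1..s}))"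
    unfolding block_def by (rule card_image[OF inj_on_comp_index[OF inj]])
  also have "\<dots> = s ^ d" by (simp add: card_PiE)
  finally have "card (indices - block s c) = (\<Prod>i=1..d. n i) - s ^ d"
    using card_Diff_subset[OF finite_subset[OF sub finite_indices] sub] by (simp add: indices_def card_PiE)
  moreover have "card (SIGMA i:{1..d}. {1..s} \<times> {1..n i}) = (\<Sum>i=1..d. s * n i)"
    by (subst card_SigmaI) auto
  ultimately show "card (params r s c) = (\<Sum>i=1..d. s * n i) + (d * s * r + ((\<Prod>i=1..d. n i) - s ^ d))"
    unfolding params_def by (simp add: card_Plus finite_indices card_cartesian_product mult.assoc)
qed

end

text \<open>Each choice of columns \<open>c\<close> gives one polynomial parametrisation, there are
  finitely many choices, and their images cover the locus. Covering is all that an upper bound asks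
  for.\<close>

lemma border_subrank_locus_dim_le:
  fixes scl :: "'k::alg_closed_field \<Rightarrow> 'v::ab_group_add \<Rightarrow> 'v"
  assumes coords: "tensor_coordinates scl V d n b co" and d: "d \<ge> 2" and s: "s = r div d"
  shows "constructible_dim (zariski_topology fun_scale (tensor_space d scl V)) (border_subrank_locus d scl V r)
    \<le> ereal (real ((\<Sum>i=1..d. s * n i) + (d * s * r + ((\<Prod>i=1..d. n i) - s ^ d))))"
proof -
  interpret tensor_coordinates scl V d n b co by fact
  interpret fs: vector_space "fun_scale :: 'k \<Rightarrow> (((nat \<Rightarrow> 'v) \<Rightarrow> 'k) \<Rightarrow> 'k) \<Rightarrow> _"
    by (rule vector_space_fun_scale)
  \<comment> \<open>Extensional functions make the set of choices finite; the \<open>c\<close> found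
    for a given tensor is later restricted to this form.\<close>
  define \<Sigma> where "\<Sigma> = {c \<in> Pi\<^sub>E {1..d} (\<lambda>i. Pi\<^sub>E {1..s} (\<lambda>_. {1..n i})). \<forall>i\<in>{1..d}. inj_on (c i) {1..s}}"
  have "finite (Pi\<^sub>E {1..d} (\<lambda>i. Pi\<^sub>E {1..s} (\<lambda>_. {1..n i})))" by (intro finite_PiE) auto
  then have fin: "finite \<Sigma>" by (simp add: \<Sigma>_def)
  have \<Sigma>_in: "c i j \<in> {1..n i}" if "c \<in> \<Sigma>" "i \<in> {1..d}" "j \<in> {1..s}" for c i j
    using that unfolding \<Sigma>_def by blast
  have \<Sigma>_inj: "inj_on (c i) {1..s}" if "c \<in> \<Sigma>" "i \<in> {1..d}" for c i
    using that unfolding \<Sigma>_def by blast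
  define E where "E J = pure_tensor d scl V (basis_vec J)" for J
  have E: "E J \<in> tensor_space d scl V" if "J \<in> indices" for J
    unfolding E_def tensor_space_def using basis_vec_in[OF that] by (intro fs.span_base imageI)
  have sub: "fs.subspace (tensor_space d scl V)"
    unfolding tensor_space_def by (rule fs.subspace_span)
  define F where "F c y = (\<Sum>J\<in>indices. fun_scale (entry_param r s c J y) (E J))" for c y
  show ?thesis
  proof (rule constructible_dim_le[OF fin])
    fix c assume "c \<in> \<Sigma>"
    note c = \<Sigma>_in[OF this] and inj = \<Sigma>_inj[OF this]
    show "finite (params r s c)" by (rule card_params(1)[OF c inj])
    show "card (params r s c) \<le> (\<Sum>i=1..d. s * n i) + (d * s * r + ((\<Prod>i=1..d. n i) - s ^ d))"
      by (simp only: card_params(2)[OF c inj])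
    fix l :: "(((nat \<Rightarrow> 'v) \<Rightarrow> 'k) \<Rightarrow> 'k) \<Rightarrow> 'k"
    assume l: "l \<in> Hom_space fun_scale (tensor_space d scl V) (*) UNIV"
    have "l (F c y) = (\<Sum>J\<in>indices. entry_param r s c J y * l (E J))" for y
      unfolding F_def by (rule Hom_space_sum[OF vector_space_fun_scale sub l E])
    then show "(\<lambda>y. l (F c y)) \<in> polynomial_maps (params r s c)"
      by (simp only:) (intro polynomial_maps_sum polynomial_maps.mult polynomial_maps.const entry_param_polynomial)
  next
    show "border_subrank_locus d scl V r \<subseteq> tensor_space d scl V"
      by (auto simp: border_subrank_locus_def)
  next
    fix T assume T: "T \<in> border_subrank_locus d scl V r"
    then have TW: "T \<in> tensor_space d scl V" by (simp add: border_subrank_locus_def)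
    from border_subrank_locus_restriction(2)[OF coords d T, folded s] obtain p u c where
      c0: "\<forall>i\<in>{1..d}. \<forall>j\<in>{1..s}. c i j \<in> {1..n i}"
      and p0: "\<forall>i\<in>{1..d}. \<forall>j\<in>{1..s}. \<forall>l\<in>{1..s}. p i j (c i l) = (if j = l then 1 else 0)"
      and u0: "\<forall>L\<in>Pi\<^sub>E {1..d} (\<lambda>_. {1..s}).
         (\<Sum>K\<in>Pi\<^sub>E {1..d} (\<lambda>i. {1..n i}). T (coord_form K) * (\<Prod>i=1..d. p i (L i) (K i)))
         = (\<Sum>l=1..r. \<Prod>i=1..d. u i (L i) l)"
      by (elim exE conjE)
    note c = c0[rule_format] and p = p0[rule_format] and u = u0[rule_format]
    define c' where "c' = (\<lambda>i\<in>{1..d}. \<lambda>j\<in>{1..s}. c i j)"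
    have c'_eq: "c' i j = c i j" if "i \<in> {1..d}" "j \<in> {1..s}" for i j
      using that by (simp add: c'_def)
    have p': "p i j (c' i l) = (if j = l then 1 else 0)" if "i \<in> {1..d}" "j \<in> {1..s}" "l \<in> {1..s}" for i j l
      using p that by (simp only: c'_eq)
    have c'_in: "c' i j \<in> {1..n i}" if "i \<in> {1..d}" "j \<in> {1..s}" for i j
      using c that by (simp only: c'_eq)
    have inj: "inj_on (c' i) {1..s}" if "i \<in> {1..d}" for i
    proof (rule inj_onI)
      fix j l assume jl: "j \<in> {1..s}" "l \<in> {1..s}" "c' i j = c' i l"
      \<comment> \<open>If the columns of j and l coincide, p takes both its diagonal value 1 and
        its value at (j, l) there, which would be 0 for j different from l.\<close>
      have "p i j (c' i l) = 1" using p'[OF that jl(1) jl(1)] jl(3) by simp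
      then show "j = l" using p'[OF that jl(1,2)] by (simp split: if_splits)
    qed
    have "c' \<in> \<Sigma>" unfolding \<Sigma>_def using inj c by (auto simp: c'_def)
    moreover have "T = F c' (case_sum (\<lambda>(i, j, k). p i j k) (case_sum (\<lambda>(i, j, l). u i j l) (\<lambda>J. T (coord_form J))))"
      (is "T = F c' ?y")
    proof -
      have entry: "T (coord_form J) = entry_param r s c' J ?y" if J: "J \<in> indices" for J
      proof (cases "J \<in> block s c'")
        case True
        define L where "L = inv_into (Pi\<^sub>E {1..d} (\<lambda>_. {1..s})) (comp_index d c') J"
        have L: "L \<in> Pi\<^sub>E {1..d} (\<lambda>_. {1..s})" "comp_index d c' L = J"
          using inv_into_into[OF True[unfolded block_def]] f_inv_into_f[OF True[unfolded block_def]]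
          unfolding L_def by blast+
        have "T (coord_form (comp_index d c' L)) =
            (\<Sum>K\<in>Pi\<^sub>E {1..d} (\<lambda>i. {1..n i}). T (coord_form K) * (\<Prod>i=1..d. p i (L i) (K i))) -
            (\<Sum>K\<in>Pi\<^sub>E {1..d} (\<lambda>i. {1..n i}) - comp_index d c' ` Pi\<^sub>E {1..d} (\<lambda>_. {1..s}).
              T (coord_form K) * (\<Prod>i=1..d. p i (L i) (K i)))"
          by (rule block_entry_recovery[where T = "\<lambda>J. T (coord_form J)", OF _ _ _ L(1)])
            (rule c'_in inj p'; assumption)+
        then have "T (coord_form J) = (\<Sum>l=1..r. \<Prod>i=1..d. u i (L i) l) -
            (\<Sum>K\<in>indices - block s c'. T (coord_form K) * (\<Prod>i=1..d. p i (L i) (K i)))"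
          unfolding u[OF L(1), folded indices_def] L(2) indices_def[symmetric] block_def[symmetric] .
        then show ?thesis using True by (simp add: entry_param_def L_def Let_def)
      qed (simp add: entry_param_def)
      have "(\<Sum>J\<in>indices. fun_scale (T (coord_form J)) (pure_tensor d scl V (basis_vec J))) = F c' ?y"
        unfolding F_def E_def by (intro sum.cong refl) (simp only: entry)
      with tensor_as_sum[OF TW] show ?thesis by (rule trans)
    qed
    ultimately show "\<exists>c\<in>\<Sigma>. \<exists>y. T = F c y" by blast
  qed
qed

text \<open>With A the sum of the n i, the bound exceeds the count by s (A - 2 d s) + r (A - d r) +
  d r (r - 1 - s) + r. Each term is nonnegative: r <= n i gives A >= d r, and d >= 2 gives 2 s <= d
  s <= r, whence s <= r - 1 if r > 0.\<close>

lemma dimension_bound_arith: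
  fixes n :: "nat \<Rightarrow> nat" and d r s :: nat
  assumes d: "d \<ge> 2" and s: "s = r div d" and n: "\<And>i. i \<in> {1..d} \<Longrightarrow> r \<le> n i"
  shows "int ((\<Sum>i=1..d. s * n i) + (d * s * r + ((\<Prod>i=1..d. n i) - s ^ d))) \<le>
    (\<Prod>i=1..d. int (n i)) - int s ^ d
               + (\<Sum>i=1..d. 2 * int s * (int (n i) - int s))
               + int r * (1 + int d * (int r - 1) + (\<Sum>i=1..d. (int (n i) - int r)))"
proof -
  have ds: "d * s \<le> r" using s by simp
  have "s * 2 \<le> s * d" using d by (rule mult_left_mono) simp
  then have s2: "2 * s \<le> r" using ds by (metis mult.commute order_trans)
  \<comment> \<open>This comparison makes the truncated subtraction of s ^ d exact.\<close>
  have "s ^ d = (\<Prod>i=1..d. s)" by simp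
  also have "\<dots> \<le> (\<Prod>i=1..d. n i)"
  proof (intro prod_mono conjI)
    fix i assume "i \<in> {1..d}"
    then show "s \<le> n i" using n[of i] s2 by simp
  qed simp
  finally have "int ((\<Prod>i=1..d. n i) - s ^ d) = (\<Prod>i=1..d. int (n i)) - int s ^ d"
    by (simp add: of_nat_diff)
  moreover define A where "A = (\<Sum>i=1..d. int (n i))"
  have "(\<Sum>i=1..d. int r) \<le> A" unfolding A_def using n by (intro sum_mono) simp
  then have A: "int d * int r \<le> A" by simp
  have e1: "(\<Sum>i=1..d. 2 * int s * (int (n i) - int s)) = 2 * int s * A - 2 * int d * int s * int s"
    unfolding A_def by (simp add: right_diff_distrib sum_subtractf sum_distrib_left)
  have e2: "(\<Sum>i=1..d. (int (n i) - int r)) = A - int d * int r"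
    unfolding A_def by (simp add: sum_subtractf)
  have e3: "int (\<Sum>i=1..d. s * n i) = int s * A"
    unfolding A_def by (simp add: sum_distrib_left)
  have "int s * A + int d * int s * int r \<le>
     2 * int s * A - 2 * int d * int s * int s + int r * (1 + int d * (int r - 1) + (A - int d * int r))"
  proof (cases "r = 0")
    case True
    then show ?thesis using s by simp
  next
    case False
    have s2': "2 * int s \<le> int r" using s2 by linarith
    have "int s * (2 * int d * int s) \<le> int s * A"
    proof (rule mult_left_mono)
      have "int d * (2 * int s) \<le> int d * int r" using s2' by (rule mult_left_mono) simp
      then show "2 * int d * int s \<le> A" using A by simp
    qed simp
    moreover have "int r * (int d * int r) \<le> int r * A" using A by (rule mult_left_mono) simp
    moreover have "0 \<le> int r * int d * (int r - 1 - int s)"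
      using s2' False by (intro mult_nonneg_nonneg) auto
    ultimately show ?thesis by (simp add: algebra_simps)
  qed
  moreover have "int ((\<Sum>i=1..d. s * n i) + (d * s * r + ((\<Prod>i=1..d. n i) - s ^ d))) =
      int s * A + (int d * int s * int r + int ((\<Prod>i=1..d. n i) - s ^ d))"
    by (simp only: of_nat_add of_nat_mult e3)
  ultimately show ?thesis unfolding e1 e2 by linarith
qed

theorem theorem1p3:
  fixes scl :: "'k::alg_closed_field \<Rightarrow> 'v::ab_group_add \<Rightarrow> 'v"
    and V :: "nat \<Rightarrow> 'v set"
    and n :: "nat \<Rightarrow> nat"
    and d r s :: nat
  assumes "d \<ge> 2"
    and "vector_space scl"
    and "\<And>i. i \<in> {1..d} \<Longrightarrow> module.subspace scl (V i)"
    and "\<And>i. i \<in> {1..d} \<Longrightarrow> \<exists>B. finite B \<and> module.span scl B = V i"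
    and "\<And>i. i \<in> {1..d} \<Longrightarrow> vector_space.dim scl (V i) = n i"
    and "s = r div d"
  shows "constructible_dim (zariski_topology fun_scale (tensor_space d scl V))
           (border_subrank_locus d scl V r)
         \<le> ereal (real_of_int
              ((\<Prod>i=1..d. int (n i)) - int s ^ d
               + (\<Sum>i=1..d. 2 * int s * (int (n i) - int s))
               + int r * (1 + int d * (int r - 1) + (\<Sum>i=1..d. (int (n i) - int r)))))"
proof (cases "border_subrank_locus d scl V r = {}")
  case True
  \<comment> \<open>The empty locus is treated apart because r <= n i, on which the arithmetic
    rests, is obtained from a member of the locus.\<close>
  then have "constructible_dim (zariski_topology fun_scale (tensor_space d scl V))
           (border_subrank_locus d scl V r) = -\<infinity>"
    unfolding constructible_dim_def by (intro krull_dim_empty) simp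
  then show ?thesis by simp
next
  case False
  then obtain T where T: "T \<in> border_subrank_locus d scl V r" by blast
  have "\<forall>i\<in>{1..d}. \<exists>bc. (\<forall>k\<in>{1..n i}. fst bc k \<in> V i \<and> snd bc k \<in> Hom_space scl (V i) (*) UNIV) \<and>
      (\<forall>v\<in>V i. v = (\<Sum>k=1..n i. scl (snd bc k v) (fst bc k)))"
    using finite_dim_coordinates[OF assms(2,3,4,5)] by simp
  from bchoice[OF this] obtain bc where
    bc: "\<forall>i\<in>{1..d}. (\<forall>k\<in>{1..n i}. fst (bc i) k \<in> V i \<and> snd (bc i) k \<in> Hom_space scl (V i) (*) UNIV) \<and>
      (\<forall>v\<in>V i. v = (\<Sum>k=1..n i. scl (snd (bc i) k v) (fst (bc i) k)))" ..
  have coords: "tensor_coordinates scl V d n (\<lambda>i. fst (bc i)) (\<lambda>i. snd (bc i))"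
    using assms(2,3) bc by (intro tensor_coordinates.intro tensor_coordinates_axioms.intro) blast+
  have n: "r \<le> n i" if "i \<in> {1..d}" for i
    by (rule border_subrank_locus_restriction(1)[OF coords assms(1) T that])
  have "constructible_dim (zariski_topology fun_scale (tensor_space d scl V)) (border_subrank_locus d scl V r)
    \<le> ereal (real ((\<Sum>i=1..d. s * n i) + (d * s * r + ((\<Prod>i=1..d. n i) - s ^ d))))"
    by (rule border_subrank_locus_dim_le[OF coords assms(1,6)])
  also have "\<dots> = ereal (real_of_int (int ((\<Sum>i=1..d. s * n i) + (d * s * r + ((\<Prod>i=1..d. n i) - s ^ d)))))"
    by (simp only: of_int_of_nat_eq)
  also have "\<dots> \<le> ereal (real_of_int
              ((\<Prod>i=1..d. int (n i)) - int s ^ d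
               + (\<Sum>i=1..d. 2 * int s * (int (n i) - int s))
               + int r * (1 + int d * (int r - 1) + (\<Sum>i=1..d. (int (n i) - int r)))))"
    unfolding ereal_less_eq of_int_le_iff by (rule dimension_bound_arith[OF assms(1,6) n])
  finally show ?thesis .
qed

end
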